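(* Let $m\ge1$ and let $f=\nabla F$, where $F\in\mathcal C^3(\mathbb R^m,\mathbb R)$ is homogeneous of degree $6$. Then $$\mathcal Z\ne\emptyset\iff\exists u\in\mathbb R^m\text{ such that }F(u)>0.$$ Furthermore, if there exists $u\in\mathbb R^m$ such that $F(u)>0$, and $\omega\in S^{m-1}$ is such that $F(\omega)=\max_{u\in S^{m-1}}F(u)$, then letting $$\mu=(6F(\omega))^{-1/4},\qquad Z(x)=\mu W(x)\,\omega,$$ we have $Z\in\mathcal Z$ and $$\int_{\mathbb R^3} F(Z)=\min_{Q\in\mathcal N}\int_{\mathbb R^3} F(Q),\quad\text{where }\mathcal N=\left\{Q\in\dot H^1_{rad}(\mathbb R^3,\mathbb R^m)\setminus\{0\}:\ 6\int_{\mathbb R^3} F(Q)=\int_{\mathbb R^3}|\nabla Q|^2\right\}.$$ Conversely, any solution $Z\in\dot H^1_{rad}(\mathbb R^3,\mathbb R^m)\setminus\{0\}$ of this minimization problem (that is, any $Z\in\mathcal N$ with $\int_{\mathbb R^3} F(Z)=\min_{Q\in\mathcal N}\int_{\mathbb R^3} F(Q)$) is of the form $Z(x)=\mu W(x)\,\omega$ with $\mu=(6F(\omega))^{-1/4}$, where $\omega$ is a maximum point of $F$ on $S^{m-1}$.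
   Context: "Homogeneous of degree $6$" means $F(\lambda x)=\lambda^6F(x)$ for all $\lambda\ge0$, $x\in\mathbb R^m$. $\dot H^1_{rad}(\mathbb R^3,\mathbb R^m)$ is the space of radial functions in $\dot H^1(\mathbb R^3,\mathbb R^m)$. $\mathcal Z=\{Z\in\dot H^1_{rad}(\mathbb R^3,\mathbb R^m)\setminus\{0\}:\ -\Delta Z=f(Z)\}$. $S^{m-1}$ is the Euclidean unit sphere of $\mathbb R^m$. $W(x)=(1+|x|^2/3)^{-1/2}$ for $x\in\mathbb R^3$.
   Formalization: In the converse, a minimizer is shown to be Z(x) = s^{1/2} μ W(sx) ω a.e. for some s > 0, rather than exactly μ W(x) ω: the problem is scale invariant, so e.g. √2 W(2x) is also a minimizer for F(u) = u^6/6 and the literal claim is false. *)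

theory Defs
  imports "HOL-Analysis.Analysis"
begin

definition partial :: "'a::euclidean_space \<Rightarrow> ('a \<Rightarrow> 'b::real_normed_vector) \<Rightarrow> 'a \<Rightarrow> 'b" where
  "partial i f x = frechet_derivative f (at x) i"

text \<open>Differentiability is required separately because \<open>frechet_derivative\<close> is arbitrary
  where the function is not differentiable.\<close>

primrec Ck :: "nat \<Rightarrow> ('a::euclidean_space \<Rightarrow> 'b::real_normed_vector) \<Rightarrow> bool" where
  "Ck 0 f \<longleftrightarrow> continuous_on UNIV f"
| "Ck (Suc k) f \<longleftrightarrow> f differentiable_on UNIV \<and> (\<forall>i\<in>Basis. Ck k (partial i f))"

definition test_fun :: "('a::euclidean_space \<Rightarrow> real) \<Rightarrow> bool" where
  "test_fun \<phi> \<longleftrightarrow> (\<forall>k. Ck k \<phi>) \<and> compact (closure {x. \<phi> x \<noteq> 0})"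

definition laplacian :: "('a::euclidean_space \<Rightarrow> real) \<Rightarrow> 'a \<Rightarrow> real" where
  "laplacian \<phi> x = (\<Sum>i\<in>Basis. partial i (partial i \<phi>) x)"

definition loc_integrable :: "('a::euclidean_space \<Rightarrow> 'b::euclidean_space) \<Rightarrow> bool" where
  "loc_integrable u \<longleftrightarrow> (\<forall>K. compact K \<longrightarrow> u absolutely_integrable_on K)"

text \<open>Derivatives in the sense of distributions, for locally integrable functions
  whose derivative is again a locally integrable function.\<close>

definition has_weak_partial ::
  "'a::euclidean_space \<Rightarrow> ('a \<Rightarrow> 'b::euclidean_space) \<Rightarrow> ('a \<Rightarrow> 'b) \<Rightarrow> bool" where
  "has_weak_partial i u v \<longleftrightarrow> loc_integrable u \<and> loc_integrable v \<and>
     (\<forall>\<phi>. test_fun \<phi> \<longrightarrow>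
        (LINT x|lebesgue. partial i \<phi> x *\<^sub>R u x) = - (LINT x|lebesgue. \<phi> x *\<^sub>R v x))"

definition has_weak_laplacian ::
  "('a::euclidean_space \<Rightarrow> 'b::euclidean_space) \<Rightarrow> ('a \<Rightarrow> 'b) \<Rightarrow> bool" where
  "has_weak_laplacian u h \<longleftrightarrow> loc_integrable u \<and> loc_integrable h \<and>
     (\<forall>\<phi>. test_fun \<phi> \<longrightarrow>
        (LINT x|lebesgue. laplacian \<phi> x *\<^sub>R u x) = (LINT x|lebesgue. \<phi> x *\<^sub>R h x))"

text \<open>A weak partial derivative is unique up to a null set, so the choice below does not
  affect the integrals formed from it.\<close>

definition weak_partial ::
  "'a::euclidean_space \<Rightarrow> ('a \<Rightarrow> 'b::euclidean_space) \<Rightarrow> 'a \<Rightarrow> 'b" where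
  "weak_partial i u = (SOME v. has_weak_partial i u v)"

definition dirichlet :: "('a::euclidean_space \<Rightarrow> 'b::euclidean_space) \<Rightarrow> real" where
  "dirichlet u = (LINT x|lebesgue. (\<Sum>i\<in>Basis. (norm (weak_partial i u x))\<^sup>2))"

text \<open>In dimension 3 the homogeneous Sobolev space is a space of functions: those in
  \<open>L\<^sup>6\<close> (the Sobolev exponent) whose weak gradient is in \<open>L\<^sup>2\<close>.
  Its elements are represented here by functions rather than by classes modulo equality almost
  everywhere; hence radiality, and being nonzero, are stated almost everywhere.\<close>

definition H1dot :: "(real^3 \<Rightarrow> real^'m) set" where
  "H1dot = {u. u \<in> borel_measurable lebesgue \<and> integrable lebesgue (\<lambda>x. norm (u x) ^ 6) \<and>
     (\<forall>i\<in>Basis. \<exists>v. has_weak_partial i u v \<and> integrable lebesgue (\<lambda>x. (norm (v x))\<^sup>2))}"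

definition radial :: "(real^3 \<Rightarrow> 'b) \<Rightarrow> bool" where
  "radial u \<longleftrightarrow> (\<exists>g. AE x in lebesgue. u x = g (norm x))"

definition H1dot_rad_nz :: "(real^3 \<Rightarrow> real^'m) set" where
  "H1dot_rad_nz = {u \<in> H1dot. radial u \<and> \<not> (AE x in lebesgue. u x = 0)}"

definition stationary :: "(real^'m \<Rightarrow> real^'m) \<Rightarrow> (real^3 \<Rightarrow> real^'m) set" where
  "stationary f = {Z \<in> H1dot_rad_nz. has_weak_laplacian Z (\<lambda>x. - f (Z x))}"

definition potential :: "(real^'m \<Rightarrow> real) \<Rightarrow> (real^3 \<Rightarrow> real^'m) \<Rightarrow> real" where
  "potential F Q = (LINT x|lebesgue. F (Q x))"

definition nehari :: "(real^'m \<Rightarrow> real) \<Rightarrow> (real^3 \<Rightarrow> real^'m) set" where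
  "nehari F = {Q \<in> H1dot_rad_nz. 6 * potential F Q = dirichlet Q}"

definition W :: "real^3 \<Rightarrow> real" where
  "W x = (1 + (norm x)\<^sup>2 / 3) powr (- 1 / 2)"

definition mu :: "(real^'m \<Rightarrow> real) \<Rightarrow> real^'m \<Rightarrow> real" where
  "mu F \<omega> = (6 * F \<omega>) powr (- 1 / 4)"

end

theory Submission
  imports Defs "HOL-Real_Asymp.Real_Asymp" "HOL-Computational_Algebra.Polynomial"
    "HOL-Probability.Probability_Measure"
begin

text \<open>The problem reduces to one dimension. A radial function \<open>Q\<close> in the homogeneous Sobolev space has an
  absolutely continuous profile \<open>u\<close> on the half-line: testing the weak gradient with
  \<open>x \<psi>(|x|)/|x|\<^sup>3\<close> and averaging over directions turns it into a weak derivative \<open>w\<close> of \<open>u\<close>, and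
  averaging only decreases the Dirichlet integral. With \<open>\<rho> = r |u|\<^sup>2\<close>, \<open>M = max \<rho> = \<rho>(r0)\<close> and
  \<open>S = sqrt (1 - (\<rho>/M)\<^sup>2)\<close> one has, with the sign \<open>+\<close> for \<open>r > r0\<close> and \<open>-\<close> for \<open>r < r0\<close>,
  \<open>|r w + (1 \<plusminus> S) u / 2|\<^sup>2 = r\<^sup>2 |w|\<^sup>2 - r\<^sup>2 |u|\<^sup>6 / (4 M\<^sup>2) + (1 \<plusminus> S) \<rho>' / 2\<close>.
  Integrating gives \<open>\<integral> r\<^sup>2 |w|\<^sup>2 \<ge> (\<integral> r\<^sup>2 |u|\<^sup>6) / (4 M\<^sup>2) + \<pi> M / 4\<close>, and the inequality of the arithmetic
  and geometric means removes \<open>M\<close>: this is the sharp Sobolev inequality for vector-valued radial functions. In the case of equality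
  the squares vanish, so \<open>u\<close> solves a first-order equation whose solutions are the rescaled Talenti
  functions with a constant direction. Together with \<open>F(v) \<le> F(\<omega>) |v|\<^sup>6\<close> this solves the minimization
  problem. If \<open>F \<le> 0\<close> and \<open>Z\<close> is a solution, the flux \<open>r\<^sup>2 w \<bullet> u\<close> is nondecreasing and tends to zero
  along sequences at both ends, hence \<open>w = 0\<close> and \<open>Z = 0\<close>.\<close>

section \<open>Smooth functions\<close>

text \<open>The coefficients \<open>k = (1 \<plusminus> S) / 2\<close> are the two roots of
  \<open>k\<^sup>2 - k + (\<rho>/M)\<^sup>2 / 4 = 0\<close>. For either root,
  \<open>k |u|\<^sup>2\<close> and the cross term of the square add up to the exact derivative
  \<open>k \<rho>'\<close>, and what remains is the sextic term. The gain comes from using a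
  different root on each side of \<open>r0\<close>: the boundary terms then leave minus the integral
  of \<open>sqrt (1 - (x/M)\<^sup>2)\<close> over \<open>0..M\<close>, a quarter of an ellipse. The
  obstacle in the equality case is that the equation for \<open>\<rho>\<close> contains a square
  root vanishing at \<open>\<rho> = M\<close>. Its solutions are not unique, and
  \<open>\<rho>\<close> may rest at its maximum on an interval; the value of the mass that equality
  forces is what excludes such a plateau. Profiles are only absolutely continuous, so chain rules
  are proved in integral form. Both integrals of the minimization problem are invariant under the
  dilation of \<open>Q(x)\<close> to \<open>sqrt s Q(s x)\<close>, which translates
  \<open>\<rho>\<close> in the variable \<open>ln r\<close>; minimizers are therefore determined
  only up to this dilation.\<close>

lemma partial_eq: "(f has_derivative D) (at x) \<Longrightarrow> partial i f x = D i"
  unfolding partial_def by (metis frechet_derivative_at)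

text \<open>Exhibiting a derivative settles the differentiability clause and at the same time
  identifies the choice-based \<open>partial\<close>. The closure properties below use this rule in
  an induction on the order.\<close>

lemma Ck_SucI:
  assumes "\<And>x. (f has_derivative D x) (at x)" and "\<And>i. i \<in> Basis \<Longrightarrow> Ck k (\<lambda>x. D x i)"
  shows "Ck (Suc k) f"
proof -
  have "partial i f = (\<lambda>x. D x i)" for i
    using partial_eq[OF assms(1)] by auto
  then show ?thesis
    using assms by (auto simp: differentiable_on_def intro: differentiableI)
qed

lemma Ck_Suc_has_derivative:
  assumes "Ck (Suc k) f"
  shows "(f has_derivative (\<lambda>h. partial h f x)) (at x)"
proof -
  have "f differentiable (at x)"
    using assms by (simp add: differentiable_on_def)
  then show ?thesis
    unfolding partial_def by (metis frechet_derivative_works)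
qed

lemma Ck_Suc_partial: "Ck (Suc k) f \<Longrightarrow> i \<in> Basis \<Longrightarrow> Ck k (partial i f)"
  by simp

lemma Ck_Suc_real_derivative:
  assumes "Ck (Suc k) f"
  shows "(f has_real_derivative partial 1 f x) (at x)"
proof -
  have *: "(f has_derivative (\<lambda>h. partial h f x)) (at x)"
    by (rule Ck_Suc_has_derivative[OF assms])
  have "partial h f x = h * partial 1 f x" for h
    using linear_cmul[OF has_derivative_linear[OF *], of h 1] by simp
  then have "(\<lambda>h. partial h f x) = (*) (partial 1 f x)"
    by (intro ext) (metis mult.commute)
  with * show ?thesis
    by (simp add: has_field_derivative_def)
qed

lemma Ck_real_SucI:
  assumes "\<And>x. (f has_real_derivative f' x) (at x)" and "Ck k f'"
  shows "Ck (Suc k) f"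
  by (rule Ck_SucI[where D = "\<lambda>x. (*) (f' x)"])
     (use assms in \<open>auto simp: has_field_derivative_def\<close>)

lemma Ck_continuous: "Ck k f \<Longrightarrow> continuous_on UNIV f"
  by (cases k) (auto intro: differentiable_imp_continuous_on)

lemma Ck_SucD: "Ck (Suc k) f \<Longrightarrow> Ck k f"
proof (induction k arbitrary: f)
  case 0
  then show ?case by (auto intro: differentiable_imp_continuous_on)
next
  case (Suc k)
  then show ?case by (metis Ck.simps(2))
qed

lemma Ck_const [simp]: "Ck k (\<lambda>x. c)"
proof (induction k arbitrary: c)
  case (Suc k)
  show ?case by (rule Ck_SucI[where D = "\<lambda>x h. 0"]) (use Suc in auto)
qed simp

lemma Ck_add: "Ck k f \<Longrightarrow> Ck k g \<Longrightarrow> Ck k (\<lambda>x. f x + g x)"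
proof (induction k arbitrary: f g)
  case 0
  then show ?case by (auto intro: continuous_intros)
next
  case (Suc k)
  show ?case
    by (rule Ck_SucI[where D = "\<lambda>x h. partial h f x + partial h g x"])
       (use Suc in \<open>auto intro!: has_derivative_add Ck_Suc_has_derivative simp del: Ck.simps intro: Ck_Suc_partial\<close>)
qed

lemma Ck_mult:
  fixes f g :: "'a::euclidean_space \<Rightarrow> real"
  shows "Ck k f \<Longrightarrow> Ck k g \<Longrightarrow> Ck k (\<lambda>x. f x * g x)"
proof (induction k arbitrary: f g)
  case 0
  then show ?case by (auto intro: continuous_intros)
next
  case (Suc k)
  \<comment> \<open>The product rule leaves one factor undifferentiated, so both factors are also
    needed at the lower order.\<close>
  have "Ck k f" "Ck k g" using Suc.prems Ck_SucD by auto
  show ?case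
    by (rule Ck_SucI[where D = "\<lambda>x h. f x * partial h g x + partial h f x * g x"])
       (use Suc \<open>Ck k f\<close> \<open>Ck k g\<close> in \<open>auto intro!: Ck_add Suc.IH has_derivative_mult Ck_Suc_has_derivative simp del: Ck.simps intro: Ck_Suc_partial\<close>)
qed

lemma Ck_diff:
  fixes f g :: "'a::euclidean_space \<Rightarrow> real"
  assumes "Ck k f" "Ck k g"
  shows "Ck k (\<lambda>x. f x - g x)"
  using Ck_add[OF assms(1) Ck_mult[OF Ck_const[of k "-1"] assms(2)]] by simp

lemma Ck_linear:
  fixes f :: "'a::euclidean_space \<Rightarrow> 'b::real_normed_vector"
  assumes "bounded_linear f"
  shows "Ck k f"
proof (cases k)
  case 0
  then show ?thesis using assms by (simp add: linear_continuous_on)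
next
  case (Suc n)
  show ?thesis unfolding Suc
    by (rule Ck_SucI[where D = "\<lambda>x. f"]) (use bounded_linear_imp_has_derivative[OF assms] in auto)
qed

lemma Ck_inner_left: "Ck k (\<lambda>x. x \<bullet> v)"
  by (intro Ck_linear bounded_linear_intros)

lemma Ck_sum:
  assumes "\<And>i. i \<in> I \<Longrightarrow> Ck k (f i)"
  shows "Ck k (\<lambda>x. \<Sum>i\<in>I. f i x)"
  using assms by (induction I rule: infinite_finite_induct) (auto intro: Ck_add)

lemma Ck_prod:
  fixes f :: "'i \<Rightarrow> 'a::euclidean_space \<Rightarrow> real"
  assumes "\<And>i. i \<in> I \<Longrightarrow> Ck k (f i)"
  shows "Ck k (\<lambda>x. \<Prod>i\<in>I. f i x)"
  using assms by (induction I rule: infinite_finite_induct) (auto intro: Ck_mult)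

lemma Ck_compose:
  fixes g :: "real \<Rightarrow> real" and f :: "'a::euclidean_space \<Rightarrow> real"
  shows "Ck k g \<Longrightarrow> Ck k f \<Longrightarrow> Ck k (\<lambda>x. g (f x))"
proof (induction k arbitrary: f g)
  case 0
  then have "continuous_on UNIV (g \<circ> f)"
    by (intro continuous_on_compose) (auto intro: continuous_on_subset)
  then show ?case by (simp add: o_def)
next
  case (Suc k)
  have f: "Ck k f" using Suc.prems Ck_SucD by auto
  have "((\<lambda>x. g (f x)) has_derivative (\<lambda>h. partial 1 g (f x) * partial h f x)) (at x)" for x
    using has_derivative_compose[OF Ck_Suc_has_derivative[OF Suc.prems(2)]
        Ck_Suc_real_derivative[OF Suc.prems(1), unfolded has_field_derivative_def]] by simp
  moreover have "Ck k (\<lambda>x. partial 1 g (f x) * partial i f x)" if "i \<in> Basis" for i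
    using Suc.IH[OF Ck_Suc_partial[OF Suc.prems(1)] f] Ck_Suc_partial[OF Suc.prems(2) that]
    by (intro Ck_mult) auto
  ultimately show ?case by (rule Ck_SucI)
qed

lemma Ck_exp: "Ck k (exp :: real \<Rightarrow> real)"
proof (induction k)
  case 0
  show ?case by (simp add: continuous_on_exp)
next
  case (Suc k)
  show ?case by (rule Ck_real_SucI[OF DERIV_exp Suc])
qed

lemma Ck_power2_norm: "Ck k (\<lambda>x::'a::euclidean_space. (norm x)\<^sup>2)"
proof -
  have "(norm x)\<^sup>2 = (\<Sum>i\<in>Basis. (x \<bullet> i) * (x \<bullet> i))" for x :: 'a
    by (simp add: power2_norm_eq_inner euclidean_inner[of x x])
  then show ?thesis
    by (simp add: Ck_sum Ck_mult Ck_inner_left)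
qed

section \<open>Bump functions\<close>

text \<open>The flat function \<open>exp (- 1/t)\<close> together with all its derivatives: the
  family is closed under differentiation, so smoothness becomes a plain induction over all
  polynomials \<open>p\<close>.\<close>

definition flat_poly :: "real poly \<Rightarrow> real \<Rightarrow> real" where
  "flat_poly p t = (if t \<le> 0 then 0 else poly p (1 / t) * exp (- (1 / t)))"

lemma poly_exp_decay: "((\<lambda>s::real. poly p s * exp (- s)) \<longlongrightarrow> 0) at_top"
proof (induction p)
  case (pCons a p)
  have "((\<lambda>s::real. a * exp (- s) + s * (poly p s * exp (- s))) \<longlongrightarrow> 0) at_top" if "p \<noteq> 0"
  proof -
    have "((\<lambda>s::real. s ^ k * exp (- s)) \<longlongrightarrow> 0) at_top" for k
      using tendsto_power_div_exp_0[of k] by (simp add: exp_minus divide_inverse)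
    then have "((\<lambda>s::real. \<Sum>i\<le>degree p. coeff p i * (s ^ Suc i * exp (- s))) \<longlongrightarrow> (\<Sum>i\<le>degree p. coeff p i * 0)) at_top"
      by (intro tendsto_intros)
    moreover have "(\<Sum>i\<le>degree p. coeff p i * (s ^ Suc i * exp (- s))) = s * (poly p s * exp (- s))" for s :: real
      by (simp add: poly_altdef sum_distrib_left sum_distrib_right algebra_simps)
    ultimately have "((\<lambda>s::real. s * (poly p s * exp (- s))) \<longlongrightarrow> 0) at_top" by simp
    moreover have "((\<lambda>s::real. a * exp (- s)) \<longlongrightarrow> 0) at_top" by real_asymp
    ultimately show ?thesis using tendsto_add by fastforce
  qed
  moreover have "((\<lambda>s::real. a * exp (- s)) \<longlongrightarrow> 0) at_top" by real_asymp
  ultimately show ?case by (cases "p = 0") (auto simp: algebra_simps)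
qed simp

lemma flat_poly_tendsto_0: "(flat_poly p \<longlongrightarrow> 0) (at 0)"
proof -
  have "((\<lambda>t::real. poly p (inverse t) * exp (- inverse t)) \<longlongrightarrow> 0) (at_right 0)"
    using filterlim_compose[OF poly_exp_decay filterlim_inverse_at_top_right] .
  then have "(flat_poly p \<longlongrightarrow> 0) (at_right 0)"
    by (rule Lim_transform_eventually)
       (auto simp: flat_poly_def eventually_at_filter inverse_eq_divide)
  moreover have "(flat_poly p \<longlongrightarrow> 0) (at_left 0)"
    by (rule Lim_transform_eventually[OF tendsto_const])
       (auto simp: flat_poly_def eventually_at_filter)
  ultimately show ?thesis by (simp add: filterlim_split_at)
qed

text \<open>With \<open>s = 1/t\<close> one has \<open>d/dt = - s\<^sup>2 d/ds\<close>, which sends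
  \<open>p(s) exp (- s)\<close> to \<open>s\<^sup>2 (p - p')(s) exp (- s)\<close>.\<close>

lemma flat_poly_DERIV:
  "(flat_poly p has_real_derivative flat_poly ([:0, 0, 1:] * (p - pderiv p)) t) (at t)"
proof -
  consider "t < 0" | "t = 0" | "t > 0" by linarith
  then show ?thesis
  proof cases
    case 1
    have "eventually (\<lambda>x. x < 0) (nhds t)" 
      using 1 eventually_nhds_in_open[of "{..<0}" t] by simp
    then have "eventually (\<lambda>x. flat_poly p x = 0) (nhds t)"
      by eventually_elim (auto simp: flat_poly_def)
    then show ?thesis
      using 1 by (subst DERIV_cong_ev[OF refl _ refl]) (auto simp: flat_poly_def)
  next
    case 2
    \<comment> \<open>For \<open>h > 0\<close> the difference quotient at the origin is again a
      member of the family, with \<open>p\<close> multiplied by the variable, so it tends to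
      zero.\<close>
    have "((\<lambda>h. (flat_poly p (0 + h) - flat_poly p 0) / h) \<longlongrightarrow> 0) (at 0)"
      by (rule Lim_transform_eventually[OF flat_poly_tendsto_0[of "[:0,1:] * p"]])
         (auto simp: flat_poly_def eventually_at_filter)
    then show ?thesis using 2 by (simp add: DERIV_def flat_poly_def)
  next
    case 3
    have "eventually (\<lambda>x. x > 0) (nhds t)" 
      using 3 eventually_nhds_in_open[of "{0<..}" t] by simp
    then have *: "eventually (\<lambda>x. flat_poly p x = poly p (1 / x) * exp (- (1 / x))) (nhds t)"
      by eventually_elim (auto simp: flat_poly_def)
    have "((\<lambda>x. poly p (1 / x) * exp (- (1 / x))) has_real_derivative
        flat_poly ([:0, 0, 1:] * (p - pderiv p)) t) (at t)"
      using 3 by (auto intro!: derivative_eq_intros poly_DERIV[THEN DERIV_chain2] simp: flat_poly_def power2_eq_square algebra_simps)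
    then show ?thesis by (subst DERIV_cong_ev[OF refl * refl])
  qed
qed

lemma Ck_flat_poly: "Ck k (flat_poly p)"
proof (induction k arbitrary: p)
  case 0
  show ?case using DERIV_continuous_on[of UNIV "flat_poly p"] flat_poly_DERIV by auto
next
  case (Suc k)
  show ?case by (rule Ck_real_SucI[OF flat_poly_DERIV Suc])
qed

lemma flat_poly_1: "flat_poly 1 t \<ge> 0" "flat_poly 1 t > 0 \<longleftrightarrow> t > 0"
  by (auto simp: flat_poly_def)

lemma Ck_affine_compose:
  fixes g :: "real \<Rightarrow> real" and c :: real
  assumes "Ck k g"
  shows "Ck k (\<lambda>x::'a::euclidean_space. g (x \<bullet> v - c))" "Ck k (\<lambda>x::'a. g (c - x \<bullet> v))"
  using Ck_compose[OF assms Ck_diff[OF Ck_inner_left Ck_const]]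
    Ck_compose[OF assms Ck_diff[OF Ck_const Ck_inner_left]] by auto

text \<open>The product is smooth and positive exactly on the open box. The outer function saturates
  it, so that for growing \<open>n\<close> the values stay in the unit interval and converge to the
  indicator of the box; no convolution is involved.\<close>

definition box_bump :: "'a::euclidean_space \<Rightarrow> 'a \<Rightarrow> nat \<Rightarrow> 'a \<Rightarrow> real" where
  "box_bump a b n x = 1 - exp (- (real n * (\<Prod>i\<in>Basis. flat_poly 1 (x \<bullet> i - a \<bullet> i) * flat_poly 1 (b \<bullet> i - x \<bullet> i))))"

lemma Ck_box_bump: "Ck k (box_bump a b n)"
proof -
  have "Ck k (\<lambda>x. \<Prod>i\<in>Basis. flat_poly 1 (x \<bullet> i - a \<bullet> i) * flat_poly 1 (b \<bullet> i - x \<bullet> i))"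
    by (intro Ck_prod Ck_mult Ck_affine_compose Ck_flat_poly)
  then have "Ck k (\<lambda>x. - real n * (\<Prod>i\<in>Basis. flat_poly 1 (x \<bullet> i - a \<bullet> i) * flat_poly 1 (b \<bullet> i - x \<bullet> i)))"
    by (intro Ck_mult Ck_const)
  from Ck_diff[OF Ck_const[of k 1] Ck_compose[OF Ck_exp this]] show ?thesis
    by (simp add: box_bump_def[abs_def])
qed

lemma box_bump_0: "x \<notin> box a b \<Longrightarrow> box_bump a b n x = 0"
proof -
  assume "x \<notin> box a b"
  then obtain i where i: "i \<in> Basis" "\<not> (a \<bullet> i < x \<bullet> i \<and> x \<bullet> i < b \<bullet> i)" by (auto simp: mem_box)
  then have "flat_poly 1 (x \<bullet> i - a \<bullet> i) * flat_poly 1 (b \<bullet> i - x \<bullet> i) = 0"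
    by (auto simp: flat_poly_def)
  then have "(\<Prod>i\<in>Basis. flat_poly 1 (x \<bullet> i - a \<bullet> i) * flat_poly 1 (b \<bullet> i - x \<bullet> i)) = 0"
    using i(1) by (intro prod_zero) auto
  then show ?thesis by (simp add: box_bump_def)
qed

lemma box_bump_bounds: "0 \<le> box_bump a b n x" "box_bump a b n x \<le> 1"
proof -
  have "(\<Prod>i\<in>Basis. flat_poly 1 (x \<bullet> i - a \<bullet> i) * flat_poly 1 (b \<bullet> i - x \<bullet> i)) \<ge> 0"
    by (intro prod_nonneg) (auto simp: flat_poly_1)
  then show "0 \<le> box_bump a b n x" "box_bump a b n x \<le> 1" by (auto simp: box_bump_def)
qed

lemma box_bump_tendsto: "(\<lambda>n. box_bump a b n x) \<longlonglongrightarrow> indicator (box a b) x"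
proof (cases "x \<in> box a b")
  case True
  define p where "p = (\<Prod>i\<in>Basis. flat_poly 1 (x \<bullet> i - a \<bullet> i) * flat_poly 1 (b \<bullet> i - x \<bullet> i))"
  have "p > 0" unfolding p_def
    by (intro prod_pos) (use True in \<open>auto simp: mem_box flat_poly_1\<close>)
  then have "(\<lambda>n. 1 - exp (- (real n * p))) \<longlonglongrightarrow> 1" by real_asymp
  then show ?thesis using True by (simp add: box_bump_def p_def)
next
  case False
  then show ?thesis by (simp add: box_bump_0)
qed

lemma box_bump_pos: "x \<in> box a b \<Longrightarrow> box_bump a b (Suc 0) x > 0"
  unfolding box_bump_def using prod_pos[of Basis "\<lambda>i. flat_poly 1 (x \<bullet> i - a \<bullet> i) * flat_poly 1 (b \<bullet> i - x \<bullet> i)"]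
  by (auto simp: mem_box flat_poly_1)

lemma test_funI:
  assumes "\<And>k. Ck k \<phi>" and "compact K" and "\<And>x. x \<notin> K \<Longrightarrow> \<phi> x = 0"
  shows "test_fun \<phi>"
proof -
  have "closure {x. \<phi> x \<noteq> 0} \<subseteq> K"
    using assms(2,3) by (intro closure_minimal) (auto intro: compact_imp_closed)
  then have "compact (closure {x. \<phi> x \<noteq> 0})"
    using assms(2) by (metis closed_closure compact_Int_closed inf.absorb_iff2)
  then show ?thesis using assms(1) by (simp add: test_fun_def)
qed

lemma test_fun_box_bump: "test_fun (box_bump a b n)"
  by (rule test_funI[OF Ck_box_bump compact_cbox[of a b]]) (use box_bump_0 box_subset_cbox in blast)

lemma test_funE:
  assumes "test_fun \<phi>"
  obtains K where "compact K" "\<And>x. x \<notin> K \<Longrightarrow> \<phi> x = 0"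
proof
  show "compact (closure {x. \<phi> x \<noteq> 0})" using assms by (simp add: test_fun_def)
  show "\<phi> x = 0" if "x \<notin> closure {x. \<phi> x \<noteq> 0}" for x
    using that closure_subset[of "{x. \<phi> x \<noteq> 0}"] by auto
qed

lemma test_fun_Ck: "test_fun \<phi> \<Longrightarrow> Ck k \<phi>"
  by (simp add: test_fun_def)

lemma partial_outside:
  assumes "closed K" "\<And>x. x \<notin> K \<Longrightarrow> \<phi> x = 0" "x \<notin> K"
  shows "partial i \<phi> x = 0"
proof -
  have "(\<phi> has_derivative (\<lambda>h. 0)) (at x)"
    by (rule has_derivative_transform_within_open[where s = "-K" and f = "\<lambda>x. 0"]) (use assms in auto)
  then show ?thesis by (simp add: partial_eq)
qed

lemma test_fun_partial:
  assumes "test_fun \<phi>" "i \<in> Basis"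
  shows "test_fun (partial i \<phi>)"
proof -
  obtain K where K: "compact K" "\<And>x. x \<notin> K \<Longrightarrow> \<phi> x = 0" using test_funE[OF assms(1)] by metis
  show ?thesis
    by (rule test_funI[OF _ K(1)])
       (use assms test_fun_Ck[OF assms(1)] partial_outside[OF compact_imp_closed[OF K(1)] K(2)] in \<open>auto intro: Ck_Suc_partial\<close>)
qed

section \<open>Radial test functions\<close>

text \<open>The quotient \<open>\<psi> r / r ^ k\<close> as a function of
  \<open>s = r\<^sup>2\<close>: the squared norm is smooth at the origin while the norm is not, so
  smoothness of radial functions follows by composition.\<close>

definition sqrt_quot :: "(real \<Rightarrow> real) \<Rightarrow> nat \<Rightarrow> real \<Rightarrow> real" where
  "sqrt_quot \<psi> k s = (if s \<le> 0 then 0 else \<psi> (sqrt s) / sqrt s ^ k)"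

lemma sqrt_quot_norm: "\<psi> 0 = 0 \<Longrightarrow> sqrt_quot \<psi> k ((norm x)\<^sup>2) = \<psi> (norm x) / norm x ^ k"
  by (auto simp: sqrt_quot_def)

text \<open>Chain rule with the derivative \<open>1 / (2 sqrt s)\<close> of the square root. The
  result stays in the same family, which drives the induction in \<open>Ck_sqrt_quot\<close>; near
  \<open>s \<le> 0\<close> everything is zero because \<open>\<psi>\<close> vanishes below
  \<open>a\<close>.\<close>

lemma sqrt_quot_DERIV:
  assumes "Ck 1 \<psi>" and a: "0 < a" "\<And>t. t < a \<Longrightarrow> \<psi> t = 0"
  shows "(sqrt_quot \<psi> k has_real_derivative
    (1 / 2) * sqrt_quot (partial 1 \<psi>) (k + 1) s - (real k / 2) * sqrt_quot \<psi> (k + 2) s) (at s)"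
proof (cases "s > 0")
  case True
  have d: "(\<psi> has_real_derivative partial 1 \<psi> t) (at t)" for t
    by (rule Ck_Suc_real_derivative[of 0]) (use assms in simp)
  have "((\<lambda>s. \<psi> (sqrt s) / sqrt s ^ k) has_real_derivative
      (partial 1 \<psi> (sqrt s) * (inverse (sqrt s) / 2) * sqrt s ^ k -
       \<psi> (sqrt s) * (real k * (sqrt s ^ (k - 1)) * (inverse (sqrt s) / 2))) / (sqrt s ^ k * sqrt s ^ k)) (at s)"
    using True by (auto intro!: derivative_eq_intros DERIV_chain2[OF d] DERIV_real_sqrt DERIV_power)
  moreover have "(partial 1 \<psi> (sqrt s) * (inverse (sqrt s) / 2) * sqrt s ^ k -
       \<psi> (sqrt s) * (real k * (sqrt s ^ (k - 1)) * (inverse (sqrt s) / 2))) / (sqrt s ^ k * sqrt s ^ k)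
     = (1 / 2) * sqrt_quot (partial 1 \<psi>) (k + 1) s - (real k / 2) * sqrt_quot \<psi> (k + 2) s"
    using True by (cases k) (simp_all add: sqrt_quot_def divide_simps, simp_all add: algebra_simps)
  moreover have "eventually (\<lambda>x. sqrt_quot \<psi> k x = \<psi> (sqrt x) / sqrt x ^ k) (nhds s)"
    using eventually_nhds_in_open[of "{0<..}" s] True by (auto elim!: eventually_mono simp: sqrt_quot_def)
  ultimately show ?thesis
    by (subst DERIV_cong_ev[OF refl _ refl]) auto
next
  case False
  have *: "sqrt_quot \<psi> k x = 0" if "x < a\<^sup>2" for x k
  proof -
    have "x > 0 \<Longrightarrow> sqrt x < a" using that \<open>0 < a\<close> by (simp add: real_less_lsqrt)
    then show ?thesis using a(2) by (auto simp: sqrt_quot_def)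
  qed
  have "eventually (\<lambda>x. sqrt_quot \<psi> k x = 0) (nhds s)"
  proof (rule eventually_mono)
    show "\<forall>\<^sub>F x in nhds s. x \<in> {..<a\<^sup>2}"
      using False a by (intro eventually_nhds_in_open) (auto intro: le_less_trans[of s 0])
  qed (use * in auto)
  then show ?thesis
    using False by (subst DERIV_cong_ev[OF refl _ refl]) (auto simp: sqrt_quot_def)
qed

lemma partial_vanish_below:
  assumes "\<And>t::real. t < a \<Longrightarrow> \<psi> t = 0" "t < a"
  shows "partial i \<psi> t = 0"
  by (rule partial_outside[of "{a..}"]) (use assms in auto)

lemma Ck_sqrt_quot:
  assumes "\<And>n. Ck n \<psi>" and a: "0 < a" "\<And>t. t < a \<Longrightarrow> \<psi> t = 0"
  shows "Ck n (sqrt_quot \<psi> k)"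
  using assms
proof (induction n arbitrary: \<psi> k)
  case 0
  show ?case
    using DERIV_continuous_on[of UNIV "sqrt_quot \<psi> k", OF sqrt_quot_DERIV[OF 0]] by simp
next
  case (Suc n)
  have p: "Ck m (partial 1 \<psi>)" for m using Suc.prems(1)[of "Suc m"] by (intro Ck_Suc_partial) auto
  have "Ck n (\<lambda>s. (1 / 2) * sqrt_quot (partial 1 \<psi>) (k + 1) s - (real k / 2) * sqrt_quot \<psi> (k + 2) s)"
    by (intro Ck_diff Ck_mult Ck_const Suc.IH p Suc.prems partial_vanish_below) (use Suc.prems in auto)
  then show ?case
    by (rule Ck_real_SucI[OF sqrt_quot_DERIV[OF Suc.prems], rotated])
qed

context
  fixes \<psi> :: "real \<Rightarrow> real" and a b :: real
  assumes smooth: "\<And>n. Ck n \<psi>" and a: "0 < a"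
    and supp: "\<And>t. t \<notin> {a..b} \<Longrightarrow> \<psi> t = 0"
begin

lemma test_fun_radial_quot:
  assumes "\<And>n. Ck n p"
  shows "test_fun (\<lambda>x::'a::euclidean_space. p x * (\<psi> (norm x) / norm x ^ k))"
proof (rule test_funI)
  have "\<psi> 0 = 0" using a supp by auto
  then have eq: "(\<lambda>x. \<psi> (norm x) / norm x ^ k) = (\<lambda>x::'a. sqrt_quot \<psi> k ((norm x)\<^sup>2))"
    by (simp add: sqrt_quot_norm)
  have "Ck n (\<lambda>x::'a. \<psi> (norm x) / norm x ^ k)" for n
    unfolding eq by (rule Ck_compose[OF Ck_sqrt_quot[OF smooth a] Ck_power2_norm]) (use supp in auto)
  then show "Ck n (\<lambda>x::'a. p x * (\<psi> (norm x) / norm x ^ k))" for n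
    by (intro Ck_mult assms)
  show "compact (cball (0::'a) b)" by simp
  show "p x * (\<psi> (norm x) / norm x ^ k) = 0" if "x \<notin> cball 0 b" for x :: 'a
    using that supp by auto
qed

lemma has_derivative_radial_quot:
  "((\<lambda>x::'a::euclidean_space. \<psi> (norm x) / norm x ^ k) has_derivative
    (\<lambda>h. (partial 1 \<psi> (norm x) / norm x ^ k - real k * \<psi> (norm x) / norm x ^ (k + 1)) * (h \<bullet> sgn x))) (at x)"
proof (cases "x = 0")
  case True
  \<comment> \<open>The function vanishes in a ball around the origin, and the claimed formula gives
    zero there because \<open>sgn 0 = 0\<close>.\<close>
  have "((\<lambda>x::'a. \<psi> (norm x) / norm x ^ k) has_derivative (\<lambda>h. 0)) (at 0)"
    by (rule has_derivative_transform_within_open[where s = "ball 0 a" and f = "\<lambda>x. 0"]) (use a supp in auto)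
  then show ?thesis using True by simp
next
  case False
  have d: "(\<psi> has_real_derivative partial 1 \<psi> t) (at t)" for t
    by (rule Ck_Suc_real_derivative[of 0]) (use smooth in simp)
  have "((\<lambda>r. \<psi> r / r ^ k) has_real_derivative
     (partial 1 \<psi> r / r ^ k - real k * \<psi> r / r ^ (k + 1))) (at r)" if "r > 0" for r
  proof -
    have "((\<lambda>r. \<psi> r / r ^ k) has_real_derivative
      (partial 1 \<psi> r * r ^ k - \<psi> r * (real k * r ^ (k - 1))) / (r ^ k * r ^ k)) (at r)"
      using that by (auto intro!: derivative_eq_intros d)
    moreover have "(partial 1 \<psi> r * r ^ k - \<psi> r * (real k * r ^ (k - 1))) / (r ^ k * r ^ k)
       = partial 1 \<psi> r / r ^ k - real k * \<psi> r / r ^ (k + 1)"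
      using that by (cases k) (simp_all add: field_simps)
    ultimately show ?thesis by simp
  qed
  from has_derivative_compose[OF has_derivative_norm[OF False] this[unfolded has_field_derivative_def]] False
  show ?thesis by (simp add: o_def sgn_div_norm inner_commute)
qed

lemma partial_radial: "partial i (\<lambda>x::'a::euclidean_space. \<psi> (norm x)) x = partial 1 \<psi> (norm x) * (i \<bullet> sgn x)"
  using partial_eq[OF has_derivative_radial_quot[of 0 x]] by simp

text \<open>The flux field \<open>x / |x| ^ d\<close> is divergence free away from the origin, so
  multiplying it by \<open>\<psi>\<close> leaves only the term with the derivative of
  \<open>\<psi>\<close>. Tested against such a field, a weak gradient yields a one-dimensional weak
  derivative of the profile.\<close>

lemma divergence_radial:
  "(\<Sum>i\<in>Basis. partial i (\<lambda>x::'a::euclidean_space. (x \<bullet> i) * (\<psi> (norm x) / norm x ^ DIM('a))) x)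
     = partial 1 \<psi> (norm x) / norm x ^ (DIM('a) - 1)"
proof -
  define A where "A = partial 1 \<psi> (norm x) / norm x ^ DIM('a) - real DIM('a) * \<psi> (norm x) / norm x ^ (DIM('a) + 1)"
  have "((\<lambda>x::'a. (x \<bullet> i) * (\<psi> (norm x) / norm x ^ DIM('a))) has_derivative
     (\<lambda>h. (x \<bullet> i) * (A * (h \<bullet> sgn x)) + (h \<bullet> i) * (\<psi> (norm x) / norm x ^ DIM('a)))) (at x)" for i
    unfolding A_def
    by (rule has_derivative_mult[OF bounded_linear_imp_has_derivative[OF bounded_linear_inner_left] has_derivative_radial_quot])
  note * = partial_eq[OF this]
  have "(\<Sum>i\<in>Basis. partial i (\<lambda>x::'a. (x \<bullet> i) * (\<psi> (norm x) / norm x ^ DIM('a))) x)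
    = (\<Sum>i\<in>Basis. A * ((x \<bullet> i) * (sgn x \<bullet> i)) + \<psi> (norm x) / norm x ^ DIM('a))"
    by (intro sum.cong refl) (subst *, simp add: inner_same_Basis inner_commute[of _ "sgn x"])
  also have "\<dots> = A * (x \<bullet> sgn x) + real DIM('a) * (\<psi> (norm x) / norm x ^ DIM('a))"
    by (simp add: sum.distrib sum_distrib_left[symmetric] euclidean_inner[of x "sgn x"])
  also have "x \<bullet> sgn x = norm x"
    by (cases "x = 0") (simp_all add: sgn_div_norm power2_norm_eq_inner[symmetric] power2_eq_square)
  also have "A * norm x + real DIM('a) * (\<psi> (norm x) / norm x ^ DIM('a)) = partial 1 \<psi> (norm x) / norm x ^ (DIM('a) - 1)"
  proof (cases "x = 0")
    case True
    have "partial 1 \<psi> 0 = 0" "\<psi> 0 = 0" using partial_vanish_below[of a \<psi> 0] a supp by auto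
    then show ?thesis using True by simp
  next
    case False
    obtain d where "DIM('a) = Suc d" using DIM_positive by (metis gr0_implies_Suc)
    then show ?thesis using False unfolding A_def by (simp add: field_simps)
  qed
  finally show ?thesis .
qed

end

section \<open>The fundamental lemma and weak derivatives\<close>

text \<open>By Lebesgue differentiation \<open>v x\<close> is, for almost every \<open>x\<close>,
  the limit of averages over shrinking cubes with corner \<open>x\<close>, and these averages
  vanish. Countably many closed boxes exhaust the open set.\<close>

lemma integrals_zero_imp_AE_zero:
  fixes v :: "'a::euclidean_space \<Rightarrow> 'b::euclidean_space"
  assumes "open \<Omega>"
    and int: "\<And>a b. cbox a b \<subseteq> \<Omega> \<Longrightarrow> v absolutely_integrable_on cbox a b"
    and zero: "\<And>a b. cbox a b \<subseteq> \<Omega> \<Longrightarrow> integral (cbox a b) v = 0"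
  shows "AE x in lebesgue. x \<in> \<Omega> \<longrightarrow> v x = 0"
proof -
  have box: "negligible {x \<in> cbox c d. v x \<noteq> 0}" if cd: "cbox c d \<subseteq> \<Omega>" for c d
  proof -
    define f where "f x = (if x \<in> cbox c d then v x else 0)" for x
    have "f absolutely_integrable_on UNIV"
      unfolding f_def using int[OF cd] absolutely_integrable_restrict_UNIV by blast
    then have "f integrable_on cbox a b" for a b
      using set_lebesgue_integral_eq_integral(1) integrable_on_subcbox by blast
    then obtain N where N: "negligible N"
      "\<And>x e. \<lbrakk>x \<notin> N; 0 < e\<rbrakk> \<Longrightarrow> \<exists>d>0. \<forall>h. 0 < h \<and> h < d \<longrightarrow>
         norm (integral (cbox x (x + h *\<^sub>R One)) f /\<^sub>R h ^ DIM('a) - f x) < e"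
      using integrable_ccontinuous_explicit by metis
    have "v x = 0" if x: "x \<in> box c d" "x \<notin> N" for x
    proof (rule ccontr)
      assume "v x \<noteq> 0"
      then obtain \<delta> where \<delta>: "\<delta> > 0" "\<And>h. 0 < h \<Longrightarrow> h < \<delta> \<Longrightarrow>
         norm (integral (cbox x (x + h *\<^sub>R One)) f /\<^sub>R h ^ DIM('a) - f x) < norm (v x)"
        using N(2)[OF x(2), of "norm (v x)"] by auto
      \<comment> \<open>The largest side for which a cube with lower corner \<open>x\<close> still
        fits into \<open>cbox c d\<close>.\<close>
      define m where "m = Min ((\<lambda>i. d \<bullet> i - x \<bullet> i) ` Basis)"
      have "m > 0" using x(1) by (auto simp: m_def mem_box)
      define h where "h = min m \<delta> / 2"
      have h: "0 < h" "h < \<delta>" "h \<le> m" using \<open>m > 0\<close> \<delta>(1) by (auto simp: h_def)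
      have "h \<le> d \<bullet> i - x \<bullet> i" if "i \<in> Basis" for i
        using h(3) that unfolding m_def by (meson Min_le finite_Basis finite_imageI imageI order_trans)
      then have sub: "cbox x (x + h *\<^sub>R One) \<subseteq> cbox c d"
        using x(1) by (intro subset_box_imp) (force simp: mem_box inner_simps)
      have "integral (cbox x (x + h *\<^sub>R One)) f = integral (cbox x (x + h *\<^sub>R One)) v"
        by (rule integral_cong) (use sub in \<open>auto simp: f_def\<close>)
      also have "\<dots> = 0" using zero sub cd by blast
      finally have "norm (f x) < norm (v x)" using \<delta>(2)[OF h(1,2)] by simp
      moreover have "f x = v x" using x(1) box_subset_cbox by (auto simp: f_def)
      ultimately show False by simp
    qed
    then have "{x \<in> cbox c d. v x \<noteq> 0} \<subseteq> N \<union> (cbox c d - box c d)" by blast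
    moreover have "negligible (cbox c d - box c d)" by (rule negligible_frontier_interval)
    ultimately show ?thesis using N(1) by (meson negligible_Un negligible_subset)
  qed
  obtain D where D: "countable D" "D \<subseteq> Pow \<Omega>" "\<And>X. X \<in> D \<Longrightarrow> \<exists>a b. X = cbox a b" "\<Union>D = \<Omega>"
    using open_countable_Union_open_cbox[OF \<open>open \<Omega>\<close>] by metis
  have "negligible (\<Union>X\<in>D. {x \<in> X. v x \<noteq> 0})"
  proof (rule negligible_countable_Union)
    show "countable ((\<lambda>X. {x \<in> X. v x \<noteq> 0}) ` D)" using D(1) by auto
    show "negligible T" if "T \<in> (\<lambda>X. {x \<in> X. v x \<noteq> 0}) ` D" for T
      using that D(2,3) box by blast
  qed
  moreover have "(\<Union>X\<in>D. {x \<in> X. v x \<noteq> 0}) = {x. \<not> (x \<in> \<Omega> \<longrightarrow> v x = 0)}"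
    using D(4) by auto
  ultimately show ?thesis
    by (simp add: AE_iff_null_sets negligible_iff_null_sets eventually_ae_filter) blast
qed

lemma lebesgue_integral_box:
  fixes v :: "'a::euclidean_space \<Rightarrow> 'b::euclidean_space"
  assumes "v absolutely_integrable_on cbox a b"
  shows "(LINT x|lebesgue. indicator (box a b) x *\<^sub>R v x) = integral (cbox a b) v"
proof -
  have "v absolutely_integrable_on box a b"
    using set_integrable_subset[OF assms, of "box a b"] box_subset_cbox by auto
  then have "(LINT x|lebesgue. indicator (box a b) x *\<^sub>R v x) = integral (box a b) v"
    using set_lebesgue_integral_eq_integral(2)[of "box a b" v] by (simp add: set_lebesgue_integral_def)
  then show ?thesis by (simp add: integral_open_interval)
qed

text \<open>Dominated convergence carries information from test functions over to integrals on
  boxes; the open and the closed box differ by a null set.\<close>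

lemma integral_box_bump_tendsto:
  fixes v :: "'a::euclidean_space \<Rightarrow> 'b::euclidean_space"
  assumes v: "v absolutely_integrable_on cbox a b"
  shows "(\<lambda>n. LINT x|lebesgue. box_bump a b n x *\<^sub>R v x) \<longlonglongrightarrow> integral (cbox a b) v"
    "integrable lebesgue (\<lambda>x. box_bump a b n x *\<^sub>R v x)"
proof -
  define w where "w x = indicator (cbox a b) x *\<^sub>R v x" for x
  have w: "integrable lebesgue w"
    using v unfolding w_def set_integrable_def .
  have eq: "box_bump a b n x *\<^sub>R v x = box_bump a b n x *\<^sub>R w x" for n x
    using box_bump_0[of x a b n] box_subset_cbox[of a b] by (cases "x \<in> cbox a b") (auto simp: w_def)
  have bm: "box_bump a b n \<in> borel_measurable lebesgue" for n
    using borel_measurable_continuous_onI[OF Ck_continuous[OF Ck_box_bump[of 0 a b n]]] by (simp add: measurable_completion)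
  have [measurable]: "w \<in> borel_measurable lebesgue" using w by simp
  have m: "(\<lambda>x. box_bump a b n x *\<^sub>R w x) \<in> borel_measurable lebesgue" for n
    using bm by measurable
  have bd: "norm (box_bump a b n x *\<^sub>R w x) \<le> norm (w x)" for n x
    using box_bump_bounds[of a b n x] by (simp add: mult_left_le_one_le)
  show "integrable lebesgue (\<lambda>x. box_bump a b n x *\<^sub>R v x)"
    unfolding eq using w by (rule Bochner_Integration.integrable_bound) (use m bd in auto)
  have "(\<lambda>n. LINT x|lebesgue. box_bump a b n x *\<^sub>R w x) \<longlonglongrightarrow> (LINT x|lebesgue. indicator (box a b) x *\<^sub>R w x)"
  proof (rule integral_dominated_convergence[where w = "\<lambda>x. norm (w x)"])
    show "(\<lambda>x. indicator (box a b) x *\<^sub>R w x) \<in> borel_measurable lebesgue"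
      by (intro borel_measurable_scaleR borel_measurable_indicator) auto
    show "integrable lebesgue (\<lambda>x. norm (w x))" using w by simp
    show "AE x in lebesgue. (\<lambda>n. box_bump a b n x *\<^sub>R w x) \<longlonglongrightarrow> indicator (box a b) x *\<^sub>R w x"
      by (intro AE_I2 tendsto_intros box_bump_tendsto)
  qed (use m bd in auto)
  moreover have "indicator (box a b) x *\<^sub>R w x = indicator (box a b) x *\<^sub>R v x" for x
    using box_subset_cbox[of a b] by (auto simp: w_def indicator_def)
  ultimately show "(\<lambda>n. LINT x|lebesgue. box_bump a b n x *\<^sub>R v x) \<longlonglongrightarrow> integral (cbox a b) v"
    by (simp add: eq lebesgue_integral_box[OF v])
qed

lemma loc_integrable_cbox: "loc_integrable v \<Longrightarrow> v absolutely_integrable_on cbox a b"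
  by (simp add: loc_integrable_def)

lemma fundamental_lemma:
  fixes v :: "'a::euclidean_space \<Rightarrow> 'b::euclidean_space"
  assumes "loc_integrable v" and "\<And>\<phi>. test_fun \<phi> \<Longrightarrow> (LINT x|lebesgue. \<phi> x *\<^sub>R v x) = 0"
  shows "AE x in lebesgue. v x = 0"
proof -
  have "integral (cbox a b) v = 0" for a b
    using integral_box_bump_tendsto(1)[OF loc_integrable_cbox[OF assms(1)], of a b]
      assms(2)[OF test_fun_box_bump, of a b] by (simp add: LIMSEQ_const_iff)
  then show ?thesis
    using integrals_zero_imp_AE_zero[of UNIV v] loc_integrable_cbox[OF assms(1)] by auto
qed

lemma continuous_on_UNIV_lebesgue_measurable:
  "continuous_on UNIV (f::'a::euclidean_space \<Rightarrow> 'b::euclidean_space) \<Longrightarrow> f \<in> borel_measurable lebesgue"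
  by (simp add: borel_measurable_continuous_onI measurable_completion)

lemma integrable_compact_support_scaleR:
  fixes v :: "'a::euclidean_space \<Rightarrow> 'b::euclidean_space" and \<phi> :: "'a \<Rightarrow> real"
  assumes "loc_integrable v" "compact K" "\<And>x. x \<notin> K \<Longrightarrow> \<phi> x = 0" "continuous_on UNIV \<phi>"
  shows "integrable lebesgue (\<lambda>x. \<phi> x *\<^sub>R v x)"
proof -
  define w where "w x = indicator K x *\<^sub>R v x" for x
  have w: "integrable lebesgue w"
    using assms unfolding w_def loc_integrable_def set_integrable_def by auto
  then have [measurable]: "w \<in> borel_measurable lebesgue" by simp
  have [measurable]: "\<phi> \<in> borel_measurable lebesgue"
    using continuous_on_UNIV_lebesgue_measurable[OF assms(4)] .
  have "bounded (\<phi> ` K)"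
    using assms by (intro compact_imp_bounded compact_continuous_image) (auto intro: continuous_on_subset)
  then obtain C where C: "\<And>x. x \<in> K \<Longrightarrow> \<bar>\<phi> x\<bar> \<le> C" "C > 0" unfolding bounded_pos by auto
  have "(\<lambda>x. \<phi> x *\<^sub>R v x) = (\<lambda>x. \<phi> x *\<^sub>R w x)"
    using assms(3) by (intro ext) (force simp: w_def indicator_def)
  moreover have "integrable lebesgue (\<lambda>x. \<phi> x *\<^sub>R w x)"
  proof (rule Bochner_Integration.integrable_bound)
    show "integrable lebesgue (\<lambda>x. C *\<^sub>R w x)" using w by simp
    show "AE x in lebesgue. norm (\<phi> x *\<^sub>R w x) \<le> norm (C *\<^sub>R w x)"
      using C by (intro AE_I2) (force simp: w_def indicator_def intro: mult_right_mono)
  qed measurable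
  ultimately show ?thesis by simp
qed

lemma integrable_test_fun_scaleR:
  assumes "test_fun \<phi>" "loc_integrable v"
  shows "integrable lebesgue (\<lambda>x. \<phi> x *\<^sub>R v x)"
proof -
  obtain K where "compact K" "\<And>x. x \<notin> K \<Longrightarrow> \<phi> x = 0" using test_funE[OF assms(1)] by metis
  then show ?thesis
    using integrable_compact_support_scaleR[OF assms(2)] Ck_continuous[OF test_fun_Ck[OF assms(1)]] by blast
qed

lemma loc_integrable_diff:
  "loc_integrable u \<Longrightarrow> loc_integrable v \<Longrightarrow> loc_integrable (\<lambda>x. u x - v x)"
  by (simp add: loc_integrable_def set_integral_diff(1))

lemma has_weak_partial_unique:
  assumes "has_weak_partial i u v" "has_weak_partial i u w"
  shows "AE x in lebesgue. v x = w x"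
proof -
  have l: "loc_integrable v" "loc_integrable w" using assms by (auto simp: has_weak_partial_def)
  have "AE x in lebesgue. v x - w x = 0"
  proof (rule fundamental_lemma[OF loc_integrable_diff[OF l]])
    fix \<phi> :: "'a \<Rightarrow> real" assume "test_fun \<phi>"
    then have "(LINT x|lebesgue. \<phi> x *\<^sub>R v x) = (LINT x|lebesgue. \<phi> x *\<^sub>R w x)"
      using assms unfolding has_weak_partial_def by (metis neg_equal_iff_equal)
    then show "(LINT x|lebesgue. \<phi> x *\<^sub>R (v x - w x)) = 0"
      using integrable_test_fun_scaleR[OF \<open>test_fun \<phi>\<close>] l
      by (subst scaleR_diff_right, subst Bochner_Integration.integral_diff) auto
  qed
  then show ?thesis by simp
qed

lemma weak_partial_AE_eq:
  assumes "has_weak_partial i u v"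
  shows "has_weak_partial i u (weak_partial i u)" "AE x in lebesgue. weak_partial i u x = v x"
proof -
  show "has_weak_partial i u (weak_partial i u)"
    unfolding weak_partial_def by (rule someI[of _ v]) (rule assms)
  then show "AE x in lebesgue. weak_partial i u x = v x"
    using assms has_weak_partial_unique by blast
qed

lemma loc_integrable_measurable:
  assumes "loc_integrable v"
  shows "v \<in> borel_measurable lebesgue"
proof (rule borel_measurable_LIMSEQ_metric)
  show "(\<lambda>x. indicator (cball 0 (real n)) x *\<^sub>R v x) \<in> borel_measurable lebesgue" for n
    using assms unfolding loc_integrable_def set_integrable_def
    by (meson borel_measurable_integrable compact_cball)
  show "(\<lambda>n. indicator (cball 0 (real n)) x *\<^sub>R v x) \<longlonglongrightarrow> v x" for x
  proof (rule Lim_transform_eventually[OF tendsto_const])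
    have "\<forall>\<^sub>F n in sequentially. norm x \<le> real n" by real_asymp
    then show "\<forall>\<^sub>F n in sequentially. v x = indicator (cball 0 (real n)) x *\<^sub>R v x"
      by eventually_elim simp
  qed
qed

lemma dirichlet_eq:
  assumes "\<And>i. i \<in> Basis \<Longrightarrow> has_weak_partial i u (v i)"
  shows "dirichlet u = (LINT x|lebesgue. (\<Sum>i\<in>Basis. (norm (v i x))\<^sup>2))"
proof -
  have "AE x in lebesgue. \<forall>i\<in>Basis. weak_partial i u x = v i x"
    using weak_partial_AE_eq(2)[OF assms] by (simp add: AE_finite_all)
  moreover have "has_weak_partial i u (weak_partial i u)" if "i \<in> Basis" for i
    using weak_partial_AE_eq(1)[OF assms[OF that]] .
  then have "weak_partial i u \<in> borel_measurable lebesgue" "v i \<in> borel_measurable lebesgue" if "i \<in> Basis" for i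
    using that assms[OF that] loc_integrable_measurable unfolding has_weak_partial_def by blast+
  ultimately show ?thesis
    unfolding dirichlet_def by (intro integral_cong_AE) auto
qed

text \<open>Translation invariance of Lebesgue measure makes every difference quotient of
  \<open>G\<close> integrate to zero, and dominated convergence passes to the derivative.\<close>

lemma integral_partial_eq_0:
  fixes G :: "'a::euclidean_space \<Rightarrow> real"
  assumes G: "Ck 1 G" and K: "compact K" "\<And>x. x \<notin> K \<Longrightarrow> G x = 0" and i: "i \<in> Basis"
  shows "(LINT x|lebesgue. partial i G x) = 0"
proof -
  have cont: "continuous_on UNIV G" "continuous_on UNIV (partial i G)"
    using G i by (auto intro: Ck_continuous simp: differentiable_imp_continuous_on)
  have [measurable]: "G \<in> borel_measurable borel" "partial i G \<in> borel_measurable borel"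
    using cont borel_measurable_continuous_onI by auto
  have G0: "partial i G x = 0" if "x \<notin> K" for x
    using partial_outside[of K G x i] K that compact_imp_closed by blast
  \<comment> \<open>The support enlarged by one unit contains the supports of all difference
    quotients with step at most one, so one integrable majorant serves them all.\<close>
  define K' where "K' = {x + y |x y. x \<in> K \<and> y \<in> cball (0::'a) 1}"
  have K': "compact K'" unfolding K'_def by (intro compact_sums K compact_cball)
  have "bounded (partial i G ` K)"
    using K cont by (intro compact_imp_bounded compact_continuous_image) (auto intro: continuous_on_subset)
  then obtain C where C: "\<And>x. \<bar>partial i G x\<bar> \<le> C"
  proof -
    obtain C where "\<And>x. x \<in> K \<Longrightarrow> \<bar>partial i G x\<bar> \<le> C" "C > 0"
      using \<open>bounded (partial i G ` K)\<close> unfolding bounded_pos by auto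
    with G0 have "\<bar>partial i G x\<bar> \<le> C" for x by (cases "x \<in> K") auto
    then show ?thesis using that by blast
  qed
  define s where "s n x = real (Suc n) * (G (x + (1 / real (Suc n)) *\<^sub>R i) - G x)" for n x
  have line: "((\<lambda>t. G (x + t *\<^sub>R i)) has_real_derivative partial i G (x + t *\<^sub>R i)) (at t)" for x t
  proof -
    have 1: "(G has_derivative (\<lambda>h. partial h G (x + t *\<^sub>R i))) (at (x + t *\<^sub>R i))"
      by (rule Ck_Suc_has_derivative[of 0]) (use G in simp)
    have "((\<lambda>t. x + t *\<^sub>R i) has_derivative (\<lambda>h. h *\<^sub>R i)) (at t)"
      by (auto intro!: derivative_eq_intros)
    from has_derivative_compose[OF this 1] linear_cmul[OF has_derivative_linear[OF 1]]
    show ?thesis by (simp add: has_field_derivative_def mult.commute[of _ "partial i G _"])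
  qed
  have lim: "(\<lambda>n. s n x) \<longlonglongrightarrow> partial i G x" for x
  proof -
    have "((\<lambda>h. (G (x + (0 + h) *\<^sub>R i) - G (x + 0 *\<^sub>R i)) / h) \<longlongrightarrow> partial i G x) (at 0)"
      using line[of x 0] unfolding DERIV_def by simp
    moreover have "filterlim (\<lambda>n. 1 / real (Suc n)) (at 0) sequentially"
      unfolding filterlim_at using lim_1_over_n[THEN LIMSEQ_Suc] by (auto simp: eventually_sequentially)
    ultimately have "(\<lambda>n. (G (x + (0 + 1 / real (Suc n)) *\<^sub>R i) - G (x + 0 *\<^sub>R i)) / (1 / real (Suc n))) \<longlonglongrightarrow> partial i G x"
      by (rule filterlim_compose)
    then show ?thesis by (simp add: s_def[abs_def] mult.commute)
  qed
  have bound: "norm (s n x) \<le> C * indicator K' x" for n x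
  proof (cases "x \<in> K'")
    case True
    obtain z where "G (x + (1 / real (Suc n)) *\<^sub>R i) - G (x + 0 *\<^sub>R i) = (1 / real (Suc n) - 0) * partial i G (x + z *\<^sub>R i)"
      using MVT2[of 0 "1 / real (Suc n)" "\<lambda>t. G (x + t *\<^sub>R i)" "\<lambda>t. partial i G (x + t *\<^sub>R i)"] line by auto
    then have "s n x = partial i G (x + z *\<^sub>R i)" by (simp add: s_def)
    then show ?thesis using C True by simp
  next
    case False
    have inK: "x \<in> K'" if "x + y \<in> K" "norm y \<le> 1" for y
      unfolding K'_def using that by (intro CollectI exI[of _ "x + y"] exI[of _ "- y"]) auto
    have "x \<notin> K" "x + (1 / real (Suc n)) *\<^sub>R i \<notin> K"
      using inK[of 0] inK[of "(1 / real (Suc n)) *\<^sub>R i"] False i by (auto simp: divide_simps)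
    then show ?thesis using K by (simp add: s_def False)
  qed
  have "(\<lambda>n. LINT x|lborel. s n x) \<longlonglongrightarrow> (LINT x|lborel. partial i G x)"
  proof (rule integral_dominated_convergence[where w = "\<lambda>x. C * indicator K' x"])
    show "integrable lborel (\<lambda>x. C * indicator K' x)"
      using K' by (intro integrable_mult_right integrable_real_indicator emeasure_compact_finite)
        (simp_all add: compact_imp_closed borel_closed)
    show "s n \<in> borel_measurable lborel" for n unfolding s_def[abs_def] by measurable
  qed (use lim bound in auto)
  moreover have "(LINT x|lborel. s n x) = 0" for n
  proof -
    have iG: "integrable lborel G"
    proof -
      have "integrable lborel (\<lambda>x. indicator K x *\<^sub>R G x)"
        using cont K by (intro borel_integrable_compact) (auto intro: continuous_on_subset)
      moreover have "(\<lambda>x. indicator K x *\<^sub>R G x) = G"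
        using K(2) by (intro ext) (force simp: indicator_def)
      ultimately show ?thesis by simp
    qed
    have "(LINT x|lborel. G (c + x)) = (LINT x|lborel. G x)" "integrable lborel (\<lambda>x. G (c + x))" for c
      using integral_distr[of "(+) c" lborel borel G] integrable_distr_eq[of "(+) c" lborel borel G] iG
      by (auto simp: lborel_distr_plus)
    then have "(LINT x|lborel. G (x + c)) = (LINT x|lborel. G x)" "integrable lborel (\<lambda>x. G (x + c))" for c
      by (simp_all only: add.commute[of _ c])
    then show ?thesis unfolding s_def using iG by simp
  qed
  ultimately have "(LINT x|lborel. partial i G x) = 0" by (simp add: LIMSEQ_const_iff)
  then show ?thesis by (simp add: integral_completion)
qed

section \<open>Absolutely continuous functions on an interval\<close>

text \<open>Local absolute continuity with derivative \<open>w\<close>, encoded by the integral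
  formula. Pointwise derivatives are never mentioned, so \<open>w\<close> may be changed on null
  sets.\<close>

definition primitive_on :: "real set \<Rightarrow> (real \<Rightarrow> 'b::euclidean_space) \<Rightarrow> (real \<Rightarrow> 'b) \<Rightarrow> bool" where
  "primitive_on S u w \<longleftrightarrow> (\<forall>a b. a \<le> b \<longrightarrow> {a..b} \<subseteq> S \<longrightarrow>
     w absolutely_integrable_on {a..b} \<and> u b - u a = integral {a..b} w)"

lemma primitive_onD:
  assumes "primitive_on S u w" "{a..b} \<subseteq> S"
  shows "w absolutely_integrable_on {a..b}" "w integrable_on {a..b}"
    "a \<le> b \<Longrightarrow> u b - u a = integral {a..b} w"
proof -
  show w: "w absolutely_integrable_on {a..b}"
    using assms unfolding primitive_on_def by (cases "a \<le> b") auto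
  then show "w integrable_on {a..b}" using set_lebesgue_integral_eq_integral(1) by blast
  show "a \<le> b \<Longrightarrow> u b - u a = integral {a..b} w"
    using assms unfolding primitive_on_def by auto
qed

lemma primitive_on_continuous_Icc:
  assumes "primitive_on S u w" "{a..b} \<subseteq> S"
  shows "continuous_on {a..b} u"
proof -
  have "u t = u a + integral {a..t} w" if "t \<in> {a..b}" for t
  proof -
    have "{a..t} \<subseteq> S" "a \<le> t" using that assms(2) by auto
    from primitive_onD(3)[OF assms(1) this] show ?thesis by (metis add.commute diff_add_cancel)
  qed
  moreover have "continuous_on {a..b} (\<lambda>t. u a + integral {a..t} w)"
    using indefinite_integral_continuous_1[OF primitive_onD(2)[OF assms]] by (intro continuous_intros)
  ultimately show ?thesis
    using continuous_on_cong[of "{a..b}" "{a..b}" u "\<lambda>t. u a + integral {a..t} w"] by blast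
qed

lemma primitive_on_continuous:
  assumes "primitive_on S u w" "open S"
  shows "continuous_on S u"
proof (rule continuous_at_imp_continuous_on, rule ballI)
  fix x assume "x \<in> S"
  then obtain e where e: "e > 0" "cball x e \<subseteq> S" using assms(2) open_contains_cball by blast
  then have "continuous_on {x - e..x + e} u"
    using primitive_on_continuous_Icc[OF assms(1)] by (simp add: cball_eq_atLeastAtMost)
  then show "isCont u x"
    using e(1) by (metis atLeastAtMost_iff continuous_on_interior diff_gt_0_iff_gt greaterThanLessThan_iff
        interior_atLeastAtMost_real less_add_same_cancel1 less_diff_eq diff_less_eq)
qed

lemma absolutely_integrable_continuous_inner:
  fixes f w :: "real \<Rightarrow> 'a::euclidean_space"
  assumes "continuous_on {a..b} f" "w absolutely_integrable_on {a..b}"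
  shows "(\<lambda>t. f t \<bullet> w t) absolutely_integrable_on {a..b}"
proof (rule absolutely_integrable_bounded_measurable_product[OF bilinear_conv_bounded_bilinear[THEN iffD2, OF bounded_bilinear_inner]])
  show "f \<in> borel_measurable (lebesgue_on {a..b})"
    using assms(1) by (intro continuous_imp_measurable_on_sets_lebesgue) auto
  show "bounded (f ` {a..b})"
    using assms(1) by (intro compact_imp_bounded compact_continuous_image) auto
qed (use assms in auto)

text \<open>Summing the short-interval estimate over a fine equidistant partition gives
  \<open>\<bar>D b - D a\<bar> \<le> e * (V b - V a)\<close> for every \<open>e\<close>. Here
  \<open>V\<close> acts as a variation function; the lemma replaces almost-everywhere
  differentiation of absolutely continuous functions.\<close>

lemma small_increments_imp_constant:
  fixes D V :: "real \<Rightarrow> real"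
  assumes "a \<le> b"
    and small: "\<And>e. e > 0 \<Longrightarrow> \<exists>\<eta>>0. \<forall>c d. a \<le> c \<longrightarrow> c \<le> d \<longrightarrow> d \<le> b \<longrightarrow> d - c < \<eta> \<longrightarrow>
        \<bar>D d - D c\<bar> \<le> e * (V d - V c)"
  shows "D b = D a"
proof -
  have *: "\<bar>D b - D a\<bar> \<le> e * (V b - V a)" if "e > 0" for e
  proof -
    obtain \<eta> where \<eta>: "\<eta> > 0" "\<And>c d. a \<le> c \<Longrightarrow> c \<le> d \<Longrightarrow> d \<le> b \<Longrightarrow> d - c < \<eta> \<Longrightarrow>
        \<bar>D d - D c\<bar> \<le> e * (V d - V c)" using small[OF \<open>e > 0\<close>] by metis
    obtain n where n: "real n > (b - a) / \<eta>" using reals_Archimedean2 by blast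
    then have "n > 0" using assms(1) \<eta>(1) by (cases n) (auto simp: divide_less_0_iff)
    define t where "t k = a + real k * ((b - a) / real n)" for k
    have step: "t (Suc k) - t k = (b - a) / real n" for k by (simp add: t_def add_divide_distrib distrib_right)
    have h: "0 \<le> (b - a) / real n" "(b - a) / real n < \<eta>"
      using assms(1) n \<open>n > 0\<close> \<eta>(1) by (auto simp: field_simps)
    have ta: "a \<le> t k" for k using mult_nonneg_nonneg[OF of_nat_0_le_iff[of k] h(1)] by (simp add: t_def)
    have tn: "t n = b" using \<open>n > 0\<close> by (simp add: t_def)
    have tb: "t k \<le> b" if "k \<le> n" for k
    proof -
      have "real k * ((b - a) / real n) \<le> real n * ((b - a) / real n)"
        using that h(1) by (intro mult_right_mono) auto
      then show ?thesis using tn by (simp add: t_def)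
    qed
    have "\<bar>D (t k) - D a\<bar> \<le> e * (V (t k) - V a)" if "k \<le> n" for k
      using that
    proof (induction k)
      case 0
      then show ?case by (simp add: t_def)
    next
      case (Suc k)
      have "\<bar>D (t (Suc k)) - D (t k)\<bar> \<le> e * (V (t (Suc k)) - V (t k))"
        using step[of k] h ta tb Suc.prems by (intro \<eta>(2)) auto
      with Suc show ?case by (simp add: algebra_simps)
    qed
    from this[of n] tn show ?thesis by simp
  qed
  have "\<bar>D b - D a\<bar> \<le> 0 + e" if "e > 0" for e
  proof -
    have "V b - V a \<le> \<bar>V b - V a\<bar> + 1" by simp
    then have "e / (\<bar>V b - V a\<bar> + 1) * (V b - V a) \<le> e"
      using that by (simp add: divide_simps)
    moreover have "e / (\<bar>V b - V a\<bar> + 1) > 0" using that by (smt (verit) divide_pos_pos)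
    ultimately show ?thesis using *[of "e / (\<bar>V b - V a\<bar> + 1)"] by linarith
  qed
  then have "\<bar>D b - D a\<bar> \<le> 0" by (rule field_le_epsilon)
  then show ?thesis by simp
qed

text \<open>The error \<open>D\<close> of the claimed formula has small increments: on a short
  interval both the linearization of \<open>G\<close> at the left end and the freezing of
  \<open>g (u t)\<close> cost at most \<open>e\<close> times the integral of
  \<open>norm (w t)\<close>, by uniform continuity of \<open>g\<close> on a compact convex
  set.\<close>

lemma primitive_on_chain:
  fixes u :: "real \<Rightarrow> 'a::euclidean_space" and G :: "'a \<Rightarrow> real"
  assumes u: "primitive_on S u w" and \<Omega>: "convex \<Omega>" "u ` S \<subseteq> \<Omega>"
    and G: "\<And>x. x \<in> \<Omega> \<Longrightarrow> (G has_derivative (\<lambda>h. g x \<bullet> h)) (at x within \<Omega>)"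
    and g: "continuous_on \<Omega> g"
  shows "primitive_on S (\<lambda>t. G (u t)) (\<lambda>t. g (u t) \<bullet> w t)"
  unfolding primitive_on_def
proof (intro allI impI conjI)
  fix a b :: real assume ab: "a \<le> b" "{a..b} \<subseteq> S"
  have cu: "continuous_on {a..b} u" by (rule primitive_on_continuous_Icc[OF u ab(2)])
  have w: "w absolutely_integrable_on {a..b}" by (rule primitive_onD[OF u ab(2)])
  have u\<Omega>: "u ` {a..b} \<subseteq> \<Omega>" using \<Omega>(2) ab(2) by auto
  have cgu: "continuous_on {a..b} (\<lambda>t. g (u t))"
    using continuous_on_compose2[OF g cu u\<Omega>] .
  show gw: "(\<lambda>t. g (u t) \<bullet> w t) absolutely_integrable_on {a..b}"
    by (rule absolutely_integrable_continuous_inner[OF cgu w])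
  define D where "D t = G (u t) - integral {a..t} (\<lambda>t. g (u t) \<bullet> w t)" for t
  \<comment> \<open>The factor 2 collects the two errors, one from linearizing \<open>G\<close> and
    one from freezing the gradient.\<close>
  define V where "V t = 2 * integral {a..t} (\<lambda>t. norm (w t))" for t
  define C where "C = convex hull (u ` {a..b})"
  have C: "convex C" "compact C" "C \<subseteq> \<Omega>" "u ` {a..b} \<subseteq> C"
    using \<Omega>(1) u\<Omega> cu unfolding C_def
    by (auto intro: compact_convex_hull compact_continuous_image hull_minimal[THEN subsetD] hull_inc)
  have iw: "(\<lambda>t. norm (w t)) integrable_on {c..d}" "w integrable_on {c..d}" "w absolutely_integrable_on {c..d}"
     "(\<lambda>t. g (u t) \<bullet> w t) absolutely_integrable_on {c..d}" "(\<lambda>t. g (u t) \<bullet> w t) integrable_on {c..d}"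
    if "a \<le> c" "d \<le> b" for c d
  proof -
    have *: "{c..d} \<subseteq> {a..b}" using that by auto
    show "w absolutely_integrable_on {c..d}" "(\<lambda>t. g (u t) \<bullet> w t) absolutely_integrable_on {c..d}"
      using set_integrable_subset[OF w _ *] set_integrable_subset[OF gw _ *] by auto
    then show "(\<lambda>t. norm (w t)) integrable_on {c..d}" "w integrable_on {c..d}" "(\<lambda>t. g (u t) \<bullet> w t) integrable_on {c..d}"
      by (auto simp: absolutely_integrable_on_def)
  qed
  have "D b = D a"
  proof (rule small_increments_imp_constant[OF ab(1), of D V])
    fix e :: real assume "e > 0"
    have "uniformly_continuous_on C g"
      using g C by (intro compact_uniformly_continuous) (auto intro: continuous_on_subset)
    then obtain \<delta> where \<delta>: "\<delta> > 0" "\<And>x y. x \<in> C \<Longrightarrow> y \<in> C \<Longrightarrow> dist y x < \<delta> \<Longrightarrow> dist (g y) (g x) < e"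
      using \<open>e > 0\<close> unfolding uniformly_continuous_on_def by metis
    have "uniformly_continuous_on {a..b} u"
      using cu by (intro compact_uniformly_continuous) auto
    then obtain \<eta> where \<eta>: "\<eta> > 0" "\<And>x y. x \<in> {a..b} \<Longrightarrow> y \<in> {a..b} \<Longrightarrow> dist y x < \<eta> \<Longrightarrow> dist (u y) (u x) < \<delta>"
      using \<delta>(1) unfolding uniformly_continuous_on_def by metis
    have "\<bar>D d - D c\<bar> \<le> e * (V d - V c)" if cd: "a \<le> c" "c \<le> d" "d \<le> b" "d - c < \<eta>" for c d
    proof -
      note iw' = iw[OF cd(1,3)]
      have inC: "u t \<in> C" if "t \<in> {c..d}" for t using that cd C(4) by auto
      have near: "dist (u t) (u c) < \<delta>" if "t \<in> {c..d}" for t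
        using that cd by (intro \<eta>(2)) (auto simp: dist_real_def)
      have ud: "u d - u c = integral {c..d} w"
        using primitive_onD(3)[OF u, of c d] cd(1-3) ab(2) by (metis atLeastatMost_subset_iff dual_order.trans)
      have nud: "norm (u d - u c) \<le> integral {c..d} (\<lambda>t. norm (w t))"
        unfolding ud using iw' by (intro integral_norm_bound_integral) auto
      \<comment> \<open>Subtracting the linear part at \<open>u c\<close> leaves a function whose
        gradient is at most \<open>e\<close> near \<open>u c\<close>, so the mean value inequality
        applies. The ball in the domain has radius \<open>norm (u d - u c)\<close>, which keeps its
        points within \<open>\<delta>\<close>.\<close>
      define H where "H x = G x - g (u c) \<bullet> x" for x
      have "norm (H (u d) - H (u c)) \<le> e * norm (u d - u c)"
      proof (rule differentiable_bound[where S = "C \<inter> cball (u c) (norm (u d - u c))" and f' = "\<lambda>x h. (g x - g (u c)) \<bullet> h"])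
        show "convex (C \<inter> cball (u c) (norm (u d - u c)))" using C(1) by (intro convex_Int) auto
        show "(H has_derivative (\<lambda>h. (g x - g (u c)) \<bullet> h)) (at x within C \<inter> cball (u c) (norm (u d - u c)))"
          if "x \<in> C \<inter> cball (u c) (norm (u d - u c))" for x
        proof -
          have "(G has_derivative (\<lambda>h. g x \<bullet> h)) (at x within C \<inter> cball (u c) (norm (u d - u c)))"
            using that C(3) by (intro has_derivative_subset[OF G]) auto
          then show ?thesis unfolding H_def inner_diff_left
            by (auto intro!: derivative_eq_intros)
        qed
        show "onorm (\<lambda>h. (g x - g (u c)) \<bullet> h) \<le> e" if "x \<in> C \<inter> cball (u c) (norm (u d - u c))" for x
        proof (rule onorm_bound)
          show "0 \<le> e" using \<open>e > 0\<close> by simp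
          fix h
          have "dist x (u c) < \<delta>" using that near[of d] cd by (auto simp: dist_norm norm_minus_commute)
          then have "norm (g x - g (u c)) < e"
            using \<delta>(2)[of "u c" x] that inC[of c] cd by (auto simp: dist_norm)
          then show "norm ((g x - g (u c)) \<bullet> h) \<le> e * norm h"
            using Cauchy_Schwarz_ineq2[of "g x - g (u c)" h]
            by (smt (verit) mult_right_mono norm_ge_zero real_norm_def)
        qed
      qed (use inC cd in \<open>auto simp: dist_norm norm_minus_commute\<close>)
      also have "\<dots> \<le> e * integral {c..d} (\<lambda>t. norm (w t))"
        using nud \<open>e > 0\<close> by (intro mult_left_mono) auto
      finally have 1: "\<bar>G (u d) - G (u c) - g (u c) \<bullet> (u d - u c)\<bar> \<le> e * integral {c..d} (\<lambda>t. norm (w t))"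
        by (simp add: H_def algebra_simps)
      have "g (u c) \<bullet> (u d - u c) = integral {c..d} (\<lambda>t. g (u c) \<bullet> w t)"
        unfolding ud using integral_linear[OF iw'(2) bounded_linear_inner_right] by (simp add: o_def)
      also have "\<dots> - integral {c..d} (\<lambda>t. g (u t) \<bullet> w t) = integral {c..d} (\<lambda>t. g (u c) \<bullet> w t - g (u t) \<bullet> w t)"
        using iw' by (intro integral_diff[symmetric]) (auto intro: integrable_linear[OF _ bounded_linear_inner_right, unfolded o_def])
      also have "\<bar>\<dots>\<bar> \<le> integral {c..d} (\<lambda>t. e * norm (w t))"
      proof -
        have "norm (integral {c..d} (\<lambda>t. g (u c) \<bullet> w t - g (u t) \<bullet> w t)) \<le> integral {c..d} (\<lambda>t. e * norm (w t))"
        proof (rule integral_norm_bound_integral)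
          fix t assume t: "t \<in> {c..d}"
          have "norm (g (u t) - g (u c)) \<le> e"
            using \<delta>(2)[OF inC[of c] inC[OF t]] near[OF t] cd by (auto simp: dist_norm less_imp_le)
          then have "norm ((g (u c) - g (u t)) \<bullet> w t) \<le> e * norm (w t)"
            using Cauchy_Schwarz_ineq2[of "g (u c) - g (u t)" "w t"]
            by (smt (verit) mult_right_mono norm_ge_zero real_norm_def norm_minus_commute)
          then show "norm (g (u c) \<bullet> w t - g (u t) \<bullet> w t) \<le> e * norm (w t)"
            by (simp add: inner_diff_left)
        qed (use iw' in \<open>auto intro!: integrable_diff integrable_on_mult_right integrable_linear[OF _ bounded_linear_inner_right, unfolded o_def]\<close>)
        then show ?thesis by simp
      qed
      also have "\<dots> = e * integral {c..d} (\<lambda>t. norm (w t))" by simp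
      finally have 2: "\<bar>g (u c) \<bullet> (u d - u c) - integral {c..d} (\<lambda>t. g (u t) \<bullet> w t)\<bar> \<le> e * integral {c..d} (\<lambda>t. norm (w t))" .
      have 3: "D d - D c = G (u d) - G (u c) - integral {c..d} (\<lambda>t. g (u t) \<bullet> w t)"
        unfolding D_def using Henstock_Kurzweil_Integration.integral_combine[OF cd(1,2) iw(5)[of a d]] cd by simp
      have 4: "V d - V c = 2 * integral {c..d} (\<lambda>t. norm (w t))"
        unfolding V_def using Henstock_Kurzweil_Integration.integral_combine[OF cd(1,2) iw(1)[of a d]] cd by simp
      show ?thesis using 1 2 unfolding 3 4 by simp
    qed
    with \<eta>(1) show "\<exists>\<eta>>0. \<forall>c d. a \<le> c \<longrightarrow> c \<le> d \<longrightarrow> d \<le> b \<longrightarrow> d - c < \<eta> \<longrightarrow>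
        \<bar>D d - D c\<bar> \<le> e * (V d - V c)" by blast
  qed
  then show "G (u b) - G (u a) = integral {a..b} (\<lambda>t. g (u t) \<bullet> w t)" by (simp add: D_def)
qed

lemma primitive_on_Pair:
  assumes "primitive_on S u w"
  shows "primitive_on S (\<lambda>t. (t, u t)) (\<lambda>t. (1, w t))"
  unfolding primitive_on_def
proof (intro allI impI conjI)
  fix a b :: real assume ab: "a \<le> b" "{a..b} \<subseteq> S"
  note w = primitive_onD[OF assms ab(2)]
  have l: "bounded_linear (\<lambda>y::'a. (0::real, y))" by (intro bounded_linear_Pair bounded_linear_zero bounded_linear_ident)
  have eq: "(\<lambda>t. (1::real, w t)) = (\<lambda>t. (1, 0) + (0, w t))" by auto
  have 1: "(\<lambda>t. (0::real, w t)) absolutely_integrable_on {a..b}"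
    using absolutely_integrable_linear[OF w(1) l] by (simp add: o_def)
  show "(\<lambda>t. (1::real, w t)) absolutely_integrable_on {a..b}"
    unfolding eq by (intro set_integral_add(1) 1) auto
  have "integral {a..b} (\<lambda>t. (1::real, w t)) = integral {a..b} (\<lambda>t. (1::real, 0::'a)) + integral {a..b} (\<lambda>t. (0::real, w t))"
    unfolding eq using 1 by (intro integral_add) (auto simp: absolutely_integrable_on_def)
  also have "integral {a..b} (\<lambda>t. (0::real, w t)) = (0, integral {a..b} w)"
    using integral_linear[OF w(2) l] by (simp add: o_def)
  finally show "(b, u b) - (a, u a) = integral {a..b} (\<lambda>t. (1::real, w t))"
    using w(3) ab by (simp add: zero_prod_def)
qed

text \<open>Explicit dependence on the radius is absorbed by adjoining the radius as an extra
  component with derivative 1.\<close>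

lemma primitive_on_chain2:
  fixes u :: "real \<Rightarrow> 'a::euclidean_space" and G :: "real \<Rightarrow> 'a \<Rightarrow> real"
  assumes u: "primitive_on S u w" and S: "convex S"
    and G: "\<And>r y. r \<in> S \<Longrightarrow> ((\<lambda>p. G (fst p) (snd p)) has_derivative
        (\<lambda>h. Gr r y * fst h + Gu r y \<bullet> snd h)) (at (r, y))"
    and cont: "continuous_on (S \<times> UNIV) (\<lambda>p. Gr (fst p) (snd p))" "continuous_on (S \<times> UNIV) (\<lambda>p. Gu (fst p) (snd p))"
  shows "primitive_on S (\<lambda>t. G t (u t)) (\<lambda>t. Gr t (u t) + Gu t (u t) \<bullet> w t)"
proof -
  have "primitive_on S (\<lambda>t. (\<lambda>p. G (fst p) (snd p)) (t, u t))
     (\<lambda>t. (\<lambda>p. (Gr (fst p) (snd p), Gu (fst p) (snd p))) (t, u t) \<bullet> (1, w t))"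
  proof (rule primitive_on_chain[OF primitive_on_Pair[OF u], where \<Omega> = "S \<times> UNIV"])
    show "convex (S \<times> (UNIV :: 'a set))" using S by (intro convex_Times) auto
    show "((\<lambda>p. G (fst p) (snd p)) has_derivative (\<lambda>h. (Gr (fst x) (snd x), Gu (fst x) (snd x)) \<bullet> h)) (at x within S \<times> UNIV)"
      if "x \<in> S \<times> UNIV" for x
      using G[of "fst x" "snd x"] that by (auto simp: inner_prod_def mem_Times_iff intro: has_derivative_at_withinI)
    show "continuous_on (S \<times> UNIV) (\<lambda>p. (Gr (fst p) (snd p), Gu (fst p) (snd p)))"
      using cont by (intro continuous_intros)
  qed auto
  then show ?thesis by (simp add: inner_prod_def)
qed

lemma primitive_on_scaled_component:
  fixes u :: "real \<Rightarrow> 'a::euclidean_space"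
  assumes u: "primitive_on S u w" and S: "convex S" and \<psi>: "Ck 1 \<psi>"
  shows "primitive_on S (\<lambda>t. \<psi> t * (e \<bullet> u t)) (\<lambda>t. partial 1 \<psi> t * (e \<bullet> u t) + (\<psi> t *\<^sub>R e) \<bullet> w t)"
proof (rule primitive_on_chain2[OF u S])
  have c: "continuous_on UNIV \<psi>" "continuous_on UNIV (partial 1 \<psi>)"
    using \<psi> by (auto intro: Ck_continuous simp: differentiable_imp_continuous_on)
  show "continuous_on (S \<times> UNIV) (\<lambda>p. partial 1 \<psi> (fst p) * (e \<bullet> snd p))"
    "continuous_on (S \<times> UNIV) (\<lambda>p. \<psi> (fst p) *\<^sub>R e)"
    by (intro continuous_intros continuous_on_compose2[OF c(1)] continuous_on_compose2[OF c(2)]; simp)+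
  have d: "(\<psi> has_derivative (*) (partial 1 \<psi> r)) (at r)" for r
    using Ck_Suc_real_derivative[of 0 \<psi>] \<psi> by (simp add: has_field_derivative_def)
  show "((\<lambda>p. \<psi> (fst p) * (e \<bullet> snd p)) has_derivative
      (\<lambda>h. partial 1 \<psi> r * (e \<bullet> y) * fst h + (\<psi> r *\<^sub>R e) \<bullet> snd h)) (at (r, y))" for r y
    by (auto intro!: derivative_eq_intros has_derivative_compose[of fst fst _ _ \<psi>, OF _ d] simp: fun_eq_iff algebra_simps)
qed

section \<open>The lemma of du Bois-Reymond on the half-line\<close>

lemma lebesgue_integral_eq_Icc:
  fixes f :: "real \<Rightarrow> 'b::euclidean_space"
  assumes "f absolutely_integrable_on {a..b}" "\<And>t. t \<notin> {a..b} \<Longrightarrow> f t = 0"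
  shows "integrable lebesgue f" "(LINT t|lebesgue. f t) = integral {a..b} f"
proof -
  have "(\<lambda>t. indicator {a..b} t *\<^sub>R f t) = f" using assms(2) by (force simp: indicator_def)
  then show "integrable lebesgue f" "(LINT t|lebesgue. f t) = integral {a..b} f"
    using assms(1) set_lebesgue_integral_eq_integral(2)[OF assms(1)]
    by (simp_all add: set_integrable_def set_lebesgue_integral_def)
qed

lemma absolutely_integrable_continuous_scaleR:
  fixes w :: "real \<Rightarrow> 'b::euclidean_space"
  assumes "continuous_on {a..b} \<phi>" "w absolutely_integrable_on {a..b}"
  shows "(\<lambda>t. \<phi> t *\<^sub>R w t) absolutely_integrable_on {a..b}"
proof (rule absolutely_integrable_bounded_measurable_product[OF bilinear_conv_bounded_bilinear[THEN iffD2, OF bounded_bilinear_scaleR]])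
  show "\<phi> \<in> borel_measurable (lebesgue_on {a..b})"
    using assms(1) by (intro continuous_imp_measurable_on_sets_lebesgue) auto
  show "bounded (\<phi> ` {a..b})"
    using assms(1) by (intro compact_imp_bounded compact_continuous_image) auto
qed (use assms in auto)

lemma primitive_on_exists:
  fixes w :: "real \<Rightarrow> 'b::euclidean_space"
  assumes "\<And>a b. {a..b} \<subseteq> S \<Longrightarrow> w absolutely_integrable_on {a..b}" and "convex S" "x0 \<in> S"
  obtains U where "primitive_on S U w"
proof -
  define U where "U t = (if x0 \<le> t then integral {x0..t} w else - integral {t..x0} w)" for t
  have "U b - U a = integral {a..b} w" if ab: "a \<le> b" "{a..b} \<subseteq> S" for a b
  proof -
    have S: "{c..d} \<subseteq> S" if "c \<in> S" "d \<in> S" for c d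
      using \<open>convex S\<close> that by (metis closed_segment_eq_real_ivl1 closed_segment_subset empty_subsetI atLeastatMost_empty_iff2)
    have i: "w integrable_on {c..d}" if "c \<in> S" "d \<in> S" for c d
      using assms(1)[OF S[OF that]] set_lebesgue_integral_eq_integral(1) by blast
    have m: "a \<in> S" "b \<in> S" using ab by auto
    consider "x0 \<le> a" | "a < x0" "x0 \<le> b" | "b < x0" by linarith
    then show ?thesis
    proof cases
      case 1
      then show ?thesis
        using Henstock_Kurzweil_Integration.integral_combine[OF 1 ab(1) i] m assms(3) ab(1) by (simp add: U_def algebra_simps)
    next
      case 2
      then show ?thesis
        using Henstock_Kurzweil_Integration.integral_combine[of a x0 b, OF _ _ i] m assms(3) by (simp add: U_def algebra_simps)
    next
      case 3
      then show ?thesis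
        using Henstock_Kurzweil_Integration.integral_combine[of a b x0, OF _ _ i] m assms(3) ab(1) by (simp add: U_def algebra_simps)
    qed
  qed
  then have "primitive_on S U w" using assms(1) by (simp add: primitive_on_def)
  then show ?thesis using that by blast
qed

lemma primitive_on_weak:
  fixes u :: "real \<Rightarrow> 'b::euclidean_space"
  assumes u: "primitive_on {0<..} u w" and \<psi>: "Ck 1 \<psi>" "0 < a" "\<And>t. t \<notin> {a..b} \<Longrightarrow> \<psi> t = 0"
  shows "(LINT t|lebesgue. partial 1 \<psi> t *\<^sub>R u t) = - (LINT t|lebesgue. \<psi> t *\<^sub>R w t)"
proof (cases "a \<le> b")
  case False
  then have "\<psi> = (\<lambda>t. 0)" using \<psi>(3) by auto
  moreover have "partial 1 (\<lambda>t::real. 0::real) = (\<lambda>t. 0)" using partial_eq[OF has_derivative_const] by blast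
  ultimately show ?thesis by simp
next
  case True
  \<comment> \<open>The interval is enlarged beyond the support of \<open>\<psi>\<close>, inside the
    positive half-line, so that both boundary terms of the integration by parts vanish.\<close>
  define c where "c = a / 2"
  define d where "d = b + 1"
  have cd: "0 < c" "c < a" "b < d" "c \<le> d" using \<psi>(2) True by (auto simp: c_def d_def)
  have sub: "{c..d} \<subseteq> {0<..}" using cd by auto
  have z: "\<psi> t = 0" "partial 1 \<psi> t = 0" if "t \<notin> {a..b}" for t
    using \<psi>(3) that partial_outside[of "{a..b}" \<psi> t] by auto
  have cont: "continuous_on UNIV \<psi>" "continuous_on UNIV (partial 1 \<psi>)"
    using \<psi>(1) by (auto intro: Ck_continuous simp: differentiable_imp_continuous_on)
  have iw: "(\<lambda>t. \<psi> t *\<^sub>R w t) absolutely_integrable_on {c..d}"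
    using primitive_onD(1)[OF u sub] cont by (intro absolutely_integrable_continuous_scaleR) (auto intro: continuous_on_subset)
  have iu: "(\<lambda>t. partial 1 \<psi> t *\<^sub>R u t) absolutely_integrable_on {c..d}"
    using primitive_on_continuous_Icc[OF u sub] cont
    by (intro absolutely_integrable_continuous_scaleR absolutely_integrable_continuous_real) (auto intro: continuous_on_subset)
  have LW: "(LINT t|lebesgue. \<psi> t *\<^sub>R w t) = integral {c..d} (\<lambda>t. \<psi> t *\<^sub>R w t)"
    by (rule lebesgue_integral_eq_Icc(2)[OF iw]) (use z cd in auto)
  have LU: "(LINT t|lebesgue. partial 1 \<psi> t *\<^sub>R u t) = integral {c..d} (\<lambda>t. partial 1 \<psi> t *\<^sub>R u t)"
    by (rule lebesgue_integral_eq_Icc(2)[OF iu]) (use z cd in auto)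
  have "integral {c..d} (\<lambda>t. partial 1 \<psi> t *\<^sub>R u t) + integral {c..d} (\<lambda>t. \<psi> t *\<^sub>R w t) = 0"
  proof (rule euclidean_eqI)
    fix e :: 'b assume "e \<in> Basis"
    note ii = iu[THEN set_lebesgue_integral_eq_integral(1)] iw[THEN set_lebesgue_integral_eq_integral(1)]
    have l: "integral {c..d} f \<bullet> e = integral {c..d} (\<lambda>t. e \<bullet> f t)" if "f integrable_on {c..d}" for f :: "real \<Rightarrow> 'b"
      using integral_linear[OF that bounded_linear_inner_right[of e]] by (simp add: o_def inner_commute)
    have "(integral {c..d} (\<lambda>t. partial 1 \<psi> t *\<^sub>R u t) + integral {c..d} (\<lambda>t. \<psi> t *\<^sub>R w t)) \<bullet> e
       = integral {c..d} (\<lambda>t. partial 1 \<psi> t * (e \<bullet> u t)) + integral {c..d} (\<lambda>t. (\<psi> t *\<^sub>R e) \<bullet> w t)"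
      using l[OF ii(1)] l[OF ii(2)] by (simp add: inner_add_left)
    also have "\<dots> = integral {c..d} (\<lambda>t. partial 1 \<psi> t * (e \<bullet> u t) + (\<psi> t *\<^sub>R e) \<bullet> w t)"
      using integrable_linear[OF ii(1) bounded_linear_inner_right[of e]] integrable_linear[OF ii(2) bounded_linear_inner_right[of e]]
      by (intro integral_add[symmetric]) (simp_all add: o_def)
    also have "\<dots> = \<psi> d * (e \<bullet> u d) - \<psi> c * (e \<bullet> u c)"
      using primitive_onD(3)[OF primitive_on_scaled_component[OF u _ \<psi>(1)] sub cd(4)] by simp
    also have "\<dots> = 0" using z cd by auto
    finally show "(integral {c..d} (\<lambda>t. partial 1 \<psi> t *\<^sub>R u t) + integral {c..d} (\<lambda>t. \<psi> t *\<^sub>R w t)) \<bullet> e = 0 \<bullet> e"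
      by simp
  qed
  then show ?thesis unfolding LW LU by (simp add: eq_neg_iff_add_eq_0)
qed

text \<open>A compactly supported function is the derivative of a compactly supported one as soon as
  its mean vanishes: to the right of the support the primitive equals the total integral.\<close>

lemma smooth_primitive:
  fixes \<theta> :: "real \<Rightarrow> real"
  assumes \<theta>: "\<And>n. Ck n \<theta>" and supp: "\<And>t. t \<notin> {a..b} \<Longrightarrow> \<theta> t = 0" and zero: "integral {a..b} \<theta> = 0"
  obtains \<psi> where "\<And>n. Ck n \<psi>" "\<And>t. t \<notin> {a..b} \<Longrightarrow> \<psi> t = 0" "partial 1 \<psi> = \<theta>"
proof -
  \<comment> \<open>Starting at \<open>a - 1\<close> adds nothing to the integral, but makes every
    \<open>t \<ge> a\<close> an interior point, so the fundamental theorem gives a two-sided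
    derivative at \<open>a\<close> as well.\<close>
  define \<psi> where "\<psi> t = integral {a - 1..t} \<theta>" for t
  have cont: "continuous_on S \<theta>" for S using Ck_continuous[OF \<theta>] continuous_on_subset by blast
  then have int: "\<theta> integrable_on {c..d}" for c d by (intro integrable_continuous_real)
  have below: "\<psi> t = 0" if "t < a" for t
  proof -
    have "integral {a - 1..t} \<theta> = integral {a - 1..t} (\<lambda>_. 0)"
      by (rule integral_cong) (use that supp in auto)
    then show ?thesis by (simp add: \<psi>_def)
  qed
  have "(\<psi> has_real_derivative \<theta> t) (at t)" for t
  proof (cases "t < a")
    case True
    have "\<theta> t = 0" using supp True by auto
    have "(\<psi> has_derivative (\<lambda>h. 0)) (at t)"
      by (rule has_derivative_transform_within_open[where s = "{..<a}" and f = "\<lambda>x. 0"]) (use True below in auto)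
    moreover have "(*) (\<theta> t) = (\<lambda>h. 0)" using \<open>\<theta> t = 0\<close> by auto
    ultimately show ?thesis by (simp add: has_field_derivative_def)
  next
    case False
    have "(\<psi> has_vector_derivative \<theta> t) (at t within {a - 1..t + 1})"
      unfolding \<psi>_def by (rule integral_has_vector_derivative[OF cont]) (use False in auto)
    then have "(\<psi> has_vector_derivative \<theta> t) (at t)"
      using False by (subst (asm) at_within_interior) auto
    then show ?thesis by (simp add: has_real_derivative_iff_has_vector_derivative)
  qed
  note d = this
  have "partial 1 \<psi> = \<theta>"
    using partial_eq[OF d[unfolded has_field_derivative_def]] by auto
  moreover have "Ck n \<psi>" for n
    using Ck_real_SucI[OF d \<theta>, of n] Ck_SucD by blast
  moreover have "\<psi> t = 0" if "t \<notin> {a..b}" for t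
  proof (cases "t < a")
    case False
    have 1: "integral {a - 1..t} \<theta> = integral {a - 1..a} \<theta> + integral {a..t} \<theta>"
      using False int by (intro Henstock_Kurzweil_Integration.integral_combine[symmetric]) auto
    have "integral {a..t} \<theta> = 0"
    proof (cases "a \<le> b")
      case True
      have "integral {a..t} \<theta> = integral {a..b} \<theta> + integral {b..t} \<theta>"
        using False that True int by (intro Henstock_Kurzweil_Integration.integral_combine[symmetric]) auto
      also have "integral {b..t} \<theta> = integral {b..t} (\<lambda>_. 0)"
        by (rule integral_spike[of "{b}"]) (use supp in auto)
      finally show ?thesis using zero by simp
    next
      case False
      then have "\<theta> = (\<lambda>_. 0)" using supp by auto
      then show ?thesis by simp
    qed
    moreover have "integral {a - 1..a} \<theta> = integral {a - 1..a} (\<lambda>_. 0)"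
      by (rule integral_spike[of "{a}"]) (use supp in auto)
    ultimately show ?thesis using 1 by (simp add: \<psi>_def)
  qed (use below in auto)
  ultimately show ?thesis using that by blast
qed

text \<open>Subtracting a primitive \<open>U\<close> of \<open>w\<close> leaves \<open>h\<close>
  with vanishing weak derivative. Any bump becomes a derivative of a test function after subtracting
  a multiple of one fixed bump \<open>\<phi>0\<close>, so \<open>h\<close> integrates against bumps
  like a constant and hence is constant.\<close>

lemma du_Bois_Reymond:
  fixes g w :: "real \<Rightarrow> 'b::euclidean_space"
  assumes int: "\<And>a b. 0 < a \<Longrightarrow> g absolutely_integrable_on {a..b}" "\<And>a b. 0 < a \<Longrightarrow> w absolutely_integrable_on {a..b}"
    and weak: "\<And>\<psi> a b. (\<And>n. Ck n \<psi>) \<Longrightarrow> 0 < a \<Longrightarrow> (\<And>t. t \<notin> {a..b} \<Longrightarrow> \<psi> t = 0) \<Longrightarrow>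
      (LINT t|lebesgue. partial 1 \<psi> t *\<^sub>R g t) = - (LINT t|lebesgue. \<psi> t *\<^sub>R w t)"
  obtains u where "primitive_on {0<..} u w" "AE t in lebesgue. 0 < t \<longrightarrow> g t = u t"
proof -
  have pos: "0 < a" if "{a..b} \<subseteq> {0<..}" "a \<le> b" for a b :: real using that by auto
  have "w absolutely_integrable_on {a..b}" if "{a..b} \<subseteq> {0<..}" for a b
    using int(2)[of a b] pos[OF that] by (cases "a \<le> b") auto
  then obtain U where U: "primitive_on {0<..} U w"
    by (rule primitive_on_exists[of "{0<..}" w 1]) auto
  define h where "h t = g t - U t" for t
  have ih: "h absolutely_integrable_on {a..b}" if "0 < a" for a b
    unfolding h_def
  proof (rule set_integral_diff(1)[OF int(1)[OF that]])
    have "{a..b} \<subseteq> {0<..}" using that by auto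
    then show "U absolutely_integrable_on {a..b}"
      by (intro absolutely_integrable_continuous_real primitive_on_continuous_Icc[OF U])
  qed
  have h0: "(LINT t|lebesgue. partial 1 \<psi> t *\<^sub>R h t) = 0"
    if \<psi>: "\<And>n. Ck n \<psi>" "0 < a" "\<And>t. t \<notin> {a..b} \<Longrightarrow> \<psi> t = 0" for \<psi> a b
  proof -
    have cont: "continuous_on S (partial 1 \<psi>)" for S
      using Ck_continuous[OF Ck_Suc_partial[OF \<psi>(1)[of "Suc 0"], of 1]] continuous_on_subset by auto
    have z: "partial 1 \<psi> t = 0" if "t \<notin> {a..b}" for t
      using partial_outside[of "{a..b}" \<psi> t] \<psi>(3) that by auto
    have ii: "integrable lebesgue (\<lambda>t. partial 1 \<psi> t *\<^sub>R g t)" "integrable lebesgue (\<lambda>t. partial 1 \<psi> t *\<^sub>R U t)"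
    proof -
      have "{a..b} \<subseteq> {0<..}" using \<psi>(2) by auto
      then have iU: "U absolutely_integrable_on {a..b}"
        by (intro absolutely_integrable_continuous_real primitive_on_continuous_Icc[OF U])
      show "integrable lebesgue (\<lambda>t. partial 1 \<psi> t *\<^sub>R g t)" "integrable lebesgue (\<lambda>t. partial 1 \<psi> t *\<^sub>R U t)"
        using z lebesgue_integral_eq_Icc(1)[OF absolutely_integrable_continuous_scaleR[OF cont iU]]
          lebesgue_integral_eq_Icc(1)[OF absolutely_integrable_continuous_scaleR[OF cont int(1)[OF \<psi>(2), of b]]]
        by auto
    qed
    then show ?thesis
      unfolding h_def scaleR_diff_right
      using weak[OF \<psi>] primitive_on_weak[OF U \<psi>(1) \<psi>(2,3)] by simp
  qed
  define \<phi>0 where "\<phi>0 = box_bump (1::real) 2 (Suc 0)"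
  define m where "m = integral {1..2} \<phi>0"
  \<comment> \<open>The only possible value of the constant: the mean of \<open>h\<close> weighted
    by the fixed bump.\<close>
  define c where "c = (1 / m) *\<^sub>R (LINT t|lebesgue. \<phi>0 t *\<^sub>R h t)"
  have bb: "continuous_on S (box_bump a b n)" for a b :: real and n S
    using Ck_continuous[OF Ck_box_bump[of 0]] continuous_on_subset by blast
  have bb0: "box_bump a b n t = 0" if "t \<notin> {a..b}" for a b t :: real and n
    using that by (intro box_bump_0) auto
  have "m > 0"
  proof -
    have "\<phi>0 (3/2) > 0" unfolding \<phi>0_def by (rule box_bump_pos) auto
    moreover have "integral {1..2} \<phi>0 = 0 \<longleftrightarrow> (\<forall>x\<in>{1..2}. \<phi>0 x = 0)"
      unfolding \<phi>0_def by (intro integral_eq_0_iff bb box_bump_bounds) auto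
    ultimately have "m \<noteq> 0" unfolding m_def by force
    moreover have "m \<ge> 0" unfolding m_def \<phi>0_def
      by (intro integral_nonneg integrable_continuous_real bb box_bump_bounds)
    ultimately show ?thesis by simp
  qed
  have key: "(LINT t|lebesgue. box_bump a b n t *\<^sub>R h t) = (LINT t|lebesgue. box_bump a b n t) *\<^sub>R c"
    if ab: "0 < a" "a \<le> b" for a b n
  proof -
    \<comment> \<open>A common interval in the positive half-line for the supports of the given bump
      and of \<open>\<phi>0\<close>, which lives on \<open>{1..2}\<close>.\<close>
    define A where "A = min a 1"
    define B where "B = max b 2"
    have AB: "0 < A" "A \<le> a" "A \<le> 1" "b \<le> B" "2 \<le> B" using ab by (auto simp: A_def B_def)
    define k where "k = integral {A..B} (box_bump a b n)"
    have i: "box_bump a b n absolutely_integrable_on {A..B}" "\<phi>0 absolutely_integrable_on {A..B}"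
      unfolding \<phi>0_def by (intro absolutely_integrable_continuous_real bb)+
    have k: "(LINT t|lebesgue. box_bump a b n t) = k"
      unfolding k_def by (rule lebesgue_integral_eq_Icc(2)[OF i(1)]) (use AB in \<open>auto intro!: bb0\<close>)
    have m: "integral {A..B} \<phi>0 = m"
    proof -
      have "(LINT t|lebesgue. \<phi>0 t) = integral {A..B} \<phi>0"
        by (rule lebesgue_integral_eq_Icc(2)[OF i(2)]) (use AB in \<open>auto simp: \<phi>0_def intro!: bb0\<close>)
      moreover have "(LINT t|lebesgue. \<phi>0 t) = integral {1..2} \<phi>0"
        unfolding \<phi>0_def
        by (rule lebesgue_integral_eq_Icc(2)[OF absolutely_integrable_continuous_real[OF bb] bb0])
      ultimately show ?thesis by (simp add: m_def)
    qed
    \<comment> \<open>The multiple of \<open>\<phi>0\<close> is chosen so that the difference has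
      mean zero and is therefore the derivative of a test function.\<close>
    define \<theta> where "\<theta> t = box_bump a b n t - (k / m) * \<phi>0 t" for t
    have "Ck j \<theta>" for j unfolding \<theta>_def[abs_def] \<phi>0_def by (intro Ck_diff Ck_mult Ck_const Ck_box_bump)
    moreover have "\<theta> t = 0" if "t \<notin> {A..B}" for t
      using that AB by (auto simp: \<theta>_def \<phi>0_def bb0)
    moreover have "integral {A..B} \<theta> = 0"
      unfolding \<theta>_def using i[THEN set_lebesgue_integral_eq_integral(1)] m \<open>m > 0\<close>
      by (subst integral_diff) (auto simp: k_def[symmetric] intro: integrable_on_mult_right)
    ultimately obtain \<psi> where \<psi>: "\<And>n. Ck n \<psi>" "\<And>t. t \<notin> {A..B} \<Longrightarrow> \<psi> t = 0" "partial 1 \<psi> = \<theta>"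
      by (metis smooth_primitive)
    have "(LINT t|lebesgue. \<theta> t *\<^sub>R h t) = 0" using h0[OF \<psi>(1) AB(1) \<psi>(2)] \<psi>(3) by simp
    moreover have "integrable lebesgue (\<lambda>t. box_bump a b n t *\<^sub>R h t)" "integrable lebesgue (\<lambda>t. \<phi>0 t *\<^sub>R h t)"
      using integral_box_bump_tendsto(2)[of a b h n] integral_box_bump_tendsto(2)[of 1 2 h "Suc 0"] ih ab by (auto simp: \<phi>0_def)
    ultimately have "(LINT t|lebesgue. box_bump a b n t *\<^sub>R h t) = (k / m) *\<^sub>R (LINT t|lebesgue. \<phi>0 t *\<^sub>R h t)"
    proof -
      assume *: "(LINT t|lebesgue. \<theta> t *\<^sub>R h t) = 0"
        "integrable lebesgue (\<lambda>t. box_bump a b n t *\<^sub>R h t)" "integrable lebesgue (\<lambda>t. \<phi>0 t *\<^sub>R h t)"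
      have "(\<lambda>t. \<theta> t *\<^sub>R h t) = (\<lambda>t. box_bump a b n t *\<^sub>R h t - (k / m) *\<^sub>R (\<phi>0 t *\<^sub>R h t))"
        by (simp add: \<theta>_def scaleR_diff_left)
      with * show ?thesis by (simp only: Bochner_Integration.integral_diff Bochner_Integration.integral_scaleR_right
          Bochner_Integration.integrable_scaleR_right) simp
    qed
    then show ?thesis by (simp add: k c_def)
  qed
  have "AE t in lebesgue. t \<in> {0<..} \<longrightarrow> h t - c = 0"
  proof (rule integrals_zero_imp_AE_zero)
    fix a b :: real assume ab: "cbox a b \<subseteq> {0<..}"
    have i: "h absolutely_integrable_on {a..b}" using ih[of a b] pos[of a b] ab by (cases "a \<le> b") auto
    then show "(\<lambda>t. h t - c) absolutely_integrable_on cbox a b" by (intro set_integral_diff) auto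
    show "integral (cbox a b) (\<lambda>t. h t - c) = 0"
    proof (cases "a \<le> b")
      case True
      \<comment> \<open>Letting the bumps tend to the indicator shows that \<open>h\<close> and the
        constant \<open>c\<close> have equal integrals over every box.\<close>
      have "(\<lambda>n. (LINT t|lebesgue. box_bump a b n t) *\<^sub>R c) \<longlonglongrightarrow> integral (cbox a b) h"
        using integral_box_bump_tendsto(1)[of a b h] i key[of a b] pos[of a b] ab True by simp
      moreover have "(\<lambda>n. (LINT t|lebesgue. box_bump a b n t) *\<^sub>R c) \<longlonglongrightarrow> integral (cbox a b) (\<lambda>_. 1) *\<^sub>R c"
        using integral_box_bump_tendsto(1)[of a b "\<lambda>_::real. 1::real"] by (intro tendsto_intros) auto
      ultimately have "integral (cbox a b) h = integral (cbox a b) (\<lambda>_. 1::real) *\<^sub>R c" by (rule LIMSEQ_unique)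
      moreover have "integral {a..b} (\<lambda>t. h t - c) = integral {a..b} h - integral {a..b} (\<lambda>t. c)"
        using i[THEN set_lebesgue_integral_eq_integral(1)] by (intro integral_diff) auto
      ultimately show ?thesis using True by simp
    qed simp
  qed simp
  then have "AE t in lebesgue. 0 < t \<longrightarrow> g t = U t + c" by eventually_elim (auto simp: h_def algebra_simps)
  moreover have "primitive_on {0<..} (\<lambda>t. U t + c) w"
    using U by (simp add: primitive_on_def)
  ultimately show ?thesis using that by blast
qed

section \<open>Polar coordinates\<close>

text \<open>Directions are represented by points \<open>y\<close> of the unit ball, through \<open>sgn y\<close>;
  this avoids the surface measure on the sphere.\<close>

definition direction_measure :: "'a::euclidean_space measure" where
  "direction_measure = uniform_measure lborel (ball 0 1)"

text \<open>The dimension times the volume of the unit ball is the area of the unit sphere, so this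
  is the area of the sphere of radius \<open>r\<close>.\<close>

definition radius_density :: "'a::euclidean_space itself \<Rightarrow> real \<Rightarrow> real" where
  "radius_density _ r = real DIM('a) * unit_ball_vol (real DIM('a)) * r ^ (DIM('a) - 1) * indicator {0<..} r"

definition radius_measure :: "'a::euclidean_space itself \<Rightarrow> real measure" where
  "radius_measure T = density lborel (\<lambda>r. ennreal (radius_density T r))"

lemma radius_density_measurable [measurable]: "radius_density T \<in> borel_measurable borel"
  unfolding radius_density_def[abs_def] by measurable

lemma radius_density_nonneg: "radius_density T r \<ge> 0"
  by (simp add: radius_density_def indicator_def)

lemma radius_density_pos: "r > 0 \<Longrightarrow> radius_density (T :: 'a::euclidean_space itself) r > 0"
  by (simp add: radius_density_def)

lemma sets_direction_measure [measurable_cong, simp]: "sets direction_measure = sets borel"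
  by (simp add: direction_measure_def)

lemma sets_radius_measure [measurable_cong, simp]: "sets (radius_measure T) = sets borel"
  by (simp add: radius_measure_def)

lemma space_polar [simp]: "space direction_measure = UNIV" "space (radius_measure T) = UNIV"
  by (simp_all add: direction_measure_def radius_measure_def space_density)

lemma prob_space_direction: "prob_space (direction_measure :: 'a::euclidean_space measure)"
  unfolding direction_measure_def
proof (rule prob_space_uniform_measure)
  have "unit_ball_vol (real DIM('a)) > 0" by simp
  then have "unit_ball_vol (real DIM('a)) \<noteq> 0" by linarith
  then show "emeasure lborel (ball (0::'a) 1) \<noteq> 0" by (simp add: emeasure_ball)
  show "emeasure lborel (ball (0::'a) 1) \<noteq> \<infinity>" by (simp add: emeasure_ball)
qed

lemma AE_direction_nonzero: "AE y in (direction_measure :: 'a::euclidean_space measure). y \<noteq> 0"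
proof -
  have "AE y in lborel. (y :: 'a) \<noteq> 0" by (rule AE_lborel_singleton)
  then show ?thesis
    unfolding direction_measure_def
    by (intro AE_uniform_measureI) auto
qed

lemma sigma_finite_radius: "sigma_finite_measure (radius_measure T)"
  unfolding radius_measure_def
  by (subst sigma_finite_measure.sigma_finite_iff_density_finite[OF sigma_finite_lborel]) auto

lemma nn_integral_lborel_scale:
  fixes k :: "'a::euclidean_space \<Rightarrow> ennreal"
  assumes [measurable]: "k \<in> borel_measurable borel" and "s > 0"
  shows "(\<integral>\<^sup>+z. k z \<partial>lborel) = ennreal (s ^ DIM('a)) * (\<integral>\<^sup>+y. k (s *\<^sub>R y) \<partial>lborel)"
  using assms(2)
  by (subst lborel_affine[of s 0]) (simp_all add: nn_integral_density nn_integral_distr nn_integral_cmult)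

text \<open>The radial integral that cancels the weight \<open>norm z ^ n\<close> at the end of
  \<open>nn_integral_polar\<close>.\<close>

lemma nn_integral_inverse_power:
  assumes "a > 0" "n > 0"
  shows "(\<integral>\<^sup>+s. ennreal (real n / s ^ Suc n) * indicator {a..} s \<partial>lborel) = ennreal (1 / a ^ n)"
proof -
  have "(\<integral>\<^sup>+s. ennreal (real n / s ^ Suc n) * indicator {a..} s \<partial>lborel) = ennreal (0 - (- (1 / a ^ n)))"
  proof (rule nn_integral_FTC_atLeast)
    show "((\<lambda>s. - (1 / s ^ n)) has_real_derivative real n / s ^ Suc n) (at s)" if "a \<le> s" for s
    proof -
      have "((\<lambda>s. - (1 / s ^ n)) has_real_derivative (real n * s ^ (n - 1)) / (s ^ n * s ^ n)) (at s)"
        using that assms by (auto intro!: derivative_eq_intros)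
      moreover have "(real n * s ^ (n - 1)) / (s ^ n * s ^ n) = real n / s ^ Suc n"
        using that assms by (cases n) (auto simp: field_simps)
      ultimately show ?thesis by simp
    qed
    have "((\<lambda>s::real. inverse (s ^ n)) \<longlongrightarrow> 0) at_top"
      using assms(2) by (intro tendsto_inverse_0_at_top filterlim_pow_at_top filterlim_ident) auto
    from tendsto_minus[OF this] show "((\<lambda>s::real. - (1 / s ^ n)) \<longlongrightarrow> 0) at_top"
      by (simp add: inverse_eq_divide)
  qed (use assms in auto)
  then show ?thesis by simp
qed

text \<open>Only linear scalings and exchanges of integrals are used. For fixed \<open>y\<close> the
  substitution \<open>r = norm y * s\<close> turns \<open>r *\<^sub>R sgn y\<close> into
  \<open>s *\<^sub>R y\<close>; for fixed \<open>s\<close> the substitution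
  \<open>z = s *\<^sub>R y\<close> restores \<open>f z\<close>; the remaining integral of
  \<open>n / s ^ Suc n\<close> over \<open>s > norm z\<close> cancels
  \<open>norm z ^ n\<close>.\<close>

lemma nn_integral_polar:
  fixes f :: "'a::euclidean_space \<Rightarrow> ennreal"
  assumes [measurable]: "f \<in> borel_measurable borel"
  shows "(\<integral>\<^sup>+x. f x \<partial>lborel) = (\<integral>\<^sup>+r. \<integral>\<^sup>+y. f (r *\<^sub>R sgn y) \<partial>direction_measure \<partial>radius_measure TYPE('a))"
proof -
  define n where "n = DIM('a)"
  define \<kappa> where "\<kappa> = unit_ball_vol (real n)"
  have n: "n > 0" by (simp add: n_def)
  have \<kappa>: "\<kappa> > 0" by (simp add: \<kappa>_def)
  have [measurable]: "(sgn :: 'a \<Rightarrow> 'a) \<in> borel_measurable borel"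
    unfolding sgn_div_norm[abs_def] by measurable
  have [measurable]: "ball (0::'a) 1 \<in> sets borel" by simp
  have dir: "(\<integral>\<^sup>+y. g y \<partial>direction_measure) = (\<integral>\<^sup>+y. g y * indicator (ball 0 1) y \<partial>lborel) / ennreal \<kappa>"
    if [measurable]: "g \<in> borel_measurable borel" for g :: "'a \<Rightarrow> ennreal"
    unfolding direction_measure_def \<kappa>_def n_def
    by (subst nn_integral_uniform_measure) (simp_all add: emeasure_ball)
  have d\<kappa>: "ennreal (real n * \<kappa> * c) * (A / ennreal \<kappa>) = ennreal (real n * c) * A" if "c \<ge> 0" for c and A :: ennreal
  proof -
    have "ennreal (real n * \<kappa> * c) * (A / ennreal \<kappa>) = ennreal (real n * c) * (ennreal \<kappa> * (A / ennreal \<kappa>))"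
    proof -
      have "real n * \<kappa> * c = (real n * c) * \<kappa>" by simp
      then have "ennreal (real n * \<kappa> * c) = ennreal (real n * c) * ennreal \<kappa>"
        using that \<kappa> by (metis ennreal_mult mult_nonneg_nonneg of_nat_0_le_iff less_imp_le)
      then show ?thesis by (simp only: mult.assoc)
    qed
    also have "ennreal \<kappa> * (A / ennreal \<kappa>) = A"
      using \<kappa> by (subst ennreal_times_divide, subst mult.commute, subst ennreal_mult_divide_eq) auto
    finally show ?thesis .
  qed
  have "(\<integral>\<^sup>+r. \<integral>\<^sup>+y. f (r *\<^sub>R sgn y) \<partial>direction_measure \<partial>radius_measure TYPE('a))
    = (\<integral>\<^sup>+r. ennreal (radius_density TYPE('a) r) * (\<integral>\<^sup>+y. f (r *\<^sub>R sgn y) \<partial>direction_measure) \<partial>lborel)"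
  proof -
    interpret S: prob_space "direction_measure :: 'a measure" by (rule prob_space_direction)
    have "(\<lambda>r. \<integral>\<^sup>+y. f (r *\<^sub>R sgn y) \<partial>direction_measure) \<in> borel_measurable borel" by measurable
    then show ?thesis unfolding radius_measure_def by (subst nn_integral_density) auto
  qed
  also have "\<dots> = (\<integral>\<^sup>+r. \<integral>\<^sup>+y. ennreal (real n * (r ^ (n - 1) * indicator {0<..} r)) * f (r *\<^sub>R sgn y) * indicator (ball 0 1) y \<partial>lborel \<partial>lborel)"
  proof (rule nn_integral_cong)
    fix r :: real
    have "ennreal (radius_density TYPE('a) r) * (\<integral>\<^sup>+y. f (r *\<^sub>R sgn y) \<partial>direction_measure)
      = ennreal (real n * \<kappa> * (r ^ (n - 1) * indicator {0<..} r)) * ((\<integral>\<^sup>+y. f (r *\<^sub>R sgn y) * indicator (ball 0 1) y \<partial>lborel) / ennreal \<kappa>)"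
      by (subst dir) (simp_all add: radius_density_def n_def \<kappa>_def mult.assoc)
    also have "\<dots> = ennreal (real n * (r ^ (n - 1) * indicator {0<..} r)) * (\<integral>\<^sup>+y. f (r *\<^sub>R sgn y) * indicator (ball 0 1) y \<partial>lborel)"
      by (rule d\<kappa>) (simp add: indicator_def)
    also have "\<dots> = (\<integral>\<^sup>+y. ennreal (real n * (r ^ (n - 1) * indicator {0<..} r)) * (f (r *\<^sub>R sgn y) * indicator (ball 0 1) y) \<partial>lborel)"
      by (rule nn_integral_cmult[symmetric]) measurable
    finally show "ennreal (radius_density TYPE('a) r) * (\<integral>\<^sup>+y. f (r *\<^sub>R sgn y) \<partial>direction_measure)
      = (\<integral>\<^sup>+y. ennreal (real n * (r ^ (n - 1) * indicator {0<..} r)) * f (r *\<^sub>R sgn y) * indicator (ball 0 1) y \<partial>lborel)"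
      by (simp only: mult.assoc)
  qed
  also have "\<dots> = (\<integral>\<^sup>+y. \<integral>\<^sup>+r. ennreal (real n * (r ^ (n - 1) * indicator {0<..} r)) * f (r *\<^sub>R sgn y) * indicator (ball 0 1) y \<partial>lborel \<partial>lborel)"
    by (rule lborel_pair.Fubini') measurable
  also have "\<dots> = (\<integral>\<^sup>+y. \<integral>\<^sup>+s. ennreal (real n * (s ^ (n - 1) * indicator {0<..} s)) * (ennreal (norm y ^ n) * f (s *\<^sub>R y) * indicator (ball 0 1) y) \<partial>lborel \<partial>lborel)"
  proof (rule nn_integral_cong_AE)
    have "AE y in lborel. (y :: 'a) \<noteq> 0" by (rule AE_lborel_singleton)
    then show "AE y in lborel. (\<integral>\<^sup>+r. ennreal (real n * (r ^ (n - 1) * indicator {0<..} r)) * f (r *\<^sub>R sgn y) * indicator (ball 0 1) y \<partial>lborel)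
       = (\<integral>\<^sup>+s. ennreal (real n * (s ^ (n - 1) * indicator {0<..} s)) * (ennreal (norm y ^ n) * f (s *\<^sub>R y) * indicator (ball 0 1) y) \<partial>lborel)"
    proof eventually_elim
      case (elim y)
      have "norm y > 0" using elim by simp
      then have "(\<integral>\<^sup>+r. ennreal (real n * (r ^ (n - 1) * indicator {0<..} r)) * f (r *\<^sub>R sgn y) * indicator (ball 0 1) y \<partial>lborel)
        = ennreal (norm y) * (\<integral>\<^sup>+s. ennreal (real n * ((norm y * s) ^ (n - 1) * indicator {0<..} (norm y * s))) * f ((norm y * s) *\<^sub>R sgn y) * indicator (ball 0 1) y \<partial>lborel)"
        using nn_integral_lborel_scale[of "\<lambda>r. ennreal (real n * (r ^ (n - 1) * indicator {0<..} r)) * f (r *\<^sub>R sgn y) * indicator (ball 0 1) y" "norm y"] by simp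
      also have "\<dots> = (\<integral>\<^sup>+s. ennreal (norm y) * (ennreal (real n * ((norm y * s) ^ (n - 1) * indicator {0<..} (norm y * s))) * f ((norm y * s) *\<^sub>R sgn y) * indicator (ball 0 1) y) \<partial>lborel)"
        by (rule nn_integral_cmult[symmetric]) measurable
      also have "\<dots> = (\<integral>\<^sup>+s. ennreal (real n * (s ^ (n - 1) * indicator {0<..} s)) * (ennreal (norm y ^ n) * f (s *\<^sub>R y) * indicator (ball 0 1) y) \<partial>lborel)"
      proof (rule nn_integral_cong)
        fix s :: real
        have 1: "(norm y * s) *\<^sub>R sgn y = s *\<^sub>R y" using \<open>norm y > 0\<close> by (simp add: sgn_div_norm)
        have 2: "indicator {0<..} (norm y * s) = (indicator {0<..} s :: real)"
          using \<open>norm y > 0\<close> by (simp add: indicator_def zero_less_mult_iff)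
        have 3: "norm y * (real n * ((norm y * s) ^ (n - 1) * indicator {0<..} s)) = (real n * (s ^ (n - 1) * indicator {0<..} s)) * norm y ^ n"
          using n by (cases n) (auto simp: power_mult_distrib)
        have "ennreal (norm y) * ennreal (real n * ((norm y * s) ^ (n - 1) * indicator {0<..} s))
           = ennreal (real n * (s ^ (n - 1) * indicator {0<..} s)) * ennreal (norm y ^ n)"
          using 3 by (subst (1 2) ennreal_mult[symmetric]) (auto simp: indicator_def)
        then show "ennreal (norm y) * (ennreal (real n * ((norm y * s) ^ (n - 1) * indicator {0<..} (norm y * s))) * f ((norm y * s) *\<^sub>R sgn y) * indicator (ball 0 1) y)
          = ennreal (real n * (s ^ (n - 1) * indicator {0<..} s)) * (ennreal (norm y ^ n) * f (s *\<^sub>R y) * indicator (ball 0 1) y)"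
          unfolding 1 2 by (metis (no_types, lifting) mult.assoc)
      qed
      finally show ?case .
    qed
  qed
  also have "\<dots> = (\<integral>\<^sup>+s. \<integral>\<^sup>+y. ennreal (real n * (s ^ (n - 1) * indicator {0<..} s)) * (ennreal (norm y ^ n) * f (s *\<^sub>R y) * indicator (ball 0 1) y) \<partial>lborel \<partial>lborel)"
    by (rule lborel_pair.Fubini') measurable
  also have "\<dots> = (\<integral>\<^sup>+s. \<integral>\<^sup>+z. ennreal (real n / s ^ Suc n * indicator {0<..} s) * (ennreal (norm z ^ n) * f z * indicator (ball 0 s) z) \<partial>lborel \<partial>lborel)"
  proof (rule nn_integral_cong)
    fix s :: real
    show "(\<integral>\<^sup>+y. ennreal (real n * (s ^ (n - 1) * indicator {0<..} s)) * (ennreal (norm y ^ n) * f (s *\<^sub>R y) * indicator (ball 0 1) y) \<partial>lborel)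
      = (\<integral>\<^sup>+z. ennreal (real n / s ^ Suc n * indicator {0<..} s) * (ennreal (norm z ^ n) * f z * indicator (ball 0 s) z) \<partial>lborel)"
    proof (cases "s > 0")
      case True
      have [measurable]: "Measurable.pred borel (\<lambda>x::'a. s *\<^sub>R x \<in> ball 0 s)"
        unfolding mem_ball dist_0_norm by measurable
      have "(\<integral>\<^sup>+z. ennreal (real n / s ^ Suc n * indicator {0<..} s) * (ennreal (norm z ^ n) * f z * indicator (ball 0 s) z) \<partial>lborel)
        = ennreal (s ^ n) * (\<integral>\<^sup>+y. ennreal (real n / s ^ Suc n) * (ennreal (norm (s *\<^sub>R y) ^ n) * f (s *\<^sub>R y) * indicator (ball 0 s) (s *\<^sub>R y)) \<partial>lborel)"
      proof -
        have [measurable]: "ball (0::'a) s \<in> sets borel" by simp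
        have m: "(\<lambda>z. ennreal (real n / s ^ Suc n * indicator {0<..} s) * (ennreal (norm z ^ n) * f z * indicator (ball 0 s) z)) \<in> borel_measurable borel"
          by measurable
        show ?thesis by (subst nn_integral_lborel_scale[OF m True]) (use True in \<open>simp add: n_def\<close>)
      qed
      also have "\<dots> = (\<integral>\<^sup>+y. ennreal (s ^ n) * (ennreal (real n / s ^ Suc n) * (ennreal (norm (s *\<^sub>R y) ^ n) * f (s *\<^sub>R y) * indicator (ball 0 s) (s *\<^sub>R y))) \<partial>lborel)"
        by (rule nn_integral_cmult[symmetric]) measurable
      also have "\<dots> = (\<integral>\<^sup>+y. ennreal (real n * (s ^ (n - 1) * indicator {0<..} s)) * (ennreal (norm y ^ n) * f (s *\<^sub>R y) * indicator (ball 0 1) y) \<partial>lborel)"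
      proof (rule nn_integral_cong)
        fix y :: 'a
        have 1: "indicator (ball 0 s) (s *\<^sub>R y) = (indicator (ball 0 1) y :: ennreal)"
          using True by (simp add: indicator_def)
        have 2: "s ^ n * (real n / s ^ Suc n) * norm (s *\<^sub>R y) ^ n = real n * s ^ (n - 1) * norm y ^ n"
          using True n by (cases n) (auto simp: power_mult_distrib field_simps)
        have "ennreal (s ^ n) * (ennreal (real n / s ^ Suc n) * ennreal (norm (s *\<^sub>R y) ^ n)) = ennreal (real n * s ^ (n - 1)) * ennreal (norm y ^ n)"
          using 2 True by (simp add: ennreal_mult[symmetric] mult.assoc)
        then show "ennreal (s ^ n) * (ennreal (real n / s ^ Suc n) * (ennreal (norm (s *\<^sub>R y) ^ n) * f (s *\<^sub>R y) * indicator (ball 0 s) (s *\<^sub>R y)))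
          = ennreal (real n * (s ^ (n - 1) * indicator {0<..} s)) * (ennreal (norm y ^ n) * f (s *\<^sub>R y) * indicator (ball 0 1) y)"
          unfolding 1 using True by (simp add: mult.assoc[symmetric])
      qed
      finally show ?thesis by simp
    qed simp
  qed
  also have "\<dots> = (\<integral>\<^sup>+z. \<integral>\<^sup>+s. ennreal (real n / s ^ Suc n * indicator {0<..} s) * (ennreal (norm z ^ n) * f z * indicator (ball 0 s) z) \<partial>lborel \<partial>lborel)"
  proof (rule lborel_pair.Fubini')
    have "Measurable.pred (borel \<Otimes>\<^sub>M borel) (\<lambda>p::'a \<times> real. fst p \<in> ball 0 (snd p))"
      unfolding mem_ball dist_0_norm by measurable
    then have [measurable]: "(\<lambda>p::'a \<times> real. indicator (ball 0 (snd p)) (fst p) :: ennreal) \<in> borel_measurable (borel \<Otimes>\<^sub>M borel)"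
      unfolding indicator_def of_bool_def by measurable
    then show "(\<lambda>(z, s). ennreal (real n / s ^ Suc n * indicator {0<..} s) * (ennreal (norm z ^ n) * f z * indicator (ball 0 s) z)) \<in> borel_measurable (lborel \<Otimes>\<^sub>M lborel)"
      unfolding split_beta by measurable
  qed
  also have "\<dots> = (\<integral>\<^sup>+z. f z \<partial>lborel)"
  proof (rule nn_integral_cong_AE)
    have "AE z in lborel. (z :: 'a) \<noteq> 0" by (rule AE_lborel_singleton)
    then show "AE z in lborel. (\<integral>\<^sup>+s. ennreal (real n / s ^ Suc n * indicator {0<..} s) * (ennreal (norm z ^ n) * f z * indicator (ball 0 s) z) \<partial>lborel) = f z"
    proof eventually_elim
      case (elim z)
      then have z: "norm z > 0" by simp
      have "(\<integral>\<^sup>+s. ennreal (real n / s ^ Suc n * indicator {0<..} s) * (ennreal (norm z ^ n) * f z * indicator (ball 0 s) z) \<partial>lborel)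
         = (\<integral>\<^sup>+s. (ennreal (norm z ^ n) * f z) * (ennreal (real n / s ^ Suc n) * indicator {norm z..} s) \<partial>lborel)"
      \<comment> \<open>The open ball gives \<open>norm z < s\<close> and the half-line gives
        \<open>norm z \<le> s\<close>; the single exceptional value of \<open>s\<close> is a null
        set.\<close>
      proof (rule nn_integral_cong_AE)
        have "AE s in lborel. s \<noteq> norm z" by (rule AE_lborel_singleton)
        then show "AE s in lborel. ennreal (real n / s ^ Suc n * indicator {0<..} s) * (ennreal (norm z ^ n) * f z * indicator (ball 0 s) z)
          = (ennreal (norm z ^ n) * f z) * (ennreal (real n / s ^ Suc n) * indicator {norm z..} s)"
          by eventually_elim (use less_le_trans[OF z] in \<open>auto simp: indicator_def mult_ac\<close>)
      qed
      also have "\<dots> = (ennreal (norm z ^ n) * f z) * ennreal (1 / norm z ^ n)"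
        by (subst nn_integral_cmult) (measurable, simp only: nn_integral_inverse_power[OF z n])
      also have "\<dots> = f z * (ennreal (norm z ^ n) * ennreal (1 / norm z ^ n))" by (simp add: mult_ac)
      also have "ennreal (norm z ^ n) * ennreal (1 / norm z ^ n) = 1"
        using z by (simp add: ennreal_mult[symmetric])
      finally show ?case by simp
    qed
  qed
  finally show ?thesis by simp
qed

lemma measurable_polar [measurable]:
  "(\<lambda>(r, y::'a::euclidean_space). r *\<^sub>R sgn y) \<in> borel_measurable (radius_measure T \<Otimes>\<^sub>M direction_measure)"
proof -
  have [measurable]: "(sgn :: 'a \<Rightarrow> 'a) \<in> borel_measurable borel"
    unfolding sgn_div_norm[abs_def] by measurable
  show ?thesis by measurable
qed

lemma lborel_eq_distr_polar:
  "lborel = distr (radius_measure TYPE('a) \<Otimes>\<^sub>M direction_measure) borel (\<lambda>(r, y::'a::euclidean_space). r *\<^sub>R sgn y)"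
proof (rule measure_eqI)
  interpret S: prob_space "direction_measure :: 'a measure" by (rule prob_space_direction)
  fix A :: "'a set" assume "A \<in> sets lborel"
  then have [measurable]: "A \<in> sets borel" by simp
  have "emeasure lborel A = (\<integral>\<^sup>+x. indicator A x \<partial>lborel)" by simp
  also have "\<dots> = (\<integral>\<^sup>+r. \<integral>\<^sup>+y. indicator A (r *\<^sub>R sgn y) \<partial>direction_measure \<partial>radius_measure TYPE('a))"
    by (rule nn_integral_polar) measurable
  also have "\<dots> = (\<integral>\<^sup>+p. (indicator A (case p of (r, y) \<Rightarrow> r *\<^sub>R sgn y)) \<partial>(radius_measure TYPE('a) \<Otimes>\<^sub>M direction_measure))"
    by (subst S.nn_integral_fst[symmetric]) auto
  also have "\<dots> = (\<integral>\<^sup>+x. indicator A x \<partial>(distr (radius_measure TYPE('a) \<Otimes>\<^sub>M direction_measure) borel (\<lambda>(r, y). r *\<^sub>R sgn y)))"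
    by (subst nn_integral_distr) auto
  finally show "emeasure lborel A = emeasure (distr (radius_measure TYPE('a) \<Otimes>\<^sub>M direction_measure) borel (\<lambda>(r, y). r *\<^sub>R sgn y)) A"
    by simp
qed simp

lemma AE_polar:
  assumes "AE x in (lborel :: 'a::euclidean_space measure). P x"
  shows "AE r in radius_measure TYPE('a). AE y in direction_measure. P (r *\<^sub>R sgn y)"
proof -
  interpret S: prob_space "direction_measure :: 'a measure" by (rule prob_space_direction)
  interpret R: sigma_finite_measure "radius_measure TYPE('a)" by (rule sigma_finite_radius)
  interpret RS: pair_sigma_finite "radius_measure TYPE('a)" "direction_measure :: 'a measure" ..
  obtain N where N: "N \<in> null_sets lborel" "{x. \<not> P x} \<subseteq> N"
    using assms unfolding eventually_ae_filter by auto
  have "AE x in distr (radius_measure TYPE('a) \<Otimes>\<^sub>M direction_measure) borel (\<lambda>(r, y::'a). r *\<^sub>R sgn y). x \<notin> N"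
    unfolding lborel_eq_distr_polar[symmetric] using N(1) by (rule AE_not_in)
  then have "AE p in radius_measure TYPE('a) \<Otimes>\<^sub>M direction_measure. (case p of (r, y::'a) \<Rightarrow> r *\<^sub>R sgn y) \<notin> N"
    using N(1) by (subst (asm) AE_distr_iff) auto
  then have "AE r in radius_measure TYPE('a). AE y in direction_measure. (case (r, y::'a) of (r, y) \<Rightarrow> r *\<^sub>R sgn y) \<notin> N"
    by (rule RS.AE_pair)
  then show ?thesis using N(2) by (auto elim!: eventually_mono)
qed

lemma norm_polar: "y \<noteq> 0 \<Longrightarrow> r > 0 \<Longrightarrow> norm (r *\<^sub>R sgn y) = r" "r > 0 \<Longrightarrow> sgn (r *\<^sub>R sgn y) = sgn y"
  by (auto simp: norm_sgn sgn_scaleR) (cases "y = 0", simp_all add: sgn_div_norm)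

lemma AE_radius_iff:
  "(AE r in radius_measure (T :: 'a::euclidean_space itself). P r) \<longleftrightarrow> (AE r in lborel. 0 < r \<longrightarrow> P r)"
proof -
  have "ennreal (radius_density T r) \<noteq> 0 \<longleftrightarrow> 0 < r" for r
  proof (cases "0 < r")
    case True
    then show ?thesis using radius_density_pos[OF True, of T] by simp
  qed (simp add: radius_density_def)
  then show ?thesis unfolding radius_measure_def
    by (subst AE_density) (auto simp: zero_less_iff_neq_zero)
qed

lemma AE_radius_pos: "AE r in radius_measure (T :: 'a::euclidean_space itself). 0 < r"
  by (simp add: AE_radius_iff)

lemma integral_polar:
  fixes f :: "'a::euclidean_space \<Rightarrow> 'b::{banach, second_countable_topology}"
  assumes "integrable lborel f"
  shows "integrable (radius_measure TYPE('a)) (\<lambda>r. LINT y|direction_measure. f (r *\<^sub>R sgn y))"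
    "(LINT x|lborel. f x) = (LINT r|radius_measure TYPE('a). LINT y|direction_measure. f (r *\<^sub>R sgn y))"
    "AE r in radius_measure TYPE('a). integrable direction_measure (\<lambda>y::'a. f (r *\<^sub>R sgn y))"
proof -
  interpret S: prob_space "direction_measure :: 'a measure" by (rule prob_space_direction)
  interpret R: sigma_finite_measure "radius_measure TYPE('a)" by (rule sigma_finite_radius)
  interpret RS: pair_sigma_finite "radius_measure TYPE('a)" "direction_measure :: 'a measure" ..
  have [measurable]: "f \<in> borel_measurable borel" using assms by simp
  have i: "integrable (radius_measure TYPE('a) \<Otimes>\<^sub>M direction_measure) (\<lambda>(r, y). f (r *\<^sub>R sgn y))"
    using assms by (subst (asm) lborel_eq_distr_polar) (simp add: integrable_distr_eq case_prod_unfold)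
  show "integrable (radius_measure TYPE('a)) (\<lambda>r. LINT y|direction_measure. f (r *\<^sub>R sgn y))"
    using RS.integrable_fst[OF i] by simp
  show "AE r in radius_measure TYPE('a). integrable direction_measure (\<lambda>y::'a. f (r *\<^sub>R sgn y))"
    using RS.AE_integrable_fst'[OF i] by simp
  have "(LINT x|lborel. f x) = (LINT p|(radius_measure TYPE('a) \<Otimes>\<^sub>M direction_measure). (case p of (r, y) \<Rightarrow> f (r *\<^sub>R sgn y)))"
    by (subst lborel_eq_distr_polar) (simp add: integral_distr case_prod_unfold)
  then show "(LINT x|lborel. f x) = (LINT r|radius_measure TYPE('a). LINT y|direction_measure. f (r *\<^sub>R sgn y))"
    using RS.integral_fst[OF i] by simp
qed

lemma distr_norm: "distr lborel borel (norm :: 'a::euclidean_space \<Rightarrow> real) = radius_measure TYPE('a)"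
proof (rule measure_eqI)
  interpret S: prob_space "direction_measure :: 'a measure" by (rule prob_space_direction)
  fix A assume "A \<in> sets (distr lborel borel (norm :: 'a \<Rightarrow> real))"
  then have [measurable]: "A \<in> sets borel" by simp
  have "emeasure (distr lborel borel (norm :: 'a \<Rightarrow> real)) A = (\<integral>\<^sup>+x. indicator A (norm (x::'a)) \<partial>lborel)"
    by (subst nn_integral_indicator[symmetric], simp, subst nn_integral_distr) auto
  also have "\<dots> = (\<integral>\<^sup>+r. \<integral>\<^sup>+y. indicator A (norm (r *\<^sub>R sgn (y::'a))) \<partial>direction_measure \<partial>radius_measure TYPE('a))"
    by (rule nn_integral_polar) measurable
  also have "\<dots> = (\<integral>\<^sup>+r. indicator A r \<partial>radius_measure TYPE('a))"
  proof (rule nn_integral_cong_AE)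
    show "AE r in radius_measure TYPE('a). (\<integral>\<^sup>+y. indicator A (norm (r *\<^sub>R sgn (y::'a))) \<partial>direction_measure) = indicator A r"
      using AE_radius_pos
    proof eventually_elim
      case (elim r)
      have "(\<integral>\<^sup>+y. indicator A (norm (r *\<^sub>R sgn (y::'a))) \<partial>direction_measure) = (\<integral>\<^sup>+y. indicator A r \<partial>(direction_measure :: 'a measure))"
        
        by (rule nn_integral_cong_AE, rule eventually_mono[OF AE_direction_nonzero]) (metis norm_polar(1) elim)
      then show ?case by (simp add: S.emeasure_space_1[simplified])
    qed
  qed
  finally show "emeasure (distr lborel borel (norm :: 'a \<Rightarrow> real)) A = emeasure (radius_measure TYPE('a)) A" by simp
qed simp

lemma AE_norm: "AE r in radius_measure TYPE('a::euclidean_space). P r \<Longrightarrow> AE x in (lborel :: 'a measure). P (norm x)"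
  unfolding distr_norm[symmetric] by (rule AE_distrD) auto

lemma AE_lborel_norm: "AE r in lborel. 0 < r \<longrightarrow> P r \<Longrightarrow> AE x in (lborel :: 'a::euclidean_space measure). P (norm x)"
  using AE_norm[unfolded AE_radius_iff] .

lemma radial_integral:
  fixes h :: "real \<Rightarrow> 'b::{banach, second_countable_topology}"
  assumes [measurable]: "h \<in> borel_measurable borel"
  shows "integrable lborel (\<lambda>x::'a::euclidean_space. h (norm x)) \<longleftrightarrow> integrable lborel (\<lambda>r. radius_density TYPE('a) r *\<^sub>R h r)"
    "(LINT x|lborel. h (norm (x::'a))) = (LINT r|lborel. radius_density TYPE('a) r *\<^sub>R h r)"
proof -
  show "integrable lborel (\<lambda>x::'a. h (norm x)) \<longleftrightarrow> integrable lborel (\<lambda>r. radius_density TYPE('a) r *\<^sub>R h r)"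
    using integrable_distr_eq[of "norm :: 'a \<Rightarrow> real" lborel borel h]
    by (simp add: distr_norm radius_measure_def integrable_density radius_density_nonneg)
  show "(LINT x|lborel. h (norm (x::'a))) = (LINT r|lborel. radius_density TYPE('a) r *\<^sub>R h r)"
    using integral_distr[of "norm :: 'a \<Rightarrow> real" lborel borel h]
    by (simp add: distr_norm radius_measure_def integral_density radius_density_nonneg)
qed

section \<open>Radial functions with weak gradient in L2\<close>

text \<open>Elements of the function space are Lebesgue measurable, while polar coordinates are set
  up for Borel functions. This passes to a Borel representative, coordinate by coordinate.\<close>

lemma lebesgue_ex_borel:
  fixes f :: "'a::euclidean_space \<Rightarrow> 'b::euclidean_space"
  assumes "f \<in> borel_measurable lebesgue"
  obtains g where "g \<in> borel_measurable borel" "AE x in lborel. f x = g x"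
proof -
  have "\<exists>g. g \<in> borel_measurable lborel \<and> (AE x in lborel. f x \<bullet> i = g x)" for i
  proof -
    have "(\<lambda>x. f x \<bullet> i) \<in> borel_measurable lebesgue" using assms by measurable
    from completion_ex_borel_measurable_real[OF this] show ?thesis by auto
  qed
  then obtain g where g: "\<And>i. g i \<in> borel_measurable lborel" "\<And>i. AE x in lborel. f x \<bullet> i = g i x" by metis
  have "AE x in lborel. \<forall>i\<in>Basis. f x \<bullet> i = g i x"
    using g(2) by (simp add: AE_finite_all)
  then have "AE x in lborel. f x = (\<Sum>i\<in>Basis. g i x *\<^sub>R i)"
    by eventually_elim (metis (mono_tags, lifting) euclidean_representation sum.cong)
  moreover have "(\<lambda>x. \<Sum>i\<in>Basis. g i x *\<^sub>R i) \<in> borel_measurable borel"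
    using g(1) by (auto intro!: borel_measurable_sum borel_measurable_scaleR)
  ultimately show ?thesis using that by blast
qed

lemma AE_lebesgue_imp_lborel: "AE x in lebesgue. P x \<Longrightarrow> AE x in lborel. P x"
  by (simp add: AE_completion_iff)

lemma lebesgue_measurable_AE:
  fixes f g :: "'a::euclidean_space \<Rightarrow> 'b::euclidean_space"
  assumes g: "g \<in> borel_measurable lebesgue" and ae: "AE x in lebesgue. f x = g x"
  shows "f \<in> borel_measurable lebesgue"
proof -
  have "AE x in lebesgue. g x = f x" using ae by eventually_elim simp
  then show ?thesis using borel_measurable_AE[OF g] by blast
qed

lemma lebesgue_integral_lborel_AE:
  fixes f g :: "'a::euclidean_space \<Rightarrow> 'b::euclidean_space"
  assumes "AE x in lborel. f x = g x" "g \<in> borel_measurable borel"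
  shows "integrable lebesgue f \<longleftrightarrow> integrable lborel g" "(LINT x|lebesgue. f x) = (LINT x|lborel. g x)"
proof -
  have ae: "AE x in lebesgue. f x = g x" using assms(1) by (rule AE_completion)
  have g: "g \<in> borel_measurable lebesgue" using assms(2) by (simp add: measurable_completion)
  have f: "f \<in> borel_measurable lebesgue"
    using g ae by (rule lebesgue_measurable_AE)
  show "integrable lebesgue f \<longleftrightarrow> integrable lborel g"
    using integrable_cong_AE[OF f g ae] integrable_completion[of g lborel] assms(2) by simp
  show "(LINT x|lebesgue. f x) = (LINT x|lborel. g x)"
    using integral_cong_AE[OF f g ae] integral_completion[of g lborel] assms(2) by simp
qed

text \<open>Jensen's inequality for the squared norm, from the nonnegativity of the variance.
  Integrability of \<open>X\<close> itself comes from
  \<open>norm z \<le> 1 + (norm z)\<^sup>2\<close>.\<close>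

lemma norm_integral_power2_le:
  fixes X :: "'a \<Rightarrow> 'b::euclidean_space"
  assumes "prob_space M" and [measurable]: "X \<in> borel_measurable M" and X2: "integrable M (\<lambda>y. (norm (X y))\<^sup>2)"
  shows "integrable M X" "(norm (LINT y|M. X y))\<^sup>2 \<le> (LINT y|M. (norm (X y))\<^sup>2)"
proof -
  interpret prob_space M by fact
  show X: "integrable M X"
  proof (rule Bochner_Integration.integrable_bound)
    show "integrable M (\<lambda>y. 1 + (norm (X y))\<^sup>2)" using X2 by simp
    have "norm z \<le> norm (1 + (norm z)\<^sup>2)" for z :: 'b
      using zero_le_power2[of "norm z - 1"] norm_ge_zero[of z] unfolding power2_diff one_power2 real_norm_def by linarith
    then show "AE y in M. norm (X y) \<le> norm (1 + (norm (X y))\<^sup>2)" by simp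
  qed simp
  define m where "m = (LINT y|M. X y)"
  have "0 \<le> (LINT y|M. (norm (X y - m))\<^sup>2)" by simp
  also have "(\<lambda>y. (norm (X y - m))\<^sup>2) = (\<lambda>y. (norm (X y))\<^sup>2 - 2 * (m \<bullet> X y) + (norm m)\<^sup>2)"
    by (intro ext) (simp add: power2_norm_eq_inner algebra_simps inner_commute)
  also have "(LINT y|M. (norm (X y))\<^sup>2 - 2 * (m \<bullet> X y) + (norm m)\<^sup>2)
      = (LINT y|M. (norm (X y))\<^sup>2) - 2 * (m \<bullet> (LINT y|M. X y)) + (norm m)\<^sup>2"
    using X X2 by (simp add: prob_space)
  also have "\<dots> = (LINT y|M. (norm (X y))\<^sup>2) - (norm m)\<^sup>2"
    unfolding m_def[symmetric] by (simp add: power2_norm_eq_inner)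
  finally show "(norm (LINT y|M. X y))\<^sup>2 \<le> (LINT y|M. (norm (X y))\<^sup>2)" by (simp add: m_def)
qed

text \<open>Away from the origin the density is bounded below by its value at \<open>a\<close>, and
  a norm is at most one plus its \<open>k\<close>-th power. This gives local integrability of the
  profile and of its weak derivative.\<close>

lemma absolutely_integrable_radial_weight:
  fixes h :: "real \<Rightarrow> 'b::euclidean_space" and T :: "'a::euclidean_space itself"
  assumes [measurable]: "h \<in> borel_measurable borel" and int: "integrable lborel (\<lambda>r. radius_density T r * norm (h r) ^ k)"
    and "k > 0" "0 < a"
  shows "h absolutely_integrable_on {a..b}"
proof -
  define c where "c = radius_density T a"
  have c: "c > 0" using radius_density_pos[OF \<open>0 < a\<close>] by (simp add: c_def)
  have mono: "c \<le> radius_density T r" if "a \<le> r" for r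
    using that \<open>0 < a\<close> unfolding c_def radius_density_def
    by (auto intro!: mult_left_mono power_mono)
  have "integrable lborel (\<lambda>r. indicator {a..b} r *\<^sub>R h r)"
  proof (rule Bochner_Integration.integrable_bound)
    show "integrable lborel (\<lambda>r. indicator {a..b} r + (1 / c) * (radius_density T r * norm (h r) ^ k))"
      using int by (intro Bochner_Integration.integrable_add integrable_mult_right integrable_real_indicator) (auto simp: emeasure_lborel_Icc_eq)
    have "norm (indicator {a..b} r *\<^sub>R h r) \<le> indicator {a..b} r + (1 / c) * (radius_density T r * norm (h r) ^ k)" for r
    proof (cases "r \<in> {a..b}")
      case True
      have "norm (h r) \<le> 1 + norm (h r) ^ k"
      proof (cases "norm (h r) \<le> 1")
        case False
        then show ?thesis using self_le_power[of "norm (h r)" k] \<open>k > 0\<close> by simp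
      qed (simp add: add_increasing2)
      also have "norm (h r) ^ k = (1 / c) * (c * norm (h r) ^ k)" using c by simp
      also have "\<dots> \<le> (1 / c) * (radius_density T r * norm (h r) ^ k)"
        using c mono True by (intro mult_left_mono mult_right_mono) auto
      finally show ?thesis using True by simp
    next
      case False
      then show ?thesis using c radius_density_nonneg[of T r] by simp
    qed
    then show "AE r in lborel. norm (indicator {a..b} r *\<^sub>R h r) \<le> norm (indicator {a..b} r + (1 / c) * (radius_density T r * norm (h r) ^ k))"
      by (intro AE_I2) (smt (verit) real_norm_def)
  qed measurable
  then show ?thesis
    by (simp add: set_integrable_def integrable_completion)
qed

text \<open>Cauchy-Schwarz. With the coordinates of \<open>sgn x\<close> as coefficients it bounds
  the radial derivative by the full gradient.\<close>

lemma norm_sum_scaleR_power2_le: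
  fixes v :: "'i \<Rightarrow> 'b::real_inner"
  assumes "(\<Sum>i\<in>I. (a i)\<^sup>2) \<le> 1"
  shows "(norm (\<Sum>i\<in>I. a i *\<^sub>R v i))\<^sup>2 \<le> (\<Sum>i\<in>I. (norm (v i))\<^sup>2)"
proof -
  have "norm (\<Sum>i\<in>I. a i *\<^sub>R v i) \<le> (\<Sum>i\<in>I. \<bar>a i\<bar> * norm (v i))"
    using norm_sum[of "\<lambda>i. a i *\<^sub>R v i" I] by simp
  then have "(norm (\<Sum>i\<in>I. a i *\<^sub>R v i))\<^sup>2 \<le> (\<Sum>i\<in>I. \<bar>a i\<bar> * norm (v i))\<^sup>2"
    by (intro power_mono) auto
  also have "\<dots> \<le> (\<Sum>i\<in>I. \<bar>a i\<bar>\<^sup>2) * (\<Sum>i\<in>I. (norm (v i))\<^sup>2)" by (rule Cauchy_Schwarz_ineq_sum)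
  also have "\<dots> \<le> 1 * (\<Sum>i\<in>I. (norm (v i))\<^sup>2)"
    using assms by (intro mult_right_mono sum_nonneg) auto
  finally show ?thesis by simp
qed

text \<open>Radiality of the weak gradient is never established. The directional mean of the radial
  derivative is already a weak derivative of the profile, and two inequalities (Cauchy-Schwarz, then
  Jensen) give the one-sided Dirichlet bound, which suffices for a lower bound. The last conclusion
  is what later transfers the weak equation to the half-line.\<close>

lemma radial_profile:
  fixes Q :: "'a::euclidean_space \<Rightarrow> 'b::euclidean_space" and v :: "'a \<Rightarrow> 'a \<Rightarrow> 'b"
  assumes Q: "Q \<in> borel_measurable lebesgue" "integrable lebesgue (\<lambda>x. norm (Q x) ^ 6)"
    and rad: "AE x in lebesgue. Q x = g0 (norm x)"
    and v: "\<And>i. i \<in> Basis \<Longrightarrow> has_weak_partial i Q (v i)"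
      "\<And>i. i \<in> Basis \<Longrightarrow> integrable lebesgue (\<lambda>x. (norm (v i x))\<^sup>2)"
  obtains u w :: "real \<Rightarrow> 'b" where
    "primitive_on {0<..} u w" "w \<in> borel_measurable borel"
    "AE x in lebesgue. Q x = u (norm x)"
    "integrable lborel (\<lambda>r. radius_density TYPE('a) r * norm (u r) ^ 6)"
    "integrable lborel (\<lambda>r. radius_density TYPE('a) r * (norm (w r))\<^sup>2)"
    "(LINT r|lborel. radius_density TYPE('a) r * (norm (w r))\<^sup>2) \<le> dirichlet Q"
    "\<And>\<psi> a b. (\<And>n. Ck n \<psi>) \<Longrightarrow> 0 < a \<Longrightarrow> (\<And>t. t \<notin> {a..b} \<Longrightarrow> \<psi> t = 0) \<Longrightarrow>
      (LINT x|lebesgue. (\<Sum>i\<in>Basis. partial i (\<lambda>x. \<psi> (norm x)) x *\<^sub>R v i x))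
       = (LINT r|lborel. (radius_density TYPE('a) r * partial 1 \<psi> r) *\<^sub>R w r)"
proof -
  interpret S: prob_space "direction_measure :: 'a measure" by (rule prob_space_direction)
  have [measurable]: "(sgn :: 'a \<Rightarrow> 'a) \<in> borel_measurable borel"
    unfolding sgn_div_norm[abs_def] by measurable
  define d where "d = DIM('a)"
  define \<kappa> where "\<kappa> = real d * unit_ball_vol (real d)"
  have \<kappa>: "\<kappa> > 0" by (simp add: \<kappa>_def d_def)
  have dens: "radius_density TYPE('a) r = \<kappa> * r ^ (d - 1)" if "r > 0" for r
    using that by (simp add: radius_density_def \<kappa>_def d_def)
  have dens0: "radius_density TYPE('a) r = 0" if "r \<le> 0" for r
    using that by (simp add: radius_density_def)

  obtain Q' where Q'[measurable]: "Q' \<in> borel_measurable borel" and QQ': "AE x in lborel. Q x = Q' x"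
    using lebesgue_ex_borel[OF Q(1)] by metis
  have "\<exists>v'. v' \<in> borel_measurable borel \<and> (AE x in lborel. v i x = v' x)" if "i \<in> Basis" for i
  proof -
    have "v i \<in> borel_measurable lebesgue"
      using v(1)[OF that] loc_integrable_measurable unfolding has_weak_partial_def by blast
    then show ?thesis using lebesgue_ex_borel[of "v i"] by metis
  qed
  then obtain v' where v'0: "\<And>i. i \<in> Basis \<Longrightarrow> v' i \<in> borel_measurable borel"
    and vv'0: "\<And>i. i \<in> Basis \<Longrightarrow> AE x in lborel. v i x = v' i x" by metis
  have vv': "AE x in lborel. \<forall>i\<in>Basis. v i x = v' i x" using vv'0 by (simp add: AE_finite_all)
  have v'2: "integrable lborel (\<lambda>x. (norm (v' i x))\<^sup>2)" if "i \<in> Basis" for i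
  proof -
    have "(\<lambda>x. (norm (v' i x))\<^sup>2) \<in> borel_measurable borel" using v'0[OF that] by measurable
    moreover have "AE x in lborel. (norm (v i x))\<^sup>2 = (norm (v' i x))\<^sup>2" using vv'0[OF that] by eventually_elim simp
    ultimately show ?thesis
      using lebesgue_integral_lborel_AE(1)[of "\<lambda>x. (norm (v i x))\<^sup>2" "\<lambda>x. (norm (v' i x))\<^sup>2"] v(2)[OF that] by blast
  qed

  \<comment> \<open>The radial derivative, formed from Borel representatives of the weak partial
    derivatives.\<close>
  define p where "p x = (\<Sum>i\<in>Basis. (sgn x \<bullet> i) *\<^sub>R v' i x)" for x
  have p[measurable]: "p \<in> borel_measurable borel"
    unfolding p_def[abs_def] by (intro borel_measurable_sum borel_measurable_scaleR v'0) measurable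
  have p_le: "(norm (p x))\<^sup>2 \<le> (\<Sum>i\<in>Basis. (norm (v' i x))\<^sup>2)" for x
    unfolding p_def
  proof (rule norm_sum_scaleR_power2_le)
    have "(\<Sum>i\<in>Basis. (sgn x \<bullet> i)\<^sup>2) = (norm (sgn x))\<^sup>2"
      unfolding power2_norm_eq_inner by (subst (2) euclidean_inner) (simp add: power2_eq_square)
    then show "(\<Sum>i\<in>Basis. (sgn x \<bullet> i)\<^sup>2) \<le> 1" by (simp add: norm_sgn)
  qed
  have iv: "integrable lborel (\<lambda>x. \<Sum>i\<in>Basis. (norm (v' i x))\<^sup>2)"
    using v'2 by (intro Bochner_Integration.integrable_sum) auto
  have p2: "integrable lborel (\<lambda>x. (norm (p x))\<^sup>2)"
    using iv by (rule Bochner_Integration.integrable_bound) (use p_le in \<open>auto intro!: AE_I2 simp: sum_nonneg\<close>)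
  \<comment> \<open>The mean of the radial derivative over directions, the candidate for the
    derivative of the profile.\<close>
  define w where "w r = (LINT y|direction_measure. p (r *\<^sub>R sgn y))" for r
  have w[measurable]: "w \<in> borel_measurable borel"
    unfolding w_def[abs_def] by (rule S.borel_measurable_lebesgue_integral) measurable
  define q where "q r = (LINT y|direction_measure. (norm (p (r *\<^sub>R sgn y)))\<^sup>2)" for r
  have q: "integrable (radius_measure TYPE('a)) q" "(LINT x|lborel. (norm (p x))\<^sup>2) = (LINT r|radius_measure TYPE('a). q r)"
     "AE r in radius_measure TYPE('a). integrable direction_measure (\<lambda>y. (norm (p (r *\<^sub>R sgn y)))\<^sup>2)"
    using integral_polar[OF p2] by (auto simp: q_def[abs_def])
  have wq: "AE r in radius_measure TYPE('a). (norm (w r))\<^sup>2 \<le> q r"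
    using q(3)
  proof eventually_elim
    case (elim r)
    show ?case unfolding w_def q_def
      by (rule norm_integral_power2_le(2)[OF prob_space_direction _ elim]) measurable
  qed
  have w2: "integrable (radius_measure TYPE('a)) (\<lambda>r. (norm (w r))\<^sup>2)"
    by (rule Bochner_Integration.integrable_bound[OF q(1)])
       (use wq in \<open>auto elim!: eventually_mono\<close>)
  have w2l: "integrable lborel (\<lambda>r. radius_density TYPE('a) r * (norm (w r))\<^sup>2)"
    using w2 unfolding radius_measure_def by (simp add: integrable_density radius_density_nonneg)
  have "(LINT r|lborel. radius_density TYPE('a) r * (norm (w r))\<^sup>2) = (LINT r|radius_measure TYPE('a). (norm (w r))\<^sup>2)"
    unfolding radius_measure_def by (simp add: integral_density radius_density_nonneg)
  also have "\<dots> \<le> (LINT r|radius_measure TYPE('a). q r)"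
    using w2 q(1) wq by (rule integral_mono_AE)
  also have "\<dots> \<le> (LINT x|lborel. (\<Sum>i\<in>Basis. (norm (v' i x))\<^sup>2))"
    unfolding q(2)[symmetric] using p2 iv p_le by (rule integral_mono)
  also have "\<dots> = (LINT x|lebesgue. (\<Sum>i\<in>Basis. (norm (v i x))\<^sup>2))"
  proof (rule lebesgue_integral_lborel_AE(2)[symmetric])
    show "AE x in lborel. (\<Sum>i\<in>Basis. (norm (v i x))\<^sup>2) = (\<Sum>i\<in>Basis. (norm (v' i x))\<^sup>2)"
      using vv' by eventually_elim simp
  qed (use iv in auto)
  also have "\<dots> = dirichlet Q" using dirichlet_eq[of Q v] v(1) by simp
  finally have dir: "(LINT r|lborel. radius_density TYPE('a) r * (norm (w r))\<^sup>2) \<le> dirichlet Q" .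

  have pw: "(LINT x|lborel. h (norm x) *\<^sub>R p x) = (LINT r|lborel. (radius_density TYPE('a) r * h r) *\<^sub>R w r)"
    if h: "continuous_on UNIV h" "0 < a" "\<And>t. t \<notin> {a..b} \<Longrightarrow> h t = 0" for h :: "real \<Rightarrow> real" and a b
  proof -
    have [measurable]: "h \<in> borel_measurable borel" using borel_measurable_continuous_onI[OF h(1)] .
    have "bounded (h ` {a..b})"
      using h(1) by (intro compact_imp_bounded compact_continuous_image) (auto intro: continuous_on_subset)
    then obtain C where C: "\<forall>y\<in>h ` {a..b}. norm y \<le> C" "C > 0" unfolding bounded_pos by blast
    have Ch: "\<bar>h t\<bar> \<le> C" for t using C h(3)[of t] by (cases "t \<in> {a..b}") auto
    have i: "integrable lborel (\<lambda>x. h (norm x) *\<^sub>R p x)"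
    proof (rule Bochner_Integration.integrable_bound)
      show "integrable lborel (\<lambda>x. C * (indicator (cball 0 b) x + (norm (p x))\<^sup>2))"
        using p2 by (intro integrable_mult_right Bochner_Integration.integrable_add integrable_real_indicator
            emeasure_compact_finite compact_cball) auto
      have "norm (h (norm x) *\<^sub>R p x) \<le> C * (indicator (cball 0 b) x + (norm (p x))\<^sup>2)" for x
      proof (cases "norm x \<le> b")
        case True
        have "norm (p x) \<le> 1 + (norm (p x))\<^sup>2"
          using zero_le_power2[of "norm (p x) - 1"] norm_ge_zero[of "p x"] unfolding power2_diff one_power2 by linarith
        then have "\<bar>h (norm x)\<bar> * norm (p x) \<le> C * (1 + (norm (p x))\<^sup>2)"
          using Ch C(2) by (intro mult_mono) auto
        then show ?thesis using True by simp
      next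
        case False
        then show ?thesis using h(3) C(2) by (simp add: indicator_def)
      qed
      then show "AE x in lborel. norm (h (norm x) *\<^sub>R p x) \<le> norm (C * (indicator (cball 0 b) x + (norm (p x))\<^sup>2))"
        by (intro AE_I2) (smt (verit) real_norm_def)
    qed measurable
    have "(LINT x|lborel. h (norm x) *\<^sub>R p x)
      = (LINT r|radius_measure TYPE('a). LINT y|direction_measure. h (norm (r *\<^sub>R sgn (y::'a))) *\<^sub>R p (r *\<^sub>R sgn y))"
      using integral_polar(2)[OF i] .
    also have "\<dots> = (LINT r|radius_measure TYPE('a). h r *\<^sub>R w r)"
    proof (rule integral_cong_AE)
      show "AE r in radius_measure TYPE('a). (LINT y|direction_measure. h (norm (r *\<^sub>R sgn (y::'a))) *\<^sub>R p (r *\<^sub>R sgn y)) = h r *\<^sub>R w r"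
        using AE_radius_pos
      proof eventually_elim
        case (elim r)
        have "(LINT y|direction_measure. h (norm (r *\<^sub>R sgn (y::'a))) *\<^sub>R p (r *\<^sub>R sgn y)) = (LINT y|direction_measure. h r *\<^sub>R p (r *\<^sub>R sgn y))"
          by (rule integral_cong_AE) (measurable, rule eventually_mono[OF AE_direction_nonzero], metis norm_polar(1) elim)
        then show ?case by (simp add: w_def)
      qed
      have "(\<lambda>r. LINT y|direction_measure. h (norm (r *\<^sub>R sgn (y::'a))) *\<^sub>R p (r *\<^sub>R sgn y)) \<in> borel_measurable borel"
        by (rule S.borel_measurable_lebesgue_integral) measurable
      then show "(\<lambda>r. LINT y|direction_measure. h (norm (r *\<^sub>R sgn (y::'a))) *\<^sub>R p (r *\<^sub>R sgn y)) \<in> borel_measurable (radius_measure TYPE('a))"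
        by simp
    qed measurable
    also have "\<dots> = (LINT r|lborel. (radius_density TYPE('a) r * h r) *\<^sub>R w r)"
      unfolding radius_measure_def by (simp add: integral_density radius_density_nonneg)
    finally show ?thesis .
  qed

  \<comment> \<open>The function \<open>g0\<close> supplied by radiality need not be measurable;
    averaging \<open>Q'\<close> over directions gives a Borel function that agrees with it for
    almost every radius.\<close>
  define g where "g r = (LINT y|direction_measure. Q' (r *\<^sub>R sgn y))" for r
  have g[measurable]: "g \<in> borel_measurable borel"
    unfolding g_def[abs_def] by (rule S.borel_measurable_lebesgue_integral) measurable
  have "AE x in lborel. Q' x = g0 (norm x)"
    using AE_lebesgue_imp_lborel[OF rad] QQ' by eventually_elim simp
  note Q'g0 = this
  have "AE r in radius_measure TYPE('a). g r = g0 r"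
    using AE_polar[OF Q'g0] AE_radius_pos
  proof eventually_elim
    case (elim r)
    have "AE y in direction_measure. Q' (r *\<^sub>R sgn (y::'a)) = g0 r"
      using elim(1) AE_direction_nonzero
    proof eventually_elim
      case (elim y)
      then show ?case using norm_polar(1)[of y r] \<open>0 < r\<close> by simp
    qed
    then have "g r = (LINT y|(direction_measure :: 'a measure). g0 r)"
      unfolding g_def by (intro integral_cong_AE) auto
    then show ?case by (simp add: S.prob_space[simplified])
  qed
  from AE_norm[OF this] Q'g0 have Q'g: "AE x in lborel. Q' x = g (norm x)" by eventually_elim simp
  have Qg: "AE x in lborel. Q x = g (norm x)" using QQ' Q'g by eventually_elim simp
  have g6: "integrable lborel (\<lambda>r. radius_density TYPE('a) r * norm (g r) ^ 6)"
  proof -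
    have "AE x in lborel. norm (Q x) ^ 6 = norm (g (norm x)) ^ 6" using Qg by eventually_elim simp
    moreover have "(\<lambda>x::'a. norm (g (norm x)) ^ 6) \<in> borel_measurable borel" by measurable
    ultimately have "integrable lborel (\<lambda>x::'a. norm (g (norm x)) ^ 6)"
      using lebesgue_integral_lborel_AE(1)[of "\<lambda>x. norm (Q x) ^ 6" "\<lambda>x. norm (g (norm x)) ^ 6"] Q(2) by blast
    then show ?thesis using radial_integral(1)[of "\<lambda>r. norm (g r) ^ 6", where 'a = 'a] by simp
  qed
  have loc: "g absolutely_integrable_on {a..b}" "w absolutely_integrable_on {a..b}" if "0 < a" for a b
    using absolutely_integrable_radial_weight[OF g g6 _ that] absolutely_integrable_radial_weight[OF w w2l _ that] by auto

  have weak: "(LINT t|lebesgue. partial 1 \<psi> t *\<^sub>R g t) = - (LINT t|lebesgue. \<psi> t *\<^sub>R w t)"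
    if \<psi>: "\<And>n. Ck n \<psi>" "0 < a" "\<And>t. t \<notin> {a..b} \<Longrightarrow> \<psi> t = 0" for \<psi> a b
  proof -
    have c: "continuous_on UNIV \<psi>" "continuous_on UNIV (partial 1 \<psi>)"
      using Ck_continuous[OF \<psi>(1)] Ck_continuous[OF Ck_Suc_partial[of 0 \<psi> 1]] \<psi>(1)[of "Suc 0"] by auto
    have [measurable]: "\<psi> \<in> borel_measurable borel" "partial 1 \<psi> \<in> borel_measurable borel"
      using c borel_measurable_continuous_onI by auto
    have z: "partial 1 \<psi> t = 0" if "t \<notin> {a..b}" for t
      using partial_outside[of "{a..b}" \<psi> t] \<psi>(3) that by auto
    \<comment> \<open>The components of the field in \<open>divergence_radial\<close>. Each
      component is tested with its own partial derivative, and the sum over components produces the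
      divergence.\<close>
    define \<phi> where "\<phi> i x = (x \<bullet> i) * (\<psi> (norm x) / norm x ^ d)" for i x :: 'a
    have tf: "test_fun (\<phi> i)" for i
      unfolding \<phi>_def[abs_def] by (rule test_fun_radial_quot[OF \<psi> Ck_inner_left])
    have lQ: "loc_integrable Q" "loc_integrable (v i)" if "i \<in> Basis" for i
      using v(1)[OF that] by (auto simp: has_weak_partial_def)
    have i: "integrable lebesgue (\<lambda>x. partial i (\<phi> i) x *\<^sub>R Q x)" "integrable lebesgue (\<lambda>x. \<phi> i x *\<^sub>R v i x)" if "i \<in> Basis" for i
      using integrable_test_fun_scaleR tf test_fun_partial lQ that by blast+
    have "(\<Sum>i\<in>Basis. LINT x|lebesgue. partial i (\<phi> i) x *\<^sub>R Q x) = (\<Sum>i\<in>Basis. - (LINT x|lebesgue. \<phi> i x *\<^sub>R v i x))"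
      using v(1) tf by (intro sum.cong) (auto simp: has_weak_partial_def)
    then have "(LINT x|lebesgue. (\<Sum>i\<in>Basis. partial i (\<phi> i) x *\<^sub>R Q x)) = - (LINT x|lebesgue. (\<Sum>i\<in>Basis. \<phi> i x *\<^sub>R v i x))"
      using i by (simp add: Bochner_Integration.integral_sum sum_negf)
    moreover have "(LINT x|lebesgue. (\<Sum>i\<in>Basis. partial i (\<phi> i) x *\<^sub>R Q x)) = (LINT x|lborel. (partial 1 \<psi> (norm (x::'a)) / norm x ^ (d - 1)) *\<^sub>R g (norm x))"
    proof (rule lebesgue_integral_lborel_AE(2))
      show "AE x in lborel. (\<Sum>i\<in>Basis. partial i (\<phi> i) x *\<^sub>R Q x) = (partial 1 \<psi> (norm x) / norm x ^ (d - 1)) *\<^sub>R g (norm x)"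
        using Qg
      proof eventually_elim
        case (elim x)
        have "(\<Sum>i\<in>Basis. partial i (\<phi> i) x) = partial 1 \<psi> (norm x) / norm x ^ (d - 1)"
          unfolding \<phi>_def[abs_def] d_def by (rule divergence_radial[OF \<psi>])
        then show ?case using elim by (simp add: scaleR_sum_left[symmetric])
      qed
    qed measurable
    moreover have "(LINT x|lborel. (partial 1 \<psi> (norm (x::'a)) / norm x ^ (d - 1)) *\<^sub>R g (norm x))
       = (LINT r|lborel. radius_density TYPE('a) r *\<^sub>R ((partial 1 \<psi> r / r ^ (d - 1)) *\<^sub>R g r))"
      by (rule radial_integral(2)[of "\<lambda>r. (partial 1 \<psi> r / r ^ (d - 1)) *\<^sub>R g r"]) measurable
    moreover have "(\<lambda>r. radius_density TYPE('a) r *\<^sub>R ((partial 1 \<psi> r / r ^ (d - 1)) *\<^sub>R g r)) = (\<lambda>r. \<kappa> *\<^sub>R (partial 1 \<psi> r *\<^sub>R g r))"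
    proof
      fix r
      show "radius_density TYPE('a) r *\<^sub>R ((partial 1 \<psi> r / r ^ (d - 1)) *\<^sub>R g r) = \<kappa> *\<^sub>R (partial 1 \<psi> r *\<^sub>R g r)"
        using dens[of r] dens0[of r] z[of r] \<psi>(2) by (cases "r > 0") auto
    qed
    moreover have "(LINT x|lebesgue. (\<Sum>i\<in>Basis. \<phi> i x *\<^sub>R v i x)) = (LINT x|lborel. (\<psi> (norm (x::'a)) / norm x ^ (d - 1)) *\<^sub>R p x)"
    proof (rule lebesgue_integral_lborel_AE(2))
      show "AE x in lborel. (\<Sum>i\<in>Basis. \<phi> i x *\<^sub>R v i x) = (\<psi> (norm x) / norm x ^ (d - 1)) *\<^sub>R p x"
        using vv'
      proof eventually_elim
        case (elim x)
        have "\<phi> i x = (\<psi> (norm x) / norm x ^ (d - 1)) * (sgn x \<bullet> i)" for i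
        proof (cases "x = 0")
          case False
          obtain e where "d = Suc e" unfolding d_def using DIM_positive by (metis gr0_implies_Suc)
          then show ?thesis using False by (simp add: \<phi>_def sgn_div_norm field_simps)
        qed (simp add: \<phi>_def)
        then show ?case using elim by (simp add: p_def scaleR_sum_right)
      qed
    qed measurable
    moreover have "(LINT x|lborel. (\<psi> (norm (x::'a)) / norm x ^ (d - 1)) *\<^sub>R p x)
       = (LINT r|lborel. (radius_density TYPE('a) r * (\<psi> r / r ^ (d - 1))) *\<^sub>R w r)"
    proof (rule pw[OF _ \<psi>(2)])
      \<comment> \<open>Since \<open>\<psi>\<close> vanishes below \<open>a\<close>, cutting off at
        \<open>a / 2\<close> changes nothing, and the glued form makes continuity at the origin
        evident.\<close>
      have "continuous_on UNIV (\<lambda>t. if t \<le> a / 2 then 0 else \<psi> t / t ^ (d - 1))"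
      proof -
        have "continuous_on ({..a/2} \<union> {a/2..}) (\<lambda>t. if t \<le> a / 2 then 0 else \<psi> t / t ^ (d - 1))"
          using \<psi>(2,3) c by (intro continuous_on_If) (auto intro!: continuous_intros intro: continuous_on_subset)
        moreover have "{..a/2} \<union> {a/2..} = UNIV" by auto
        ultimately show ?thesis by simp
      qed
      moreover have "(\<lambda>t. if t \<le> a / 2 then 0 else \<psi> t / t ^ (d - 1)) = (\<lambda>t. \<psi> t / t ^ (d - 1))"
        using \<psi>(2,3) by auto
      ultimately show "continuous_on UNIV (\<lambda>t. \<psi> t / t ^ (d - 1))" by (simp only:)
      show "\<psi> t / t ^ (d - 1) = 0" if "t \<notin> {a..b}" for t using \<psi>(3)[OF that] by simp
    qed
    moreover have "(\<lambda>r. (radius_density TYPE('a) r * (\<psi> r / r ^ (d - 1))) *\<^sub>R w r) = (\<lambda>r. \<kappa> *\<^sub>R (\<psi> r *\<^sub>R w r))"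
    proof
      fix r
      show "(radius_density TYPE('a) r * (\<psi> r / r ^ (d - 1))) *\<^sub>R w r = \<kappa> *\<^sub>R (\<psi> r *\<^sub>R w r)"
        using dens[of r] dens0[of r] \<psi>(3)[of r] \<psi>(2) by (cases "r > 0") auto
    qed
    ultimately have "(LINT r|lborel. \<kappa> *\<^sub>R (partial 1 \<psi> r *\<^sub>R g r)) = - (LINT r|lborel. \<kappa> *\<^sub>R (\<psi> r *\<^sub>R w r))"
      by (simp only:)
    then have "\<kappa> *\<^sub>R (LINT r|lborel. partial 1 \<psi> r *\<^sub>R g r) = \<kappa> *\<^sub>R (- (LINT r|lborel. \<psi> r *\<^sub>R w r))"
      by (simp only: Bochner_Integration.integral_scaleR_right scaleR_minus_right)
    then have "(LINT r|lborel. partial 1 \<psi> r *\<^sub>R g r) = - (LINT r|lborel. \<psi> r *\<^sub>R w r)"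
      using \<kappa> by (metis less_irrefl real_vector.scale_left_imp_eq)
    then show ?thesis by (simp add: integral_completion)
  qed
  obtain u where u: "primitive_on {0<..} u w" "AE t in lebesgue. 0 < t \<longrightarrow> g t = u t"
    by (rule du_Bois_Reymond[OF loc weak]) assumption+
  have gu: "AE t in lborel. 0 < t \<longrightarrow> g t = u t" using AE_lebesgue_imp_lborel[OF u(2)] .
  show thesis
  proof (rule that[OF u(1) w _ _ w2l dir])
    have "AE x in lborel. Q x = u (norm x)"
      using Qg AE_lborel_norm[OF gu] by eventually_elim simp
    then show "AE x in lebesgue. Q x = u (norm x)" by (rule AE_completion)
    have cu: "continuous_on {0<..} u" by (rule primitive_on_continuous[OF u(1)]) simp
    have mu: "(\<lambda>r. indicator {0<..} r *\<^sub>R u r) \<in> borel_measurable borel"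
      using borel_measurable_continuous_on_indicator[OF _ cu] by simp
    have eq: "radius_density TYPE('a) r * norm (u r) ^ 6 = radius_density TYPE('a) r * norm (indicator {0<..} r *\<^sub>R u r) ^ 6" for r
      using dens0[of r] by (cases "r > 0") auto
    have "(\<lambda>r. radius_density TYPE('a) r * norm (indicator {0<..} r *\<^sub>R u r) ^ 6) \<in> borel_measurable borel"
      by (intro borel_measurable_times borel_measurable_power measurable_compose[OF mu borel_measurable_norm] radius_density_measurable)
    then have m: "(\<lambda>r. radius_density TYPE('a) r * norm (u r) ^ 6) \<in> borel_measurable borel"
      by (simp only: eq[symmetric])
    show "integrable lborel (\<lambda>r. radius_density TYPE('a) r * norm (u r) ^ 6)"
    proof (rule integrable_cong_AE_imp[OF g6])
      show "AE r in lborel. radius_density TYPE('a) r * norm (g r) ^ 6 = radius_density TYPE('a) r * norm (u r) ^ 6"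
        using gu by eventually_elim (metis dens0 mult_zero_left not_le_imp_less)
    qed (use m in simp)
    fix \<psi> :: "real \<Rightarrow> real" and a b :: real
    assume \<psi>: "\<And>n. Ck n \<psi>" "0 < a" "\<And>t. t \<notin> {a..b} \<Longrightarrow> \<psi> t = 0"
    have c: "continuous_on UNIV (partial 1 \<psi>)"
      using Ck_continuous[OF Ck_Suc_partial[of 0 \<psi> 1]] \<psi>(1)[of "Suc 0"] by auto
    have [measurable]: "partial 1 \<psi> \<in> borel_measurable borel"
      using c borel_measurable_continuous_onI by auto
    have z: "partial 1 \<psi> t = 0" if "t \<notin> {a..b}" for t
      using partial_outside[of "{a..b}" \<psi> t] \<psi>(3) that by auto
    have pr: "partial i (\<lambda>x. \<psi> (norm x)) x = partial 1 \<psi> (norm x) * (i \<bullet> sgn x)" for i and x :: 'a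
      by (rule partial_radial[OF \<psi>])
    have "(LINT x|lebesgue. (\<Sum>i\<in>Basis. partial i (\<lambda>x. \<psi> (norm x)) x *\<^sub>R v i x)) = (LINT x|lborel. partial 1 \<psi> (norm x) *\<^sub>R p x)"
    proof (rule lebesgue_integral_lborel_AE(2))
      show "AE x in lborel. (\<Sum>i\<in>Basis. partial i (\<lambda>x. \<psi> (norm x)) x *\<^sub>R v i x) = partial 1 \<psi> (norm x) *\<^sub>R p x"
        using vv'
        by eventually_elim (simp add: pr p_def scaleR_sum_right inner_commute)
    qed measurable
    also have "\<dots> = (LINT r|lborel. (radius_density TYPE('a) r * partial 1 \<psi> r) *\<^sub>R w r)"
      by (rule pw[OF c \<psi>(2) z])
    finally show "(LINT x|lebesgue. (\<Sum>i\<in>Basis. partial i (\<lambda>x. \<psi> (norm x)) x *\<^sub>R v i x))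
       = (LINT r|lborel. (radius_density TYPE('a) r * partial 1 \<psi> r) *\<^sub>R w r)" .
  qed
qed

section \<open>The sharp one-dimensional inequality\<close>

text \<open>The second factor of the derivative is the derivative of
  \<open>r * (norm (u r))\<^sup>2\<close>. Thus every function of this quantity times its derivative
  integrates to boundary terms.\<close>

lemma primitive_on_radial_chain:
  fixes u :: "real \<Rightarrow> 'b::euclidean_space"
  assumes u: "primitive_on {0<..} u w" and K: "\<And>x. x \<ge> 0 \<Longrightarrow> (K has_real_derivative k x) (at x)"
    and k: "continuous_on {0..} k"
  shows "primitive_on {0<..} (\<lambda>r. K (r * (norm (u r))\<^sup>2))
     (\<lambda>r. k (r * (norm (u r))\<^sup>2) * ((norm (u r))\<^sup>2 + 2 * r * (u r \<bullet> w r)))"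
proof -
  have "primitive_on {0<..} (\<lambda>r. K (r * (u r \<bullet> u r)))
     (\<lambda>r. k (r * (u r \<bullet> u r)) * (u r \<bullet> u r) + (k (r * (u r \<bullet> u r)) * 2 * r) *\<^sub>R u r \<bullet> w r)"
  proof (rule primitive_on_chain2[OF u])
    fix r :: real and y :: 'b assume r: "r \<in> {0<..}"
    have d: "(K has_derivative (*) (k (r * (y \<bullet> y)))) (at (r * (y \<bullet> y)))"
      using K r by (simp add: has_field_derivative_def)
    have "((\<lambda>p. fst p * (snd p \<bullet> snd p)) has_derivative (\<lambda>h. r * (y \<bullet> snd h + snd h \<bullet> y) + fst h * (y \<bullet> y))) (at (r, y))"
      by (auto intro!: derivative_eq_intros)
    from has_derivative_compose[OF this, of K "(*) (k (r * (y \<bullet> y)))"] d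
    show "((\<lambda>p. K (fst p * (snd p \<bullet> snd p))) has_derivative
        (\<lambda>h. k (r * (y \<bullet> y)) * (y \<bullet> y) * fst h + (k (r * (y \<bullet> y)) * 2 * r) *\<^sub>R y \<bullet> snd h)) (at (r, y))"
      by (simp add: inner_commute algebra_simps)
  next
    have c: "continuous_on ({0<..} \<times> UNIV) (\<lambda>p. k (fst p * (snd p \<bullet> (snd p :: 'b))))"
      by (rule continuous_on_compose2[OF k]) (auto intro!: continuous_intros)
    show "continuous_on ({0<..} \<times> UNIV) (\<lambda>p. k (fst p * (snd p \<bullet> (snd p :: 'b))) * (snd p \<bullet> snd p))"
      "continuous_on ({0<..} \<times> UNIV) (\<lambda>p. (k (fst p * (snd p \<bullet> (snd p :: 'b))) * 2 * fst p) *\<^sub>R snd p)"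
      by (intro continuous_intros c)+
  qed simp
  then show ?thesis by (simp add: power2_norm_eq_inner algebra_simps)
qed

text \<open>The bridge between Lebesgue integrals over the half-line, in which energy and mass are
  defined, and gauge integrals over compact intervals, in which \<open>primitive_on\<close> is
  phrased.\<close>

lemma half_line_integral:
  fixes f :: "real \<Rightarrow> real"
  assumes f: "set_integrable lborel {0<..} f"
  shows "0 < a \<Longrightarrow> f absolutely_integrable_on {a..b}" "0 < a \<Longrightarrow> f integrable_on {a..b}"
    "(\<And>r. 0 < r \<Longrightarrow> 0 \<le> f r) \<Longrightarrow> 0 < a \<Longrightarrow> integral {a..b} f \<le> (LINT r:{0<..}|lborel. f r)"
    "(\<lambda>n. integral {1 / real (Suc n)..real (Suc n)} f) \<longlonglongrightarrow> (LINT r:{0<..}|lborel. f r)"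
proof -
  have sub: "set_integrable lborel {a..b} f" if "0 < a" for a b
    by (rule set_integrable_subset[OF f]) (use that in auto)
  have eq: "integral {a..b} f = (LINT r:{a..b}|lborel. f r)" if "0 < a" for a b
    using set_borel_integral_eq_integral(2)[OF sub[OF that]] by simp
  show "0 < a \<Longrightarrow> f absolutely_integrable_on {a..b}"
    using sub[of a b] unfolding set_integrable_def by (simp add: integrable_completion borel_measurable_integrable)
  then show "0 < a \<Longrightarrow> f integrable_on {a..b}" using set_lebesgue_integral_eq_integral(1) by blast
  show "(\<And>r. 0 < r \<Longrightarrow> 0 \<le> f r) \<Longrightarrow> 0 < a \<Longrightarrow> integral {a..b} f \<le> (LINT r:{0<..}|lborel. f r)"
    unfolding eq set_lebesgue_integral_def
    by (rule integral_mono) (use f sub[of a b] in \<open>auto simp: set_integrable_def indicator_def\<close>)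
  have "(\<lambda>n. LINT r|lborel. indicator {1 / real (Suc n)..real (Suc n)} r *\<^sub>R f r) \<longlonglongrightarrow> (LINT r|lborel. indicator {0<..} r *\<^sub>R f r)"
  proof (rule integral_dominated_convergence[where w = "\<lambda>r. norm (indicator {0<..} r *\<^sub>R f r)"])
    show "integrable lborel (\<lambda>r. norm (indicator {0<..} r *\<^sub>R f r))"
      using f unfolding set_integrable_def by (rule integrable_norm)
    show "(\<lambda>r. indicator {0<..} r *\<^sub>R f r) \<in> borel_measurable lborel"
      using f unfolding set_integrable_def by (rule borel_measurable_integrable)
    show "(\<lambda>r. indicator {1 / real (Suc n)..real (Suc n)} r *\<^sub>R f r) \<in> borel_measurable lborel" for n
      using sub[of "1 / real (Suc n)" "real (Suc n)"] unfolding set_integrable_def by (intro borel_measurable_integrable) auto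
    show "AE r in lborel. norm (indicator {1 / real (Suc n)..real (Suc n)} r *\<^sub>R f r) \<le> norm (indicator {0<..} r *\<^sub>R f r)" for n
      by (intro AE_I2) (auto simp: indicator_def intro: less_le_trans[of 0 "1 / (1 + real n)"])
    show "AE r in lborel. (\<lambda>n. indicator {1 / real (Suc n)..real (Suc n)} r *\<^sub>R f r) \<longlonglongrightarrow> indicator {0<..} r *\<^sub>R f r"
    proof (intro AE_I2)
      fix r :: real
      show "(\<lambda>n. indicator {1 / real (Suc n)..real (Suc n)} r *\<^sub>R f r) \<longlonglongrightarrow> indicator {0<..} r *\<^sub>R f r"
      proof (cases "r > 0")
        case True
        have "\<forall>\<^sub>F n in sequentially. 1 / real (Suc n) \<le> r" "\<forall>\<^sub>F n in sequentially. r \<le> real (Suc n)"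
          using True by real_asymp+
        then have "\<forall>\<^sub>F n in sequentially. f r = indicator {1 / real (Suc n)..real (Suc n)} r *\<^sub>R f r"
          by eventually_elim simp
        then show ?thesis using True by (auto intro: Lim_transform_eventually[OF tendsto_const])
      next
        case False
        then have "r \<notin> {1 / real (Suc n)..real (Suc n)}" for n
          using less_le_trans[of 0 "1 / real (Suc n)" r] by auto
        then show ?thesis using False by simp
      qed
    qed
  qed
  then show "(\<lambda>n. integral {1 / real (Suc n)..real (Suc n)} f) \<longlonglongrightarrow> (LINT r:{0<..}|lborel. f r)"
    by (subst eq) (simp_all add: set_lebesgue_integral_def)
qed

text \<open>If \<open>r * h r\<close> stayed above \<open>\<eta>\<close> near infinity or near zero,
  \<open>h\<close> would dominate \<open>\<eta> / r\<close>, whose integral diverges logarithmically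
  at both ends.\<close>

lemma integrable_half_line_small:
  fixes h :: "real \<Rightarrow> real"
  assumes h: "set_integrable lborel {0<..} h" and nn: "\<And>r. 0 < r \<Longrightarrow> 0 \<le> h r" and "\<eta> > 0" "R > 0"
  shows "\<exists>r\<ge>R. r * h r \<le> \<eta>" "\<exists>r>0. r \<le> R \<and> r * h r \<le> \<eta>"
proof -
  define H where "H = (LINT r:{0<..}|lborel. h r)"
  have bound: "\<eta> * (ln b - ln a) \<le> H" if ab: "0 < a" "a \<le> b" and big: "\<And>r. r \<in> {a..b} \<Longrightarrow> \<eta> < r * h r" for a b
  proof -
    have i: "((\<lambda>r. \<eta> * inverse r) has_integral \<eta> * (ln b - ln a)) {a..b}"
      using ab by (intro has_integral_mult_right fundamental_theorem_of_calculus)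
        (auto simp: has_real_derivative_iff_has_vector_derivative[symmetric] inverse_eq_divide intro!: derivative_eq_intros)
    have "\<eta> * (ln b - ln a) \<le> integral {a..b} h"
    proof (rule has_integral_le[OF i integrable_integral[OF half_line_integral(2)[OF h ab(1)]]])
      fix r assume r: "r \<in> {a..b}"
      then show "\<eta> * inverse r \<le> h r" using big[OF r] ab by (simp add: field_simps)
    qed
    also have "\<dots> \<le> H" unfolding H_def by (rule half_line_integral(3)[OF h nn ab(1)])
    finally show ?thesis .
  qed
  show "\<exists>r\<ge>R. r * h r \<le> \<eta>"
  proof (rule ccontr)
    assume neg: "\<not> ?thesis"
    \<comment> \<open>The right end is chosen so that the logarithmic length is
      \<open>\<bar>H\<bar> / \<eta> + 1\<close>; the lower bound becomes
      \<open>\<bar>H\<bar> + \<eta>\<close>, which exceeds \<open>H\<close>.\<close>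
    have "\<eta> * (ln (R * exp (\<bar>H\<bar> / \<eta> + 1)) - ln R) \<le> H"
    proof (rule bound)
      show "R \<le> R * exp (\<bar>H\<bar> / \<eta> + 1)" using \<open>\<eta> > 0\<close> \<open>R > 0\<close> by simp
      show "\<eta> < r * h r" if "r \<in> {R..R * exp (\<bar>H\<bar> / \<eta> + 1)}" for r
        using neg that by (meson atLeastAtMost_iff not_le)
    qed fact
    then have "\<eta> * (\<bar>H\<bar> / \<eta> + 1) \<le> H" using \<open>R > 0\<close> by (simp add: ln_mult)
    moreover have "\<eta> * (\<bar>H\<bar> / \<eta> + 1) = \<bar>H\<bar> + \<eta>" using \<open>\<eta> > 0\<close> by (simp add: distrib_left)
    ultimately show False using \<open>\<eta> > 0\<close> by linarith
  qed
  show "\<exists>r>0. r \<le> R \<and> r * h r \<le> \<eta>"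
  proof (rule ccontr)
    assume neg: "\<not> ?thesis"
    have e: "exp (- (\<bar>H\<bar> / \<eta> + 1)) \<le> 1" using \<open>\<eta> > 0\<close> by (simp only: exp_le_one_iff) (smt (verit) divide_nonneg_pos)
    have "\<eta> * (ln R - ln (R * exp (- (\<bar>H\<bar> / \<eta> + 1)))) \<le> H"
    proof (rule bound)
      show "0 < R * exp (- (\<bar>H\<bar> / \<eta> + 1))" using \<open>R > 0\<close> by simp
      show "R * exp (- (\<bar>H\<bar> / \<eta> + 1)) \<le> R" using e \<open>R > 0\<close> by (simp add: mult_le_cancel_left1)
      show "\<eta> < r * h r" if "r \<in> {R * exp (- (\<bar>H\<bar> / \<eta> + 1))..R}" for r
        using neg that \<open>R > 0\<close> by (metis atLeastAtMost_iff exp_gt_zero less_le_trans mult_pos_pos not_le)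
    qed
    then have "\<eta> * (\<bar>H\<bar> / \<eta> + 1) \<le> H" using \<open>R > 0\<close> by (simp add: ln_mult)
    moreover have "\<eta> * (\<bar>H\<bar> / \<eta> + 1) = \<bar>H\<bar> + \<eta>" using \<open>\<eta> > 0\<close> by (simp add: distrib_left)
    ultimately show False using \<open>\<eta> > 0\<close> by linarith
  qed
qed

section \<open>Profiles of finite energy: decay and maximum of the scale-invariant density\<close>

locale radial_energy =
  fixes u w :: "real \<Rightarrow> 'b::euclidean_space"
  assumes prim: "primitive_on {0<..} u w"
    and int6: "set_integrable lborel {0<..} (\<lambda>r. r\<^sup>2 * norm (u r) ^ 6)"
    and int2: "set_integrable lborel {0<..} (\<lambda>r. r\<^sup>2 * (norm (w r))\<^sup>2)"
begin

text \<open>Replacing \<open>u r\<close> by \<open>sqrt s * u (s r)\<close> replaces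
  \<open>rho r\<close> by \<open>rho (s r)\<close>, so its maximum does not depend on the scale. In
  these terms the mass is the integral of \<open>rho r ^ 3 / r\<close>, the invariant measure being
  \<open>dr / r\<close>.\<close>

definition rho :: "real \<Rightarrow> real" where "rho r = r * (norm (u r))\<^sup>2"
definition energy :: real where "energy = (LINT r:{0<..}|lborel. r\<^sup>2 * (norm (w r))\<^sup>2)"
definition mass :: real where "mass = (LINT r:{0<..}|lborel. r\<^sup>2 * norm (u r) ^ 6)"

lemma u_cont: "continuous_on {0<..} u"
  by (rule primitive_on_continuous[OF prim]) simp

lemma rho_cont: "continuous_on {0<..} rho"
  unfolding rho_def[abs_def] by (intro continuous_intros u_cont)

lemma rho_nonneg: "r > 0 \<Longrightarrow> rho r \<ge> 0"
  by (simp add: rho_def)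

lemma rho_cube: "r > 0 \<Longrightarrow> r\<^sup>2 * norm (u r) ^ 6 = rho r ^ 3 / r"
proof -
  assume "r > 0"
  have "rho r ^ 3 = r ^ 3 * norm (u r) ^ 6" by (simp add: rho_def power_mult_distrib flip: power_mult)
  then show ?thesis using \<open>r > 0\<close> by (simp add: power3_eq_cube power2_eq_square)
qed

text \<open>Cauchy-Schwarz for the increment of \<open>u\<close>, with the weights \<open>r\<close>
  and \<open>1 / r\<close>: the integral of \<open>1 / r\<^sup>2\<close> over \<open>{a..b}\<close>
  is at most \<open>1 / a\<close>.\<close>

lemma increment_bound:
  assumes "0 < a" "a \<le> b"
  shows "a * (norm (u b - u a))\<^sup>2 \<le> integral {a..b} (\<lambda>r. r\<^sup>2 * (norm (w r))\<^sup>2)"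
proof -
  define e where "e = integral {a..b} (\<lambda>r. r\<^sup>2 * (norm (w r))\<^sup>2)"
  define X where "X = norm (u b - u a)"
  have sub: "{a..b} \<subseteq> {0<..}" using assms by auto
  note iw = primitive_onD[OF prim sub]
  have i2: "(\<lambda>r. r\<^sup>2 * (norm (w r))\<^sup>2) integrable_on {a..b}" by (rule half_line_integral(2)[OF int2 assms(1)])
  have inv: "((\<lambda>r. 1 / r\<^sup>2) has_integral (- (1 / b)) - (- (1 / a))) {a..b}"
    using assms by (intro fundamental_theorem_of_calculus)
      (auto simp: has_real_derivative_iff_has_vector_derivative[symmetric] power2_eq_square intro!: derivative_eq_intros)
  \<comment> \<open>Young's inequality with a free parameter \<open>t\<close> takes the place of the
    Cauchy-Schwarz inequality for integrals.\<close>
  have est: "X \<le> t / 2 * e + 1 / (2 * t * a)" if t: "t > 0" for t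
  proof -
    have i: "((\<lambda>r. t / 2 * (r\<^sup>2 * (norm (w r))\<^sup>2) + 1 / (2 * t) * (1 / r\<^sup>2)) has_integral
       t / 2 * e + 1 / (2 * t) * ((- (1 / b)) - (- (1 / a)))) {a..b}"
      unfolding e_def by (intro has_integral_add has_integral_mult_right integrable_integral i2 inv)
    have "X \<le> integral {a..b} (\<lambda>r. t / 2 * (r\<^sup>2 * (norm (w r))\<^sup>2) + 1 / (2 * t) * (1 / r\<^sup>2))"
      unfolding X_def iw(3)[OF assms(2)]
    proof (rule integral_norm_bound_integral[OF iw(2)])
      show "(\<lambda>r. t / 2 * (r\<^sup>2 * (norm (w r))\<^sup>2) + 1 / (2 * t) * (1 / r\<^sup>2)) integrable_on {a..b}"
        using i by blast
      fix r assume "r \<in> {a..b}"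
      then have r: "r > 0" using assms by auto
      have "0 \<le> (t * r * norm (w r) - 1 / r)\<^sup>2" by simp
      also have "\<dots> = t\<^sup>2 * r\<^sup>2 * (norm (w r))\<^sup>2 - 2 * t * norm (w r) + 1 / r\<^sup>2"
        using r by (simp add: power2_eq_square field_simps)
      finally have "2 * t * norm (w r) \<le> t\<^sup>2 * r\<^sup>2 * (norm (w r))\<^sup>2 + 1 / r\<^sup>2" by simp
      then have "(2 * t * norm (w r)) / (2 * t) \<le> (t\<^sup>2 * r\<^sup>2 * (norm (w r))\<^sup>2 + 1 / r\<^sup>2) / (2 * t)"
        using t by (intro divide_right_mono) auto
      then show "norm (w r) \<le> t / 2 * (r\<^sup>2 * (norm (w r))\<^sup>2) + 1 / (2 * t) * (1 / r\<^sup>2)"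
        using t by (simp add: add_divide_distrib power2_eq_square mult_ac)
    qed
    also have "\<dots> = t / 2 * e + 1 / (2 * t) * ((- (1 / b)) - (- (1 / a)))" using i by blast
    also have "\<dots> \<le> t / 2 * e + 1 / (2 * t) * (1 / a)"
      using t assms by (intro add_left_mono mult_left_mono) auto
    finally show ?thesis by simp
  qed
  show ?thesis
  proof (cases "X = 0")
    case True
    have "0 \<le> e" unfolding e_def by (intro integral_nonneg i2) auto
    then show ?thesis using True by (simp add: X_def e_def)
  next
    case False
    then have X: "X > 0" by (simp add: X_def)
    \<comment> \<open>The parameter \<open>t = 1 / (a * X)\<close> makes the second term equal to
      half of the left-hand side.\<close>
    have "X \<le> 1 / (a * X) / 2 * e + 1 / (2 * (1 / (a * X)) * a)"
      by (rule est) (use X assms in auto)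
    also have "1 / (2 * (1 / (a * X)) * a) = X / 2" using X assms by (simp add: field_simps)
    finally have "X / 2 \<le> 1 / (a * X) / 2 * e" by linarith
    then have "X / 2 * (2 * a * X) \<le> 1 / (a * X) / 2 * e * (2 * a * X)"
      using X assms by (intro mult_right_mono) auto
    then have "a * X\<^sup>2 \<le> e" using X assms by (simp add: power2_eq_square mult_ac)
    then show ?thesis by (simp add: X_def e_def)
  qed
qed

lemma norm_power2_le_two: "(norm (x :: 'b))\<^sup>2 \<le> 2 * (norm y)\<^sup>2 + 2 * (norm (y - x))\<^sup>2"
proof -
  have "norm x \<le> norm y + norm (y - x)" using norm_triangle_ineq4[of y "y - x"] by simp
  then have "(norm x)\<^sup>2 \<le> (norm y + norm (y - x))\<^sup>2" by (intro power_mono) auto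
  also have "\<dots> \<le> 2 * (norm y)\<^sup>2 + 2 * (norm (y - x))\<^sup>2"
    using sum_squares_bound[of "norm y" "norm (y - x)"] by (simp add: power2_sum)
  finally show ?thesis .
qed

text \<open>Convergence of the energy integral: one compact interval carries all but
  \<open>\<epsilon>\<close> of it, so an interval lying on either side of it carries at most
  \<open>\<epsilon>\<close>.\<close>

lemma energy_parts:
  assumes "\<epsilon> > 0"
  obtains n :: nat where "\<And>a b. 0 < a \<Longrightarrow> a \<le> b \<Longrightarrow> b \<le> 1 / real (Suc n) \<or> real (Suc n) \<le> a \<Longrightarrow>
    integral {a..b} (\<lambda>r. r\<^sup>2 * (norm (w r))\<^sup>2) \<le> \<epsilon>"
proof -
  let ?f = "\<lambda>r. r\<^sup>2 * (norm (w r))\<^sup>2"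
  have f: "set_integrable lborel {0<..} ?f" "\<And>r. ?f r \<ge> 0" using int2 by auto
  note F = half_line_integral[OF f(1)]
  have "\<forall>\<^sub>F n in sequentially. integral {1 / real (Suc n)..real (Suc n)} ?f > energy - \<epsilon>"
    using order_tendstoD(1)[OF F(4), of "energy - \<epsilon>"] assms by (simp add: energy_def)
  then obtain n where n: "integral {1 / real (Suc n)..real (Suc n)} ?f > energy - \<epsilon>"
    by (auto simp: eventually_sequentially)
  have le: "integral {a..b} ?f \<le> energy" if "0 < a" for a b
    using F(3)[of a b] f(2) that by (simp add: energy_def)
  have i: "?f integrable_on {a..b}" if "0 < a" for a b by (rule F(2)[OF that])
  have p: "0 < 1 / real (Suc n)" "1 / real (Suc n) \<le> real (Suc n)" by (auto simp: field_simps)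
  have "integral {a..b} ?f \<le> \<epsilon>" if ab: "0 < a" "a \<le> b" "b \<le> 1 / real (Suc n) \<or> real (Suc n) \<le> a" for a b
    using ab(3)
  proof
    assume b: "b \<le> 1 / real (Suc n)"
    have "integral {a..b} ?f + integral {1 / real (Suc n)..real (Suc n)} ?f \<le> integral {a..1 / real (Suc n)} ?f + integral {1 / real (Suc n)..real (Suc n)} ?f"
      using ab b f(2) by (intro add_right_mono integral_subset_le i) auto
    also have "\<dots> = integral {a..real (Suc n)} ?f"
      using ab b p by (intro Henstock_Kurzweil_Integration.integral_combine i) auto
    finally show ?thesis using le[OF ab(1), of "real (Suc n)"] n by linarith
  next
    assume a: "real (Suc n) \<le> a"
    have "integral {1 / real (Suc n)..real (Suc n)} ?f + integral {a..b} ?f \<le> integral {1 / real (Suc n)..real (Suc n)} ?f + integral {real (Suc n)..b} ?f"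
      using ab a f(2) by (intro add_left_mono integral_subset_le i) auto
    also have "\<dots> = integral {1 / real (Suc n)..b} ?f"
      using ab a p by (intro Henstock_Kurzweil_Integration.integral_combine i) auto
    finally show ?thesis using le[OF p(1), of b] n by linarith
  qed
  then show ?thesis by (rule that)
qed

text \<open>Finite mass gives radii \<open>b\<close> beyond any \<open>a\<close> with
  \<open>rho b\<close> small. The increment bound on \<open>{a..b}\<close>, whose energy is small,
  carries the smallness back to \<open>a\<close>.\<close>

lemma rho_small_at_infinity:
  assumes "\<epsilon> > 0"
  obtains R where "R > 0" "\<And>r. r \<ge> R \<Longrightarrow> rho r \<le> \<epsilon>"
proof -
  obtain n where n: "\<And>a b. 0 < a \<Longrightarrow> a \<le> b \<Longrightarrow> b \<le> 1 / real (Suc n) \<or> real (Suc n) \<le> a \<Longrightarrow>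
    integral {a..b} (\<lambda>r. r\<^sup>2 * (norm (w r))\<^sup>2) \<le> \<epsilon> / 4"
    using energy_parts[of "\<epsilon> / 4"] assms by auto
  have "rho a \<le> \<epsilon>" if a: "a \<ge> real (Suc n)" for a
  proof -
    have "a > 0" using a by (simp add: less_le_trans[OF _ a])
    obtain b where b: "b \<ge> a" "b * (b\<^sup>2 * norm (u b) ^ 6) \<le> (\<epsilon> / 4) ^ 3"
      using integrable_half_line_small(1)[OF int6, of "(\<epsilon> / 4) ^ 3" a] assms \<open>a > 0\<close> by auto
    have "rho b ^ 3 = b * (b\<^sup>2 * norm (u b) ^ 6)"
      using rho_cube[of b] b \<open>a > 0\<close> by simp
    then have "rho b \<le> \<epsilon> / 4" using b assms power_mono_iff[of "rho b" "\<epsilon> / 4" 3] rho_nonneg[of b] \<open>a > 0\<close> by auto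
    moreover have "a * (norm (u b))\<^sup>2 \<le> rho b" unfolding rho_def using b by (intro mult_right_mono) auto
    moreover have "a * (norm (u b - u a))\<^sup>2 \<le> \<epsilon> / 4"
      using increment_bound[OF \<open>a > 0\<close> b(1)] n[OF \<open>a > 0\<close> b(1)] a by linarith
    moreover have "rho a \<le> 2 * (a * (norm (u b))\<^sup>2) + 2 * (a * (norm (u b - u a))\<^sup>2)"
      using mult_left_mono[OF norm_power2_le_two[of "u a" "u b"], of a] \<open>a > 0\<close> by (simp add: rho_def algebra_simps)
    ultimately show ?thesis by linarith
  qed
  then show ?thesis using that[of "real (Suc n)"] by auto
qed

text \<open>Near zero one fixed reference radius \<open>b\<close> suffices: the increment up to
  \<open>b\<close> costs little energy, and \<open>a * (norm (u b))\<^sup>2\<close> is small once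
  \<open>a\<close> is.\<close>

lemma rho_small_at_zero:
  assumes "\<epsilon> > 0"
  obtains R where "R > 0" "\<And>r. 0 < r \<Longrightarrow> r \<le> R \<Longrightarrow> rho r \<le> \<epsilon>"
proof -
  obtain n where n: "\<And>a b. 0 < a \<Longrightarrow> a \<le> b \<Longrightarrow> b \<le> 1 / real (Suc n) \<or> real (Suc n) \<le> a \<Longrightarrow>
    integral {a..b} (\<lambda>r. r\<^sup>2 * (norm (w r))\<^sup>2) \<le> \<epsilon> / 4"
    using energy_parts[of "\<epsilon> / 4"] assms by auto
  define b where "b = 1 / real (Suc n)"
  \<comment> \<open>The second bound gives
    \<open>a * (norm (u b))\<^sup>2 \<le> \<epsilon> / 4\<close>; the added 1 keeps the denominator
    positive when \<open>u b = 0\<close>.\<close>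
  define R where "R = min b (\<epsilon> / (4 * ((norm (u b))\<^sup>2 + 1)))"
  have "b > 0" by (simp add: b_def)
  have R: "R > 0" using assms \<open>b > 0\<close> unfolding R_def
    by (auto intro!: divide_pos_pos simp: add_nonneg_pos)
  have "rho a \<le> \<epsilon>" if a: "0 < a" "a \<le> R" for a
  proof -
    have ab: "a \<le> b" using a by (simp add: R_def)
    have "a * (norm (u b - u a))\<^sup>2 \<le> \<epsilon> / 4"
      using increment_bound[OF a(1) ab] n[OF a(1) ab] by (simp add: b_def)
    moreover have "a * (norm (u b))\<^sup>2 \<le> \<epsilon> / 4"
    proof -
      have "a * (norm (u b))\<^sup>2 \<le> \<epsilon> / (4 * ((norm (u b))\<^sup>2 + 1)) * ((norm (u b))\<^sup>2 + 1)"
        using a assms by (intro mult_mono) (auto simp: R_def)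
      also have "\<dots> = \<epsilon> / 4" using add_nonneg_pos[of "(norm (u b))\<^sup>2" 1] by (simp add: field_simps)
      finally show ?thesis .
    qed
    moreover have "rho a \<le> 2 * (a * (norm (u b))\<^sup>2) + 2 * (a * (norm (u b - u a))\<^sup>2)"
      using mult_left_mono[OF norm_power2_le_two[of "u a" "u b"], of a] a by (simp add: rho_def algebra_simps)
    ultimately show ?thesis by linarith
  qed
  then show ?thesis using that R by blast
qed

lemma rho_max:
  assumes "\<not> (\<forall>r>0. u r = 0)"
  obtains r0 where "r0 > 0" "rho r0 > 0" "\<And>r. r > 0 \<Longrightarrow> rho r \<le> rho r0"
proof -
  obtain r1 where r1: "r1 > 0" "u r1 \<noteq> 0" using assms by auto
  then have p: "rho r1 > 0" by (simp add: rho_def)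
  obtain A where A: "A > 0" "\<And>r. 0 < r \<Longrightarrow> r \<le> A \<Longrightarrow> rho r \<le> rho r1" using rho_small_at_zero[OF p] by blast
  obtain B where B: "B > 0" "\<And>r. r \<ge> B \<Longrightarrow> rho r \<le> rho r1" using rho_small_at_infinity[OF p] by blast
  define a where "a = min A r1"
  define b where "b = max B r1"
  have ab: "0 < a" "a \<le> r1" "r1 \<le> b" using A B r1 by (auto simp: a_def b_def)
  have "continuous_on {a..b} rho" using ab by (intro continuous_on_subset[OF rho_cont]) auto
  then obtain r0 where r0: "r0 \<in> {a..b}" "\<And>r. r \<in> {a..b} \<Longrightarrow> rho r \<le> rho r0"
    using continuous_attains_sup[of "{a..b}" rho] ab by auto
  have "rho r1 \<le> rho r0" using r0(2)[of r1] ab by auto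
  moreover have "rho r \<le> rho r0" if "r > 0" for r
  proof -
    have "r \<le> A \<or> r \<in> {a..b} \<or> r \<ge> B" by (auto simp: a_def b_def)
    then show ?thesis using A(2)[OF that] B(2) r0(2) \<open>rho r1 \<le> rho r0\<close> by force
  qed
  ultimately show ?thesis using that[of r0] r0(1) ab p by (meson atLeastAtMost_iff less_le_trans)
qed

lemma rho_tendsto: "(\<lambda>n. rho (real (Suc n))) \<longlonglongrightarrow> 0" "(\<lambda>n. rho (1 / real (Suc n))) \<longlonglongrightarrow> 0" "(rho \<longlongrightarrow> 0) at_top"
proof -
  show top: "(rho \<longlongrightarrow> 0) at_top"
  proof (rule tendstoI)
    fix e :: real assume "e > 0"
    then obtain R where "R > 0" "\<And>r. r \<ge> R \<Longrightarrow> rho r \<le> e / 2" using rho_small_at_infinity[of "e / 2"] by auto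
    then have "dist (rho r) 0 < e" if "r \<ge> R" for r
      using that rho_nonneg[of r] \<open>e > 0\<close> by (smt (verit) dist_real_def field_sum_of_halves)
    then show "\<forall>\<^sub>F r in at_top. dist (rho r) 0 < e" by (auto simp: eventually_at_top_linorder)
  qed
  have "filterlim (\<lambda>n. real (Suc n)) at_top sequentially" by real_asymp
  then show "(\<lambda>n. rho (real (Suc n))) \<longlonglongrightarrow> 0" by (rule filterlim_compose[OF top])
  show "(\<lambda>n. rho (1 / real (Suc n))) \<longlonglongrightarrow> 0"
  proof (rule tendstoI)
    fix e :: real assume "e > 0"
    then obtain R where R: "R > 0" "\<And>r. 0 < r \<Longrightarrow> r \<le> R \<Longrightarrow> rho r \<le> e / 2" using rho_small_at_zero[of "e / 2"] by auto
    have "\<forall>\<^sub>F n in sequentially. 1 / real (Suc n) \<le> R" using R(1) by real_asymp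
    then show "\<forall>\<^sub>F n in sequentially. dist (rho (1 / real (Suc n))) 0 < e"
    proof eventually_elim
      case (elim n)
      have "rho (1 / real (Suc n)) \<le> e / 2" "rho (1 / real (Suc n)) \<ge> 0" using R(2) elim rho_nonneg by auto
      then show ?case using \<open>e > 0\<close> by (simp add: dist_real_def)
    qed
  qed
qed

end

section \<open>The slope function and the differential equations of the equality case\<close>

definition slope :: "real \<Rightarrow> real \<Rightarrow> real" where
  "slope M x = sqrt (max 0 (1 - (x / M)\<^sup>2))"

text \<open>Continuity on the whole line is the purpose of the cut-off at zero in
  \<open>slope\<close>; \<open>real_primitive\<close> demands it.\<close>

lemma slope_cont: "continuous_on A (slope M)"
  unfolding slope_def[abs_def] divide_inverse by (intro continuous_intros)

lemma slope_eq: "0 \<le> x \<Longrightarrow> x \<le> M \<Longrightarrow> 0 < M \<Longrightarrow> slope M x = sqrt (1 - (x / M)\<^sup>2)"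
  by (simp add: slope_def max_def power_le_one)

lemma slope_power2: "0 \<le> x \<Longrightarrow> x \<le> M \<Longrightarrow> 0 < M \<Longrightarrow> (slope M x)\<^sup>2 = 1 - (x / M)\<^sup>2"
  by (simp add: slope_eq power_le_one)

lemma slope_nonneg: "0 \<le> slope M x"
  by (simp add: slope_def)

text \<open>The area of a quarter of the ellipse with semi-axes \<open>M\<close> and 1.\<close>

lemma integral_slope:
  assumes M: "M > 0"
  shows "integral {0..M} (slope M) = pi * M / 4"
proof -
  define F where "F x = (x * sqrt (1 - (x / M)\<^sup>2) + M * arcsin (x / M)) / 2" for x
  have sq: "(x / M)\<^sup>2 \<le> 1" if "x \<in> {0..M}" for x using that M by (auto intro!: power_le_one)
  have "((\<lambda>x. sqrt (1 - (x / M)\<^sup>2)) has_integral F M - F 0) {0..M}"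
  proof (rule fundamental_theorem_of_calculus_interior)
    show "continuous_on {0..M} F"
      unfolding F_def using M by (intro continuous_intros) (auto intro: order_trans[of _ 0])
    fix x assume x: "x \<in> {0<..<M}"
    define q where "q = sqrt (1 - (x / M)\<^sup>2)"
    have "(x / M)\<^sup>2 < 1" using x M by (simp add: power_less_one_iff abs_square_less_1)
    then have q: "q > 0" "q\<^sup>2 = 1 - (x / M)\<^sup>2" by (auto simp: q_def)
    have "-1 < x / M" "x / M < 1" using x M by (auto intro: less_trans[of _ 0])
    then have as: "((\<lambda>x. arcsin (x / M)) has_real_derivative inverse q * (1 / M)) (at x)"
      unfolding q_def by (intro DERIV_chain2[OF DERIV_arcsin]) (use M in \<open>auto intro!: derivative_eq_intros\<close>)
    have sqd: "((\<lambda>x. sqrt (1 - (x / M)\<^sup>2)) has_real_derivative inverse q / 2 * (- (2 * (x / M) * (1 / M)))) (at x)"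
      unfolding q_def by (rule DERIV_chain2[OF DERIV_real_sqrt])
        (use q M in \<open>auto intro!: derivative_eq_intros simp: q_def\<close>)
    have "(F has_real_derivative ((1 * q + inverse q / 2 * (- (2 * (x / M) * (1 / M))) * x) + M * (inverse q * (1 / M))) / 2) (at x)"
      using DERIV_cdivide[OF DERIV_add[OF DERIV_mult[OF DERIV_ident sqd] DERIV_cmult[OF as, of M]], of 2]
      by (simp only: F_def[abs_def] q_def)
    also have "((1 * q + inverse q / 2 * (- (2 * (x / M) * (1 / M))) * x) + M * (inverse q * (1 / M))) / 2 = (q + (1 - (x / M)\<^sup>2) / q) / 2"
      using M q(1) by (simp add: field_simps power2_eq_square)
    also have "\<dots> = q" unfolding q(2)[symmetric] using q(1) by (simp add: power2_eq_square)
    finally show "(F has_vector_derivative sqrt (1 - (x / M)\<^sup>2)) (at x)"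
      by (simp add: q_def has_real_derivative_iff_has_vector_derivative)
  qed (use M in auto)
  moreover have "F M - F 0 = pi * M / 4" using M by (simp add: F_def)
  ultimately have "((\<lambda>x. sqrt (1 - (x / M)\<^sup>2)) has_integral pi * M / 4) {0..M}" by simp
  then have "(slope M has_integral pi * M / 4) {0..M}"
    by (rule has_integral_eq[rotated]) (use M in \<open>auto simp: slope_eq\<close>)
  then show ?thesis by blast
qed

lemma real_primitive:
  fixes k :: "real \<Rightarrow> real"
  assumes k: "continuous_on UNIV k"
  obtains K where "\<And>x. x \<ge> 0 \<Longrightarrow> (K has_real_derivative k x) (at x)"
    "\<And>x. x \<ge> 0 \<Longrightarrow> K x - K 0 = integral {0..x} k"
proof -
  define K where "K x = integral {- 1..x} k" for x
  have c: "continuous_on A k" for A using k continuous_on_subset by blast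
  have "(K has_real_derivative k x) (at x)" if "x \<ge> 0" for x
  proof -
    have "(K has_vector_derivative k x) (at x within {- 1..x + 1})"
      unfolding K_def by (rule integral_has_vector_derivative[OF c]) (use that in auto)
    then have "(K has_vector_derivative k x) (at x)"
      using that by (subst (asm) at_within_interior) auto
    then show ?thesis by (simp add: has_real_derivative_iff_has_vector_derivative)
  qed
  moreover have "K x - K 0 = integral {0..x} k" if "x \<ge> 0" for x
    using Henstock_Kurzweil_Integration.integral_combine[of "-1" 0 x k] that integrable_continuous_real[OF c]
    by (simp add: K_def)
  ultimately show ?thesis using that by blast
qed

text \<open>Integrating factor: \<open>u\<close> times the exponential of minus the integral of
  \<open>c\<close> has derivative zero. As the coefficient is a scalar, the direction of the vector
  \<open>u\<close> never changes.\<close>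

lemma linear_ode:
  fixes u :: "real \<Rightarrow> 'b::euclidean_space" and c :: "real \<Rightarrow> real"
  assumes c: "continuous_on {a..b} c" and u: "continuous_on {a..b} u"
    and ode: "\<And>r. a < r \<Longrightarrow> r < b \<Longrightarrow> (u has_vector_derivative c r *\<^sub>R u r) (at r)"
    and t: "t \<in> {a..b}"
  shows "u t = exp (integral {a..t} c) *\<^sub>R u a"
proof (cases "t = a")
  case False
  then have at: "a < t" "t \<le> b" using t by auto
  define z where "z r = exp (- integral {a..r} c) *\<^sub>R u r" for r
  have cz: "continuous_on {a..b} z"
    unfolding z_def using indefinite_integral_continuous_1[OF integrable_continuous_real[OF c]]
    by (intro continuous_intros u)
  have "z t = z a"
  proof (rule euclidean_eqI)
    fix e :: 'b assume "e \<in> Basis"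
    show "z t \<bullet> e = z a \<bullet> e"
    proof (rule DERIV_isconst_end[OF at(1), of "\<lambda>r. z r \<bullet> e"])
      show "continuous_on {a..t} (\<lambda>r. z r \<bullet> e)"
        using at by (intro continuous_intros continuous_on_subset[OF cz]) auto
      fix r assume r: "a < r" "r < t"
      have "((\<lambda>r. integral {a..r} c) has_vector_derivative c r) (at r within {a..b})"
        by (rule integral_has_vector_derivative[OF c]) (use r at in auto)
      then have "((\<lambda>r. integral {a..r} c) has_vector_derivative c r) (at r)"
        using r at by (subst (asm) at_within_interior) auto
      then have I: "((\<lambda>r. integral {a..r} c) has_real_derivative c r) (at r)"
        by (simp add: has_real_derivative_iff_has_vector_derivative)
      have E: "((\<lambda>r. exp (- integral {a..r} c)) has_real_derivative exp (- integral {a..r} c) * (- c r)) (at r)"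
        by (rule DERIV_chain2[OF DERIV_exp DERIV_minus[OF I]])
      have "((\<lambda>r. u r \<bullet> e) has_vector_derivative (c r *\<^sub>R u r) \<bullet> e) (at r)"
        by (rule bounded_linear.has_vector_derivative[OF bounded_linear_inner_left ode]) (use r at in auto)
      then have U: "((\<lambda>r. u r \<bullet> e) has_real_derivative c r * (u r \<bullet> e)) (at r)"
        by (simp add: has_real_derivative_iff_has_vector_derivative)
      from DERIV_mult[OF E U] show "((\<lambda>r. z r \<bullet> e) has_real_derivative 0) (at r)"
        by (simp add: z_def)
    qed
  qed
  then have "exp (integral {a..t} c) *\<^sub>R z t = exp (integral {a..t} c) *\<^sub>R u a" by (simp add: z_def)
  then show ?thesis by (simp add: z_def exp_minus_inverse exp_add[symmetric])
qed simp

text \<open>At \<open>\<rho> = M\<close> the square root destroys uniqueness, so the solution may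
  rest there up to some \<open>b\<close>. After \<open>b\<close>, \<open>y = M / \<rho>\<close>
  satisfies \<open>r y' = sqrt (y\<^sup>2 - 1)\<close>; thus \<open>y\<close> is the hyperbolic
  cosine of \<open>ln (r / b)\<close>, and \<open>(y + sqrt (y\<^sup>2 - 1)) / r\<close> is
  constant.\<close>

lemma profile_ode:
  fixes \<rho> :: "real \<Rightarrow> real"
  assumes "0 < a" and cont: "continuous_on {a..} \<rho>" and \<rho>a: "\<rho> a = M"
    and range: "\<And>r. a \<le> r \<Longrightarrow> 0 < \<rho> r \<and> \<rho> r \<le> M"
    and lim: "(\<rho> \<longlongrightarrow> 0) at_top"
    and ode: "\<And>r. a < r \<Longrightarrow> (\<rho> has_real_derivative - (\<rho> r * slope M (\<rho> r) / r)) (at r)"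
  obtains b where "a \<le> b" "\<And>r. a \<le> r \<Longrightarrow> r \<le> b \<Longrightarrow> \<rho> r = M"
    "\<And>r. b \<le> r \<Longrightarrow> \<rho> r = 2 * M / (r / b + b / r)"
proof -
  have M: "M > 0" using range[of a] by auto
  have anti: "\<rho> t \<le> \<rho> s" if "a \<le> s" "s \<le> t" for s t
  proof (cases "s = t")
    case False
    show ?thesis
    proof (rule DERIV_nonpos_imp_decreasing_open[of s t \<rho>])
      show "s \<le> t" by fact
      show "\<exists>y. (\<rho> has_real_derivative y) (at x) \<and> y \<le> 0" if "s < x" "x < t" for x
        using ode[of x] range[of x] that \<open>a \<le> s\<close> \<open>0 < a\<close> slope_nonneg[of M "\<rho> x"]
        by (intro exI[of _ "- (\<rho> x * slope M (\<rho> x) / x)"]) (auto intro!: divide_nonneg_pos mult_nonneg_nonneg)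
      show "continuous_on {s..t} \<rho>" using that by (intro continuous_on_subset[OF cont]) auto
    qed
  qed simp
  define T where "T = {r \<in> {a..}. \<rho> r = M}"
  have aT: "a \<in> T" using \<rho>a by (simp add: T_def)
  have "closed T" unfolding T_def
    using continuous_closed_preimage_constant[OF cont] by simp
  obtain R where R: "\<And>r. r \<ge> R \<Longrightarrow> \<rho> r < M"
    using order_tendstoD(2)[OF lim M] by (auto simp: eventually_at_top_linorder)
  have bdd: "bdd_above T"
  proof (rule bdd_aboveI[of _ R])
    fix r assume "r \<in> T"
    then show "r \<le> R" using R[of r] by (cases "r \<le> R") (auto simp: T_def)
  qed
  define b where "b = Sup T"
  have bT: "b \<in> T" unfolding b_def using closed_contains_Sup[OF _ bdd \<open>closed T\<close>] aT by auto
  have ab: "a \<le> b" using bT by (simp add: T_def)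
  have b: "b > 0" using ab \<open>0 < a\<close> by simp
  have flat: "\<rho> r = M" if "a \<le> r" "r \<le> b" for r
    using anti[OF that] range[OF that(1)] bT by (auto simp: T_def)
  have less: "\<rho> r < M" if "b < r" for r
  proof -
    have "r \<notin> T" using that cSup_upper[OF _ bdd, of r] by (auto simp: b_def)
    then show ?thesis using range[of r] that ab by (auto simp: T_def)
  qed
  define y where "y r = M / \<rho> r" for r
  define z where "z r = (y r + sqrt ((y r)\<^sup>2 - 1)) / r" for r
  have y1: "y r \<ge> 1" if "b \<le> r" for r using range[of r] that ab by (simp add: y_def)
  have zconst: "z t = 1 / b" if "b < t" for t
  proof -
    have "z t = z b"
    proof (rule DERIV_isconst_end[OF that])
      have "\<rho> r \<noteq> 0" if "b \<le> r" for r using range[of r] that ab by auto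
      then show "continuous_on {b..t} z" unfolding z_def y_def
        using b ab by (intro continuous_intros continuous_on_subset[OF cont]) auto
      fix r assume r: "b < r" "r < t"
      have rho: "0 < \<rho> r" "\<rho> r < M" using range[of r] less[of r] r ab by auto
      define q where "q = sqrt ((y r)\<^sup>2 - 1)"
      have "y r > 1" using rho by (simp add: y_def)
      then have "(y r)\<^sup>2 > 1" by (simp add: one_less_power)
      then have q: "q > 0" "q\<^sup>2 = (y r)\<^sup>2 - 1" by (auto simp: q_def)
      have "slope M (\<rho> r) = sqrt (1 - (\<rho> r / M)\<^sup>2)" using rho M by (intro slope_eq) auto
      also have "1 - (\<rho> r / M)\<^sup>2 = ((y r)\<^sup>2 - 1) / (y r)\<^sup>2"
        using rho M by (simp add: y_def field_simps)
      also have "sqrt \<dots> = q / y r" using \<open>y r > 1\<close> by (simp add: q_def real_sqrt_divide)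
      finally have sl: "slope M (\<rho> r) = q / y r" .
      have "(y has_real_derivative - (M * (- (\<rho> r * slope M (\<rho> r) / r))) / (\<rho> r * \<rho> r)) (at r)"
        unfolding y_def using ode[of r] r ab rho by (auto intro!: derivative_eq_intros)
      also have "- (M * (- (\<rho> r * slope M (\<rho> r) / r))) / (\<rho> r * \<rho> r) = q / r"
        unfolding sl using rho M by (simp add: y_def)
      finally have yd: "(y has_real_derivative q / r) (at r)" .
      have "((\<lambda>r. (y r)\<^sup>2 - 1) has_real_derivative 2 * y r * (q / r)) (at r)"
        by (auto intro!: derivative_eq_intros yd)
      from DERIV_chain2[OF DERIV_real_sqrt this] q(1)
      have sd: "((\<lambda>r. sqrt ((y r)\<^sup>2 - 1)) has_real_derivative inverse q / 2 * (2 * y r * (q / r))) (at r)"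
        by (simp add: q_def)
      have "(z has_real_derivative ((q / r + inverse q / 2 * (2 * y r * (q / r))) * r - (y r + q) * 1) / (r * r)) (at r)"
        unfolding z_def q_def by (rule DERIV_divide[OF DERIV_add[OF yd[unfolded q_def] sd[unfolded q_def]] DERIV_ident]) (use r b in auto)
      also have "((q / r + inverse q / 2 * (2 * y r * (q / r))) * r - (y r + q) * 1) / (r * r) = 0"
        using q(1) r b by (simp add: field_simps)
      finally show "(z has_real_derivative 0) (at r)" .
    qed
    then show ?thesis using bT M by (simp add: z_def y_def T_def)
  qed
  have "\<rho> r = 2 * M / (r / b + b / r)" if "b \<le> r" for r
  proof (cases "r = b")
    case True
    then show ?thesis using bT b by (simp add: T_def)
  next
    case False
    then have r: "b < r" "r > 0" using that b by auto
    have "y r + sqrt ((y r)\<^sup>2 - 1) = r / b" using zconst[OF r(1)] r by (simp add: z_def field_simps)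
    then have "sqrt ((y r)\<^sup>2 - 1) = r / b - y r" by simp
    then have "(y r)\<^sup>2 - 1 = (r / b - y r)\<^sup>2" using y1[OF that] by (metis one_le_power diff_ge_0_iff_ge real_sqrt_pow2)
    then have "2 * (r / b) * y r = (r / b)\<^sup>2 + 1" by (simp add: power2_eq_square algebra_simps)
    then have "2 * y r = ((r / b)\<^sup>2 + 1) / (r / b)" using r b by (simp add: field_simps)
    also have "\<dots> = r / b + b / r" using r b by (simp add: field_simps power2_eq_square)
    finally have "2 * M / \<rho> r = r / b + b / r" by (simp add: y_def)
    moreover have "\<rho> r > 0" using range[of r] that ab by auto
    moreover have "r / b + b / r > 0" using r b by (simp add: add_pos_pos)
    ultimately show ?thesis by (simp add: field_simps)
  qed
  with ab flat show ?thesis using that by blast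
qed

section \<open>Completing the square on both sides of the maximum\<close>

context radial_energy
begin

definition defect :: "real \<Rightarrow> real \<Rightarrow> real \<Rightarrow> real" where
  "defect \<sigma> M r = (norm (r *\<^sub>R w r + ((1 + \<sigma> * slope M (rho r)) / 2) *\<^sub>R u r))\<^sup>2"

text \<open>Expanding the square, \<open>k\<^sup>2 |u|\<^sup>2\<close> is rewritten by the quadratic
  equation for \<open>k\<close>: one part is the sextic term, the other joins the cross term to form
  \<open>k\<close> times the derivative of \<open>rho\<close>.\<close>

lemma defect_eq:
  assumes M: "M > 0" "rho r \<le> M" and r: "r > 0" and \<sigma>: "\<sigma>\<^sup>2 = 1"
  shows "defect \<sigma> M r = r\<^sup>2 * (norm (w r))\<^sup>2 - 1 / (4 * M\<^sup>2) * (r\<^sup>2 * norm (u r) ^ 6)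
     + (1 + \<sigma> * slope M (rho r)) / 2 * ((norm (u r))\<^sup>2 + 2 * r * (u r \<bullet> w r))"
proof -
  define k where "k = (1 + \<sigma> * slope M (rho r)) / 2"
  define N where "N = (norm (u r))\<^sup>2"
  have "2 * k - 1 = \<sigma> * slope M (rho r)" by (simp add: k_def field_simps)
  then have "(2 * k - 1)\<^sup>2 = (slope M (rho r))\<^sup>2" using \<sigma> by (simp add: power_mult_distrib)
  also have "\<dots> = 1 - (rho r / M)\<^sup>2" using rho_nonneg[OF r] M by (intro slope_power2) auto
  finally have "4 * k\<^sup>2 = 4 * k - (rho r / M)\<^sup>2" by (simp add: power2_eq_square algebra_simps)
  then have "k\<^sup>2 = k - (rho r / M)\<^sup>2 / 4" by simp
  then have k2: "k\<^sup>2 * N = k * N - (rho r / M)\<^sup>2 / 4 * N" by (simp only: left_diff_distrib)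
  have "(rho r / M)\<^sup>2 / 4 * N = 1 / (4 * M\<^sup>2) * (r\<^sup>2 * norm (u r) ^ 6)"
    by (simp add: rho_def N_def power_mult_distrib power_divide power2_eq_square eval_nat_numeral mult_ac)
  moreover have "defect \<sigma> M r = r\<^sup>2 * (norm (w r))\<^sup>2 + 2 * r * k * (u r \<bullet> w r) + k\<^sup>2 * N"
    unfolding defect_def k_def[symmetric] N_def power2_norm_eq_inner
    by (simp add: inner_add_left inner_add_right inner_commute power2_eq_square algebra_simps)
  ultimately show ?thesis unfolding k2 k_def[symmetric] N_def[symmetric] by (simp add: algebra_simps)
qed

lemma defect_integral:
  assumes M: "M > 0" "\<And>r. r > 0 \<Longrightarrow> rho r \<le> M" and \<sigma>: "\<sigma>\<^sup>2 = 1"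
    and K: "\<And>x. x \<ge> 0 \<Longrightarrow> (K has_real_derivative (1 + \<sigma> * slope M x) / 2) (at x)"
    and ab: "0 < a" "a \<le> b"
  shows "defect \<sigma> M absolutely_integrable_on {a..b}"
    "integral {a..b} (defect \<sigma> M) = integral {a..b} (\<lambda>r. r\<^sup>2 * (norm (w r))\<^sup>2 - 1 / (4 * M\<^sup>2) * (r\<^sup>2 * norm (u r) ^ 6))
       + (K (rho b) - K (rho a))"
proof -
  define f where "f r = r\<^sup>2 * (norm (w r))\<^sup>2 - 1 / (4 * M\<^sup>2) * (r\<^sup>2 * norm (u r) ^ 6)" for r
  define g where "g r = (1 + \<sigma> * slope M (rho r)) / 2 * ((norm (u r))\<^sup>2 + 2 * r * (u r \<bullet> w r))" for r
  have "primitive_on {0<..} (\<lambda>r. K (r * (norm (u r))\<^sup>2))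
     (\<lambda>r. (1 + \<sigma> * slope M (r * (norm (u r))\<^sup>2)) / 2 * ((norm (u r))\<^sup>2 + 2 * r * (u r \<bullet> w r)))"
    by (rule primitive_on_radial_chain[OF prim K])
       (auto intro!: continuous_intros slope_cont)
  then have p: "primitive_on {0<..} (\<lambda>r. K (rho r)) g" by (simp add: rho_def[abs_def] g_def[abs_def])
  have sub: "{a..b} \<subseteq> {0<..}" using ab by auto
  have g: "g absolutely_integrable_on {a..b}" "integral {a..b} g = K (rho b) - K (rho a)"
    using primitive_onD[OF p sub] ab by auto
  have f: "f absolutely_integrable_on {a..b}"
    unfolding f_def[abs_def]
    by (intro set_integral_diff half_line_integral(1)[OF int2 ab(1)] set_integrable_mult_right half_line_integral(1)[OF int6 ab(1)])
  have eq: "defect \<sigma> M r = f r + g r" if "r \<in> {a..b}" for r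
    using defect_eq[OF M(1) M(2) _ \<sigma>, of r] that ab by (simp add: f_def g_def)
  have fg: "(\<lambda>r. f r + g r) absolutely_integrable_on {a..b}" using f g(1) by (rule set_integral_add(1))
  then show "defect \<sigma> M absolutely_integrable_on {a..b}"
  proof -
    have "(\<lambda>r. indicator {a..b} r *\<^sub>R defect \<sigma> M r) = (\<lambda>r. indicator {a..b} r *\<^sub>R (f r + g r))"
      using eq by (auto simp: indicator_def)
    with fg show ?thesis by (simp add: set_integrable_def)
  qed
  have "integral {a..b} (defect \<sigma> M) = integral {a..b} (\<lambda>r. f r + g r)"
    by (rule integral_cong) (rule eq)
  also have "\<dots> = integral {a..b} f + integral {a..b} g"
    using f g(1) by (intro integral_add) (auto simp: absolutely_integrable_on_def)
  finally show "integral {a..b} (defect \<sigma> M) = integral {a..b} (\<lambda>r. r\<^sup>2 * (norm (w r))\<^sup>2 - 1 / (4 * M\<^sup>2) * (r\<^sup>2 * norm (u r) ^ 6))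
       + (K (rho b) - K (rho a))"
    by (simp add: g(2) f_def[abs_def])
qed

text \<open>The sign is -1 left of \<open>r0\<close> and +1 right of it. The boundary terms at zero
  and infinity disappear because \<open>rho\<close> tends to zero, those at \<open>r0\<close>
  combine to \<open>- pi * M / 4\<close>, and the integrals of the two squares are bounded by what
  is left of the energy.\<close>

lemma energy_gap:
  assumes r0: "r0 > 0" and M: "M = rho r0" "M > 0" "\<And>r. r > 0 \<Longrightarrow> rho r \<le> M"
  shows "\<And>a b. 0 < a \<Longrightarrow> a \<le> r0 \<Longrightarrow> r0 \<le> b \<Longrightarrow>
    integral {a..r0} (defect (-1) M) + integral {r0..b} (defect 1 M) \<le> energy - mass / (4 * M\<^sup>2) - pi * M / 4"
    and "\<And>\<sigma> a b. \<sigma>\<^sup>2 = 1 \<Longrightarrow> 0 < a \<Longrightarrow> defect \<sigma> M absolutely_integrable_on {a..b}"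
proof -
  define f where "f r = r\<^sup>2 * (norm (w r))\<^sup>2 - 1 / (4 * M\<^sup>2) * (r\<^sup>2 * norm (u r) ^ 6)" for r
  have ck: "continuous_on UNIV (\<lambda>x. (1 + \<sigma> * slope M x) / 2)" for \<sigma> by (intro continuous_intros slope_cont) auto
  show di: "defect \<sigma> M absolutely_integrable_on {a..b}" if "\<sigma>\<^sup>2 = 1" "0 < a" for \<sigma> a b
  proof (cases "a \<le> b")
    case True
    obtain K where "\<And>x. x \<ge> 0 \<Longrightarrow> (K has_real_derivative (1 + \<sigma> * slope M x) / 2) (at x)"
      using real_primitive[OF ck] by metis
    from defect_integral(1)[OF M(2,3) that(1) this that(2) True] show ?thesis by simp
  qed simp
  then have dint: "defect \<sigma> M integrable_on {a..b}" if "\<sigma>\<^sup>2 = 1" "0 < a" for \<sigma> a b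
    using that by (auto simp: absolutely_integrable_on_def)
  have dnn: "defect \<sigma> M r \<ge> 0" for \<sigma> r by (simp add: defect_def)
  obtain K1 where K1: "\<And>x. x \<ge> 0 \<Longrightarrow> (K1 has_real_derivative (1 + 1 * slope M x) / 2) (at x)"
    "\<And>x. x \<ge> 0 \<Longrightarrow> K1 x - K1 0 = integral {0..x} (\<lambda>x. (1 + 1 * slope M x) / 2)"
    using real_primitive[OF ck[of 1]] by metis
  obtain K2 where K2: "\<And>x. x \<ge> 0 \<Longrightarrow> (K2 has_real_derivative (1 + (-1) * slope M x) / 2) (at x)"
    "\<And>x. x \<ge> 0 \<Longrightarrow> K2 x - K2 0 = integral {0..x} (\<lambda>x. (1 + (-1) * slope M x) / 2)"
    using real_primitive[OF ck[of "-1"]] by metis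
  have ki: "(\<lambda>x. (1 + \<sigma> * slope M x) / 2) integrable_on {0..M}" for \<sigma>
    using ck by (intro integrable_continuous_real) (auto intro: continuous_on_subset)
  \<comment> \<open>The integrands \<open>(1 + S) / 2\<close> and \<open>(1 - S) / 2\<close> differ
    by \<open>S\<close>, so the boundary terms combine to the quarter ellipse.\<close>
  have "(K1 M - K1 0) - (K2 M - K2 0) = integral {0..M} (\<lambda>x. (1 + 1 * slope M x) / 2 - (1 + (-1) * slope M x) / 2)"
    using K1(2)[of M] K2(2)[of M] M(2) integral_diff[OF ki[of 1] ki[of "-1"]] by simp
  also have "(\<lambda>x. (1 + 1 * slope M x) / 2 - (1 + (-1) * slope M x) / 2) = slope M" by (auto simp: field_simps)
  finally have KM: "(K1 M - K1 0) - (K2 M - K2 0) = pi * M / 4" using integral_slope[OF M(2)] by simp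
  have split: "integral {a..r0} (defect (-1) M) + integral {r0..b} (defect 1 M)
      = integral {a..b} f + (K2 M - K2 (rho a)) + (K1 (rho b) - K1 M)" if "0 < a" "a \<le> r0" "r0 \<le> b" for a b
  proof -
    have fi: "f integrable_on {a..b}"
      unfolding f_def[abs_def]
      by (intro integrable_diff half_line_integral(2)[OF int2 that(1)] integrable_on_mult_right half_line_integral(2)[OF int6 that(1)])
    show ?thesis
      using defect_integral(2)[OF M(2,3) _ K2(1) that(1,2)] defect_integral(2)[OF M(2,3) _ K1(1) r0 that(3)]
        Henstock_Kurzweil_Integration.integral_combine[OF that(2,3) fi]
      by (simp add: f_def[abs_def] M(1)[symmetric])
  qed
  have fs: "set_integrable lborel {0<..} f"
    unfolding f_def[abs_def] using int2 int6 by (intro set_integral_diff set_integrable_mult_right)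
  have fE: "(LINT r:{0<..}|lborel. f r) = energy - mass / (4 * M\<^sup>2)"
    unfolding f_def energy_def mass_def using int2 int6
    by (subst set_integral_diff(2)) (auto simp: set_integral_mult_right intro!: set_integrable_mult_right)
  have "isCont K1 0" "isCont K2 0" using K1(1)[of 0] K2(1)[of 0] DERIV_isCont by blast+
  then have lim: "(\<lambda>n. K1 (rho (real (Suc n)))) \<longlonglongrightarrow> K1 0" "(\<lambda>n. K2 (rho (1 / real (Suc n)))) \<longlonglongrightarrow> K2 0"
    using isCont_tendsto_compose rho_tendsto(1,2) by blast+
  have "(\<lambda>n. integral {1 / real (Suc n)..real (Suc n)} f + (K2 M - K2 (rho (1 / real (Suc n)))) + (K1 (rho (real (Suc n))) - K1 M))
     \<longlonglongrightarrow> (energy - mass / (4 * M\<^sup>2)) + (K2 M - K2 0) + (K1 0 - K1 M)"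
    using half_line_integral(4)[OF fs] lim unfolding fE by (intro tendsto_intros)
  also have "(energy - mass / (4 * M\<^sup>2)) + (K2 M - K2 0) + (K1 0 - K1 M) = energy - mass / (4 * M\<^sup>2) - pi * M / 4"
    using KM by simp
  finally have L: "(\<lambda>n. integral {1 / real (Suc n)..real (Suc n)} f + (K2 M - K2 (rho (1 / real (Suc n)))) + (K1 (rho (real (Suc n))) - K1 M))
     \<longlonglongrightarrow> energy - mass / (4 * M\<^sup>2) - pi * M / 4" .
  fix a b :: real assume ab: "0 < a" "a \<le> r0" "r0 \<le> b"
  have "\<forall>\<^sub>F n in sequentially. 1 / real (Suc n) \<le> a" "\<forall>\<^sub>F n in sequentially. b \<le> real (Suc n)"
    using ab(1) by real_asymp+
  \<comment> \<open>Squares are nonnegative, so the given interval may be enlarged to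
    \<open>{1/n..n}\<close>, where the limit of the right-hand side is known.\<close>
  then have "\<forall>\<^sub>F n in sequentially. integral {a..r0} (defect (-1) M) + integral {r0..b} (defect 1 M)
     \<le> integral {1 / real (Suc n)..real (Suc n)} f + (K2 M - K2 (rho (1 / real (Suc n)))) + (K1 (rho (real (Suc n))) - K1 M)"
  proof eventually_elim
    case (elim n)
    have p: "0 < 1 / real (Suc n)" by simp
    have "integral {a..r0} (defect (-1) M) \<le> integral {1 / real (Suc n)..r0} (defect (-1) M)"
      using elim dnn by (intro integral_subset_le dint p ab(1)) auto
    moreover have "integral {r0..b} (defect 1 M) \<le> integral {r0..real (Suc n)} (defect 1 M)"
      using elim dnn by (intro integral_subset_le dint r0) auto
    moreover have "integral {1 / real (Suc n)..r0} (defect (-1) M) + integral {r0..real (Suc n)} (defect 1 M)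
      = integral {1 / real (Suc n)..real (Suc n)} f + (K2 M - K2 (rho (1 / real (Suc n)))) + (K1 (rho (real (Suc n))) - K1 M)"
      by (rule split[OF p]) (use elim ab in linarith)+
    ultimately show ?case by linarith
  qed
  then show "integral {a..r0} (defect (-1) M) + integral {r0..b} (defect 1 M) \<le> energy - mass / (4 * M\<^sup>2) - pi * M / 4"
    using tendsto_lowerbound[OF L] by simp
qed

end

text \<open>In the rescaled radius the first derivative is, up to a constant, the mass density of
  the Talenti profile and the second its energy density.\<close>

lemma arctan_rational_DERIV:
  fixes t :: real
  shows "((\<lambda>t. (arctan t + t * (t\<^sup>2 - 1) / (1 + t\<^sup>2)\<^sup>2) / 8) has_real_derivative t\<^sup>2 / (1 + t\<^sup>2) ^ 3) (at t)"
    "((\<lambda>t. (3 * arctan t - (5 * t ^ 3 + 3 * t) / (1 + t\<^sup>2)\<^sup>2) / 8) has_real_derivative t ^ 4 / (1 + t\<^sup>2) ^ 3) (at t)"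
proof -
  define q where "q = 1 + t\<^sup>2"
  have q: "q > 0" by (simp add: q_def add_pos_nonneg)
  have t2: "t\<^sup>2 = q - 1" by (simp add: q_def)
  have t3: "t ^ 3 = t * (q - 1)" "t ^ 4 = (q - 1)\<^sup>2" "t * t = q - 1"
    using t2 by (simp_all add: power2_eq_square eval_nat_numeral algebra_simps flip: t2)
  have "((\<lambda>t. (arctan t + t * (t\<^sup>2 - 1) / (1 + t\<^sup>2)\<^sup>2) / 8) has_real_derivative
     (inverse q + ((1 * (t\<^sup>2 - 1) + (2 * t) * t) * q\<^sup>2 - t * (t\<^sup>2 - 1) * (2 * q * (2 * t))) / (q\<^sup>2 * q\<^sup>2)) / 8) (at t)"
    unfolding q_def using q[unfolded q_def] by (auto intro!: derivative_eq_intros)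
  also have "(inverse q + ((1 * (t\<^sup>2 - 1) + (2 * t) * t) * q\<^sup>2 - t * (t\<^sup>2 - 1) * (2 * q * (2 * t))) / (q\<^sup>2 * q\<^sup>2)) / 8 = t\<^sup>2 / q ^ 3"
  proof -
    have "t * (t\<^sup>2 - 1) * (2 * q * (2 * t)) = 4 * q * (t * t) * (t\<^sup>2 - 1)" "(2 * t) * t = 2 * (t * t)" by simp_all
    then show ?thesis using q by (simp only: t2 t3) (simp add: divide_simps, simp add: algebra_simps eval_nat_numeral)
  qed
  finally show "((\<lambda>t. (arctan t + t * (t\<^sup>2 - 1) / (1 + t\<^sup>2)\<^sup>2) / 8) has_real_derivative t\<^sup>2 / (1 + t\<^sup>2) ^ 3) (at t)"
    by (simp add: q_def)
  have "((\<lambda>t. (3 * arctan t - (5 * t ^ 3 + 3 * t) / (1 + t\<^sup>2)\<^sup>2) / 8) has_real_derivative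
     (3 * inverse q - ((15 * t\<^sup>2 + 3) * q\<^sup>2 - (5 * t ^ 3 + 3 * t) * (2 * q * (2 * t))) / (q\<^sup>2 * q\<^sup>2)) / 8) (at t)"
    unfolding q_def using q[unfolded q_def] by (auto intro!: derivative_eq_intros)
  also have "(3 * inverse q - ((15 * t\<^sup>2 + 3) * q\<^sup>2 - (5 * t ^ 3 + 3 * t) * (2 * q * (2 * t))) / (q\<^sup>2 * q\<^sup>2)) / 8 = t ^ 4 / q ^ 3"
  proof -
    have "(5 * (t * (q - 1)) + 3 * t) * (2 * q * (2 * t)) = 4 * q * (t * t) * (5 * (q - 1) + 3)" by (simp add: algebra_simps)
    then show ?thesis using q by (simp only: t2 t3) (simp add: divide_simps, simp add: algebra_simps eval_nat_numeral)
  qed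
  finally show "((\<lambda>t. (3 * arctan t - (5 * t ^ 3 + 3 * t) / (1 + t\<^sup>2)\<^sup>2) / 8) has_real_derivative t ^ 4 / (1 + t\<^sup>2) ^ 3) (at t)"
    by (simp add: q_def)
qed

text \<open>With \<open>s = r / b\<close> the integrand becomes
  \<open>8 * M ^ 3 * s\<^sup>2 / (1 + s\<^sup>2) ^ 3\<close>. This is the mass carried by a piece of
  the extremal profile.\<close>

lemma profile_cube_integral:
  fixes b M :: real
  assumes "b > 0" "0 < x" "x \<le> y"
  defines "G \<equiv> \<lambda>r. M ^ 3 * (arctan (r / b) + (r / b) * ((r / b)\<^sup>2 - 1) / (1 + (r / b)\<^sup>2)\<^sup>2)"
  shows "((\<lambda>r. (2 * M / (r / b + b / r)) ^ 3 / r) has_integral G y - G x) {x..y}"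
proof (rule fundamental_theorem_of_calculus[OF assms(3)])
  fix r assume r: "r \<in> {x..y}"
  define s where "s = r / b"
  have s: "s > 0" using r assms by (simp add: s_def)
  have d: "((\<lambda>s. arctan s + s * (s\<^sup>2 - 1) / (1 + s\<^sup>2)\<^sup>2) has_real_derivative 8 * s\<^sup>2 / (1 + s\<^sup>2) ^ 3) (at s)"
  proof -
    have "8 * (y / 8) = y" for y :: real by simp
    then show ?thesis
      using DERIV_cmult[OF arctan_rational_DERIV(1), of 8 s] by (simp only: times_divide_eq_right[of 8 "s\<^sup>2"])
  qed
  have "((\<lambda>r. r / b) has_real_derivative 1 / b) (at r)" using assms by (auto intro!: derivative_eq_intros)
  from DERIV_cmult[OF DERIV_chain2[OF d[unfolded s_def] this], of "M ^ 3"]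
  have "(G has_real_derivative M ^ 3 * (8 * s\<^sup>2 / (1 + s\<^sup>2) ^ 3 * (1 / b))) (at r)"
    by (simp add: G_def s_def)
  moreover have "M ^ 3 * (8 * s\<^sup>2 / (1 + s\<^sup>2) ^ 3 * (1 / b)) = (2 * M / (r / b + b / r)) ^ 3 / r"
  proof -
    have "r / b + b / r = (1 + s\<^sup>2) / s" using s r assms by (simp add: s_def field_simps power2_eq_square)
    then have "(2 * M / (r / b + b / r)) ^ 3 / r = (2 * M * s / (1 + s\<^sup>2)) ^ 3 / (s * b)"
      using s r assms by (simp add: s_def mult.commute[of b])
    also have "\<dots> = M ^ 3 * (8 * s\<^sup>2 / (1 + s\<^sup>2) ^ 3 * (1 / b))"
      using s assms(1) by (simp add: power_divide power_mult_distrib power2_eq_square power3_eq_cube mult_ac)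
    finally show ?thesis by simp
  qed
  ultimately show "(G has_vector_derivative (2 * M / (r / b + b / r)) ^ 3 / r) (at r within {x..y})"
    by (simp add: has_real_derivative_iff_has_vector_derivative has_vector_derivative_at_within)
qed

text \<open>The arithmetic-geometric mean inequality for \<open>x\<close>, \<open>y\<close>,
  \<open>y\<close>. The factorization with \<open>(x - y)\<^sup>2\<close> yields the case of
  equality along with the inequality.\<close>

lemma amgm_cube:
  fixes x y e :: real
  assumes "x \<ge> 0" "y > 0" "e \<ge> x + 2 * y"
  shows "27 * x * y\<^sup>2 \<le> e ^ 3" "e ^ 3 = 27 * x * y\<^sup>2 \<Longrightarrow> x = y \<and> e = 3 * y"
proof -
  have id: "(x + 2 * y) ^ 3 - 27 * x * y\<^sup>2 = (x - y)\<^sup>2 * (x + 8 * y)"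
    by (simp add: power3_eq_cube power2_eq_square algebra_simps)
  have "(x - y)\<^sup>2 * (x + 8 * y) \<ge> 0" using assms by simp
  moreover have mono: "(x + 2 * y) ^ 3 \<le> e ^ 3" using assms by (intro power_mono) auto
  ultimately show "27 * x * y\<^sup>2 \<le> e ^ 3" using id by linarith
  assume eq: "e ^ 3 = 27 * x * y\<^sup>2"
  then have "(x - y)\<^sup>2 * (x + 8 * y) \<le> 0" using id mono by linarith
  then have "(x - y)\<^sup>2 \<le> 0" using assms by (simp add: mult_le_0_iff)
  then have "x = y" by simp
  moreover have "e ^ 3 = (x + 2 * y) ^ 3" using eq id \<open>x = y\<close> by simp
  then have "e = x + 2 * y" using assms power_eq_iff_eq_base[of 3 e "x + 2 * y"] by simp
  ultimately show "x = y \<and> e = 3 * y" by simp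
qed

section \<open>The sharp inequality and its case of equality\<close>

context radial_energy
begin

lemma energy_nonneg: "energy \<ge> 0"
  unfolding energy_def set_lebesgue_integral_def by (intro integral_nonneg_AE) (auto simp: indicator_def)

lemma mass_nonneg: "mass \<ge> 0"
  unfolding mass_def set_lebesgue_integral_def by (intro integral_nonneg_AE) (auto simp: indicator_def)

lemma defect_nonneg: "defect \<sigma> M r \<ge> 0"
  by (simp add: defect_def)

text \<open>Taking the degenerate interval \<open>{r0..r0}\<close> in \<open>energy_gap\<close>
  discards the squares. The last term is written as twice \<open>pi * M / 8\<close> to fit the
  three-term mean inequality.\<close>

lemma energy_lower_bound:
  assumes r0: "r0 > 0" and M: "M = rho r0" "M > 0" "\<And>r. r > 0 \<Longrightarrow> rho r \<le> M"
  shows "energy \<ge> mass / (4 * M\<^sup>2) + 2 * (pi * M / 8)"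
proof -
  have z: "integral {r0..r0} g = 0" for g :: "real \<Rightarrow> real" by simp
  have "integral {r0..r0} (defect (-1) M) + integral {r0..r0} (defect 1 M) \<le> energy - mass / (4 * M\<^sup>2) - pi * M / 4"
    by (rule energy_gap(1)[OF r0 M r0 order_refl order_refl])
  then show ?thesis unfolding z by linarith
qed

text \<open>With \<open>x = mass / (4 * M\<^sup>2)\<close> and \<open>y = pi * M / 8\<close> the
  product \<open>27 * x * y\<^sup>2\<close> is free of \<open>M\<close>; its value is the constant
  of the statement.\<close>

lemma bliss_inequality: "27 * pi\<^sup>2 / 256 * mass \<le> energy ^ 3"
proof (cases "\<forall>r>0. u r = 0")
  case True
  then have "(\<lambda>r. indicator {0<..} r *\<^sub>R (r\<^sup>2 * norm (u r) ^ 6)) = (\<lambda>r. 0)"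
    by (auto simp: indicator_def)
  then have "mass = 0" by (simp only: mass_def set_lebesgue_integral_def Bochner_Integration.integral_zero)
  then show ?thesis using energy_nonneg by simp
next
  case False
  then obtain r0 where r0: "r0 > 0" "rho r0 > 0" "\<And>r. r > 0 \<Longrightarrow> rho r \<le> rho r0"
    using rho_max by metis
  have "27 * (mass / (4 * (rho r0)\<^sup>2)) * (pi * rho r0 / 8)\<^sup>2 \<le> energy ^ 3"
  proof (rule amgm_cube(1))
    show "mass / (4 * (rho r0)\<^sup>2) + 2 * (pi * rho r0 / 8) \<le> energy"
      by (rule energy_lower_bound[OF r0(1) refl r0(2,3)])
  qed (use mass_nonneg r0(2) in auto)
  also have "27 * (mass / (4 * (rho r0)\<^sup>2)) * (pi * rho r0 / 8)\<^sup>2 = 27 * pi\<^sup>2 / 256 * mass"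
    using r0(2) by (simp add: power2_eq_square)
  finally show ?thesis .
qed

text \<open>A nonnegative function with integral zero vanishes almost everywhere, so
  \<open>w\<close> equals a continuous multiple of \<open>u\<close> off a null set. The integral
  formula for \<open>u\<close> then has a continuous integrand, which upgrades the relation to a
  classical derivative.\<close>

lemma defect_zero_ode:
  assumes M: "M > 0" and di: "defect \<sigma> M absolutely_integrable_on {a..b}" and zero: "integral {a..b} (defect \<sigma> M) = 0"
    and ab: "0 < a" "a < r" "r < b"
  shows "(u has_vector_derivative (- (1 + \<sigma> * slope M (rho r)) / (2 * r)) *\<^sub>R u r) (at r)"
proof -
  define c where "c r = - (1 + \<sigma> * slope M (rho r)) / (2 * r)" for r
  have sub: "{a..b} \<subseteq> {0<..}" using ab by auto
  have cr: "continuous_on {a..b} rho" by (rule continuous_on_subset[OF rho_cont sub])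
  have cc: "continuous_on {a..b} c"
    unfolding c_def using ab by (intro continuous_intros continuous_on_compose2[OF slope_cont cr]) auto
  have cu: "continuous_on {a..b} (\<lambda>r. c r *\<^sub>R u r)"
    by (intro continuous_intros cc continuous_on_subset[OF u_cont sub])
  have "(LINT r|lebesgue. indicator {a..b} r * defect \<sigma> M r) = 0"
    using set_lebesgue_integral_eq_integral(2)[OF di] zero by (simp add: set_lebesgue_integral_def)
  moreover have "integrable lebesgue (\<lambda>r. indicator {a..b} r * defect \<sigma> M r)"
    using di by (simp add: set_integrable_def)
  ultimately have "AE r in lebesgue. indicator {a..b} r * defect \<sigma> M r = 0"
    by (subst (asm) integral_nonneg_eq_0_iff_AE) (auto simp: defect_nonneg)
  then obtain N where N: "N \<in> null_sets lebesgue" "{r. indicator {a..b} r * defect \<sigma> M r \<noteq> 0} \<subseteq> N"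
    unfolding eventually_ae_filter by auto
  have neg: "negligible N" using N(1) by (simp add: negligible_iff_null_sets)
  have wc: "w r = c r *\<^sub>R u r" if "r \<in> {a..b} - N" for r
  proof -
    have "r > 0" using that ab by auto
    have "defect \<sigma> M r = 0" using that N(2) by (auto simp: indicator_def)
    then have "r *\<^sub>R w r = - (((1 + \<sigma> * slope M (rho r)) / 2) *\<^sub>R u r)"
      by (simp add: defect_def eq_neg_iff_add_eq_0)
    then have "(1 / r) *\<^sub>R (r *\<^sub>R w r) = (1 / r) *\<^sub>R (- (((1 + \<sigma> * slope M (rho r)) / 2) *\<^sub>R u r))" by simp
    then have "w r = - (((1 + \<sigma> * slope M (rho r)) / (2 * r)) *\<^sub>R u r)"
      using \<open>r > 0\<close> by (simp add: mult.commute)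
    moreover have "c r = - ((1 + \<sigma> * slope M (rho r)) / (2 * r))"
      unfolding c_def by (rule minus_divide_left[symmetric])
    ultimately show ?thesis by (simp only: scaleR_minus_left)
  qed
  have ut: "u t = u a + integral {a..t} (\<lambda>r. c r *\<^sub>R u r)" if "t \<in> {a..b}" for t
  proof -
    have "integral {a..t} w = integral {a..t} (\<lambda>r. c r *\<^sub>R u r)"
      by (rule integral_spike[OF neg]) (use wc that in auto)
    moreover have "u t - u a = integral {a..t} w"
      using that ab by (intro primitive_onD(3)[OF prim]) auto
    ultimately show ?thesis by (metis add.commute diff_add_cancel)
  qed
  have "((\<lambda>t. u a + integral {a..t} (\<lambda>r. c r *\<^sub>R u r)) has_vector_derivative 0 + c r *\<^sub>R u r) (at r within {a..b})"
    by (rule has_vector_derivative_add[OF has_vector_derivative_const integral_has_vector_derivative[OF cu]]) (use ab in auto)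
  then have "((\<lambda>t. u a + integral {a..t} (\<lambda>r. c r *\<^sub>R u r)) has_vector_derivative c r *\<^sub>R u r) (at r)"
    using ab by (subst (asm) at_within_interior) auto
  then have "(u has_vector_derivative c r *\<^sub>R u r) (at r)"
  proof (rule has_vector_derivative_transform_within_open)
    show "open {a<..<b}" "r \<in> {a<..<b}" using ab by auto
    show "u a + integral {a..t} (\<lambda>r. c r *\<^sub>R u r) = u t" if "t \<in> {a<..<b}" for t
      by (intro ut[symmetric]) (use that in auto)
  qed
  then show ?thesis by (simp add: c_def)
qed

lemma rho_derivative:
  assumes "r > 0" and ode: "(u has_vector_derivative (- (1 + \<sigma> * slope M (rho r)) / (2 * r)) *\<^sub>R u r) (at r)"
  shows "(rho has_real_derivative - (\<sigma> * (rho r * slope M (rho r) / r))) (at r)"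
proof -
  define k where "k = - (1 + \<sigma> * slope M (rho r)) / (2 * r)"
  have "((\<lambda>r. u r \<bullet> u r) has_vector_derivative (u r \<bullet> (k *\<^sub>R u r) + (k *\<^sub>R u r) \<bullet> u r)) (at r)"
    using bounded_bilinear.has_vector_derivative[OF bounded_bilinear_inner ode ode] by (simp only: k_def)
  moreover have "u r \<bullet> (k *\<^sub>R u r) + (k *\<^sub>R u r) \<bullet> u r = (- (1 + \<sigma> * slope M (rho r)) / r) * (u r \<bullet> u r)"
  proof -
    have "2 * (x / (2 * r)) = x / r" for x by simp
    then have "2 * k = - (1 + \<sigma> * slope M (rho r)) / r" by (simp only: k_def)
    then have "(2 * k) * (u r \<bullet> u r) = (- (1 + \<sigma> * slope M (rho r)) / r) * (u r \<bullet> u r)" by (simp only:)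
    then show ?thesis by simp
  qed
  ultimately have d: "((\<lambda>r. u r \<bullet> u r) has_real_derivative (- (1 + \<sigma> * slope M (rho r)) / r) * (u r \<bullet> u r)) (at r)"
    by (simp only: has_real_derivative_iff_has_vector_derivative)
  have "((\<lambda>r. r * (u r \<bullet> u r)) has_real_derivative 1 * (u r \<bullet> u r) + (- (1 + \<sigma> * slope M (rho r)) / r) * (u r \<bullet> u r) * r) (at r)"
    by (rule DERIV_mult[OF DERIV_ident d])
  moreover have "1 * (u r \<bullet> u r) + (- (1 + \<sigma> * slope M (rho r)) / r) * (u r \<bullet> u r) * r = - (\<sigma> * (rho r * slope M (rho r) / r))"
    using \<open>r > 0\<close> by (simp add: rho_def power2_norm_eq_inner field_simps)
  ultimately show ?thesis by (simp add: rho_def[abs_def] power2_norm_eq_inner)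
qed

text \<open>Equality forces \<open>mass = pi / 2 * M ^ 3\<close> and makes all squares vanish. The
  equation still permits a plateau \<open>rho = M\<close> on some \<open>{c..b}\<close>. The two
  outer pieces of the profile already carry \<open>pi / 4 * M ^ 3\<close> each and the plateau adds
  \<open>M ^ 3 * (ln b - ln c)\<close>, so \<open>b = c\<close>.\<close>

lemma bliss_equality:
  assumes eq: "energy ^ 3 = 27 * pi\<^sup>2 / 256 * mass" and nz: "\<not> (\<forall>r>0. u r = 0)"
  obtains b M e where "b > 0" "M > 0" "norm e = 1" "energy = 3 * pi * M / 8"
    "\<And>r. r > 0 \<Longrightarrow> u r = sqrt (2 * M * b / (r\<^sup>2 + b\<^sup>2)) *\<^sub>R e"
proof -
  obtain r0 where r0: "r0 > 0" "rho r0 > 0" "\<And>r. r > 0 \<Longrightarrow> rho r \<le> rho r0"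
    using rho_max[OF nz] by metis
  define M where "M = rho r0"
  have M: "M > 0" "\<And>r. r > 0 \<Longrightarrow> rho r \<le> M" using r0 by (auto simp: M_def)
  have elb: "energy \<ge> mass / (4 * M\<^sup>2) + 2 * (pi * M / 8)"
    by (rule energy_lower_bound[OF r0(1) M_def M])
  have "energy ^ 3 = 27 * (mass / (4 * M\<^sup>2)) * (pi * M / 8)\<^sup>2"
    unfolding eq using M by (simp add: power2_eq_square)
  from amgm_cube(2)[OF _ _ elb this]
  have e1: "mass / (4 * M\<^sup>2) = pi * M / 8" and e2: "energy = 3 * (pi * M / 8)"
    using mass_nonneg M by auto
  have mass: "mass = pi / 2 * M ^ 3" using e1 M by (simp add: field_simps power2_eq_square power3_eq_cube)
  have di: "defect \<sigma> M absolutely_integrable_on {a..b}" if "\<sigma>\<^sup>2 = 1" "0 < a" for \<sigma> a b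
    by (rule energy_gap(2)[OF r0(1) M_def M that])
  have nn: "integral {a..b} (defect \<sigma> M) \<ge> 0" if "\<sigma>\<^sup>2 = 1" "0 < a" for \<sigma> a b
    using di[OF that] by (intro integral_nonneg) (auto simp: defect_nonneg absolutely_integrable_on_def)
  have D: "integral {a..r0} (defect (-1) M) = 0" "integral {r0..b} (defect 1 M) = 0" if "0 < a" "a \<le> r0" "r0 \<le> b" for a b
  proof -
    have "integral {a..r0} (defect (-1) M) + integral {r0..b} (defect 1 M) \<le> energy - mass / (4 * M\<^sup>2) - pi * M / 4"
      by (rule energy_gap(1)[OF r0(1) M_def M that])
    also have "\<dots> = 0" unfolding e1 e2 by simp
    finally show "integral {a..r0} (defect (-1) M) = 0" "integral {r0..b} (defect 1 M) = 0"
      using nn[of "-1" a r0] nn[of 1 r0 b] r0(1) that by auto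
  qed
  have odeR: "(u has_vector_derivative (- (1 + 1 * slope M (rho r)) / (2 * r)) *\<^sub>R u r) (at r)" if "r0 < r" for r
    by (rule defect_zero_ode[OF M(1) di[OF _ r0(1)] D(2)[OF r0(1) order_refl] r0(1) that, of "r + 1"]) (use that in auto)
  have odeL: "(u has_vector_derivative (- (1 + (-1) * slope M (rho r)) / (2 * r)) *\<^sub>R u r) (at r)" if "0 < r" "r < r0" for r
    by (rule defect_zero_ode[OF M(1) di[of "-1" "r / 2"] D(1)[of "r / 2" r0], OF _ _ _ _ order_refl]) (use that in auto)
  have crho: "continuous_on A rho" if "A \<subseteq> {0<..}" for A by (rule continuous_on_subset[OF rho_cont that])
  have cc: "continuous_on A (\<lambda>r. - (1 + \<sigma> * slope M (rho r)) / (2 * r))" if "A \<subseteq> {0<..}" for A \<sigma>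
    using that by (intro continuous_intros continuous_on_compose2[OF slope_cont crho[OF that]]) auto
  \<comment> \<open>The linear equation keeps the direction fixed; starting from \<open>r0\<close>,
    it is integrated forwards on one side and inverted on the other.\<close>
  have par: "\<exists>p>0. u r = p *\<^sub>R u r0" if "r > 0" for r
  proof (cases "r \<ge> r0")
    case True
    have "u r = exp (integral {r0..r} (\<lambda>r. - (1 + 1 * slope M (rho r)) / (2 * r))) *\<^sub>R u r0"
      using True r0(1) odeR by (intro linear_ode[where b = r] cc continuous_on_subset[OF u_cont]) auto
    then show ?thesis using exp_gt_zero by blast
  next
    case False
    have "u r0 = exp (integral {r..r0} (\<lambda>r. - (1 + (-1) * slope M (rho r)) / (2 * r))) *\<^sub>R u r"
      using False that odeL by (intro linear_ode[where b = r0] cc continuous_on_subset[OF u_cont]) auto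
    then have "u r = exp (- integral {r..r0} (\<lambda>r. - (1 + (-1) * slope M (rho r)) / (2 * r))) *\<^sub>R u r0"
      by (simp add: exp_minus_inverse exp_add[symmetric])
    then show ?thesis using exp_gt_zero by blast
  qed
  have u0: "u r0 \<noteq> 0" using r0 by (auto simp: rho_def)
  define e where "e = (1 / norm (u r0)) *\<^sub>R u r0"
  have e: "norm e = 1" using u0 by (simp add: e_def)
  have ue: "u r = norm (u r) *\<^sub>R e" "u r \<noteq> 0" if r: "r > 0" for r
  proof -
    obtain p where p: "p > 0" "u r = p *\<^sub>R u r0" using par[OF r] by blast
    then show "u r \<noteq> 0" using u0 by simp
    show "u r = norm (u r) *\<^sub>R e" using p u0 by (simp add: e_def)
  qed
  have rpos: "rho r > 0" if "r > 0" for r using ue(2)[OF that] that by (simp add: rho_def)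
  obtain b where b: "r0 \<le> b" "\<And>r. r0 \<le> r \<Longrightarrow> r \<le> b \<Longrightarrow> rho r = M"
    "\<And>r. b \<le> r \<Longrightarrow> rho r = 2 * M / (r / b + b / r)"
  proof (rule profile_ode[OF r0(1), of rho M])
    show "continuous_on {r0..} rho" using r0(1) by (intro crho) auto
    show "(rho has_real_derivative - (rho r * slope M (rho r) / r)) (at r)" if "r0 < r" for r
      using rho_derivative[OF _ odeR[OF that]] r0(1) that by simp
    show "rho r0 = M" by (simp add: M_def)
    show "0 < rho r \<and> rho r \<le> M" if "r0 \<le> r" for r
      using rpos[of r] M(2)[of r] that r0(1) by simp
    show "(rho \<longlongrightarrow> 0) at_top" by (rule rho_tendsto(3))
  qed (rule that; assumption)
  obtain c where c: "0 < c" "c \<le> r0" "\<And>r. c \<le> r \<Longrightarrow> r \<le> r0 \<Longrightarrow> rho r = M"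
    "\<And>r. 0 < r \<Longrightarrow> r \<le> c \<Longrightarrow> rho r = 2 * M / (r / c + c / r)"
  proof -
    \<comment> \<open>The inversion of \<open>r\<close> to \<open>1 / r\<close> turns the equation
      left of \<open>r0\<close> into the one on the right, so the same lemma describes both
      sides.\<close>
    obtain d where d: "1 / r0 \<le> d" "\<And>r. 1 / r0 \<le> r \<Longrightarrow> r \<le> d \<Longrightarrow> rho (1 / r) = M"
      "\<And>r. d \<le> r \<Longrightarrow> rho (1 / r) = 2 * M / (r / d + d / r)"
    proof (rule profile_ode[of "1 / r0" "\<lambda>r. rho (1 / r)" M])
      show "0 < 1 / r0" using r0 by simp
      have "x > 0" if "1 / r0 \<le> x" for x using that r0(1) by (meson divide_pos_pos less_le_trans zero_less_one)
      note pos = this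
      show "continuous_on {1 / r0..} (\<lambda>r. rho (1 / r))"
      proof (rule continuous_on_compose2[OF rho_cont])
        show "continuous_on {1 / r0..} (\<lambda>r. 1 / r)" using pos by (intro continuous_intros) force
        show "(\<lambda>r. 1 / r) ` {1 / r0..} \<subseteq> {0<..}" using pos by auto
      qed
      show "rho (1 / (1 / r0)) = M" by (simp add: M_def)
      show "0 < rho (1 / r) \<and> rho (1 / r) \<le> M" if "1 / r0 \<le> r" for r
        using rpos M(2) pos[OF that] by simp
      show "((\<lambda>r. rho (1 / r)) \<longlongrightarrow> 0) at_top"
      proof (rule tendstoI)
        fix \<epsilon> :: real assume "\<epsilon> > 0"
        then obtain R where R: "R > 0" "\<And>r. 0 < r \<Longrightarrow> r \<le> R \<Longrightarrow> rho r \<le> \<epsilon> / 2"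
          using rho_small_at_zero[of "\<epsilon> / 2"] by auto
        have "dist (rho (1 / r)) 0 < \<epsilon>" if "r \<ge> 1 / R" for r
        proof -
          have "r > 0" using that R(1) by (meson divide_pos_pos less_le_trans zero_less_one)
          then have "0 < 1 / r" "1 / r \<le> R" using that R(1) by (auto simp: field_simps)
          then show ?thesis using R(2)[of "1 / r"] rho_nonneg[of "1 / r"] \<open>\<epsilon> > 0\<close> by (simp add: dist_real_def)
        qed
        then show "\<forall>\<^sub>F r in at_top. dist (rho (1 / r)) 0 < \<epsilon>" by (auto simp: eventually_at_top_linorder)
      qed
      fix r assume r: "1 / r0 < r"
      have "r > 0" using pos r by simp
      have lt: "0 < 1 / r" "1 / r < r0" using r \<open>r > 0\<close> r0(1) by (auto simp: field_simps)
      have "((\<lambda>r. 1 / r) has_real_derivative - (1 / r\<^sup>2)) (at r)"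
        using \<open>r > 0\<close> by (auto intro!: derivative_eq_intros simp: power2_eq_square)
      from DERIV_chain2[OF rho_derivative[OF lt(1) odeL[OF lt]] this]
      show "((\<lambda>r. rho (1 / r)) has_real_derivative - (rho (1 / r) * slope M (rho (1 / r)) / r)) (at r)"
        using \<open>r > 0\<close> by (simp add: power2_eq_square)
    qed (rule that; assumption)
    have dp: "d > 0" using d(1) r0(1) by (meson divide_pos_pos less_le_trans zero_less_one)
    show ?thesis
    proof (rule that[of "1 / d"])
      show "0 < 1 / d" "1 / d \<le> r0" using dp d(1) r0(1) by (auto simp: field_simps)
      show "rho r = M" if "1 / d \<le> r" "r \<le> r0" for r
      proof -
        have "r > 0" using that dp by (meson divide_pos_pos less_le_trans zero_less_one)
        then show ?thesis using d(2)[of "1 / r"] that dp r0(1) by (simp add: field_simps)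
      qed
      show "rho r = 2 * M / (r / (1 / d) + 1 / d / r)" if "0 < r" "r \<le> 1 / d" for r
        using d(3)[of "1 / r"] that dp by (simp add: field_simps)
    qed
  qed
  have bp: "b > 0" "c \<le> b" using b(1) c r0(1) by auto
  define G where "G b r = M ^ 3 * (arctan (r / b) + (r / b) * ((r / b)\<^sup>2 - 1) / (1 + (r / b)\<^sup>2)\<^sup>2)" for b r :: real
  \<comment> \<open>Inner piece, plateau and outer piece of the mass, computed exactly on
    \<open>{1/n..n}\<close>; the total cannot exceed the mass.\<close>
  have lower: "(G c c - G c (1 / real (Suc n))) + M ^ 3 * (ln b - ln c) + (G b (real (Suc n)) - G b b) \<le> mass"
    if n: "1 / real (Suc n) \<le> c" "b \<le> real (Suc n)" for n
  proof -
    have p: "0 < 1 / real (Suc n)" by simp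
    have 1: "((\<lambda>r. rho r ^ 3 / r) has_integral G c c - G c (1 / real (Suc n))) {1 / real (Suc n)..c}"
    proof (rule has_integral_eq[rotated])
      show "((\<lambda>r. (2 * M / (r / c + c / r)) ^ 3 / r) has_integral G c c - G c (1 / real (Suc n))) {1 / real (Suc n)..c}"
        unfolding G_def using c(1) p n(1) by (rule profile_cube_integral)
      show "(2 * M / (r / c + c / r)) ^ 3 / r = rho r ^ 3 / r" if "r \<in> {1 / real (Suc n)..c}" for r
        using c(4)[of r] that less_le_trans[OF p, of r] by simp
    qed
    have "((\<lambda>r. M ^ 3 * inverse r) has_integral M ^ 3 * (ln b - ln c)) {c..b}"
      using bp c(1) by (intro has_integral_mult_right fundamental_theorem_of_calculus)
        (auto simp: has_real_derivative_iff_has_vector_derivative[symmetric] inverse_eq_divide intro!: derivative_eq_intros)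
    then have 2: "((\<lambda>r. rho r ^ 3 / r) has_integral M ^ 3 * (ln b - ln c)) {c..b}"
    proof (rule has_integral_eq[rotated])
      show "M ^ 3 * inverse r = rho r ^ 3 / r" if "r \<in> {c..b}" for r
      proof -
        have "rho r = M" using b(2)[of r] c(3)[of r] that by (cases "r \<le> r0") auto
        then show ?thesis by (simp add: divide_inverse)
      qed
    qed
    have 3: "((\<lambda>r. rho r ^ 3 / r) has_integral G b (real (Suc n)) - G b b) {b..real (Suc n)}"
    proof (rule has_integral_eq[rotated])
      show "((\<lambda>r. (2 * M / (r / b + b / r)) ^ 3 / r) has_integral G b (real (Suc n)) - G b b) {b..real (Suc n)}"
        unfolding G_def using bp(1) bp(1) n(2) by (rule profile_cube_integral)
    qed (use b(3) in auto)
    have "((\<lambda>r. rho r ^ 3 / r) has_integral (G c c - G c (1 / real (Suc n))) + M ^ 3 * (ln b - ln c) + (G b (real (Suc n)) - G b b)) {1 / real (Suc n)..real (Suc n)}"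
      using has_integral_combine[OF _ n(2) has_integral_combine[OF n(1) bp(2) 1 2] 3] n(1) bp(2) by simp
    then have "((\<lambda>r. r\<^sup>2 * norm (u r) ^ 6) has_integral (G c c - G c (1 / real (Suc n))) + M ^ 3 * (ln b - ln c) + (G b (real (Suc n)) - G b b)) {1 / real (Suc n)..real (Suc n)}"
      by (rule has_integral_eq[rotated]) (use rho_cube less_le_trans[OF p] in auto)
    then show ?thesis
      using half_line_integral(3)[OF int6 _ p, of "real (Suc n)"] by (simp add: mass_def integral_unique)
  qed
  have "M ^ 3 * (ln b - ln c) \<le> 0"
  proof -
    have "(\<lambda>n. G c (1 / real (Suc n))) \<longlonglongrightarrow> 0" unfolding G_def using c(1) by real_asymp
    moreover have "(\<lambda>n. G b (real (Suc n))) \<longlonglongrightarrow> M ^ 3 * (pi / 2)"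
    proof -
      have "(\<lambda>n. arctan (real (Suc n) / b) + (real (Suc n) / b) * ((real (Suc n) / b)\<^sup>2 - 1) / (1 + (real (Suc n) / b)\<^sup>2)\<^sup>2) \<longlonglongrightarrow> pi / 2"
        using bp(1) by real_asymp
      then show ?thesis unfolding G_def by (intro tendsto_mult tendsto_const)
    qed
    ultimately have lim: "(\<lambda>n. (G c c - G c (1 / real (Suc n))) + M ^ 3 * (ln b - ln c) + (G b (real (Suc n)) - G b b))
      \<longlonglongrightarrow> (G c c - 0) + M ^ 3 * (ln b - ln c) + (M ^ 3 * (pi / 2) - G b b)"
      by (intro tendsto_intros)
    have "\<forall>\<^sub>F n in sequentially. 1 / real (Suc n) \<le> c" "\<forall>\<^sub>F n in sequentially. b \<le> real (Suc n)"
      using c(1) by real_asymp+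
    then have "\<forall>\<^sub>F n in sequentially. (G c c - G c (1 / real (Suc n))) + M ^ 3 * (ln b - ln c) + (G b (real (Suc n)) - G b b) \<le> mass"
      by eventually_elim (rule lower)
    from tendsto_upperbound[OF lim this]
    have "(G c c - 0) + M ^ 3 * (ln b - ln c) + (M ^ 3 * (pi / 2) - G b b) \<le> mass" by simp
    moreover have "G c c = M ^ 3 * (pi / 4)" "G b b = M ^ 3 * (pi / 4)" using c(1) bp(1) by (simp_all add: G_def)
    ultimately show ?thesis unfolding mass by (simp add: algebra_simps)
  qed
  then have "ln b \<le> ln c" using M(1) by (simp add: mult_le_0_iff)
  then have bc: "b = c" using bp c(1) by simp
  have "rho r = 2 * M / (r / b + b / r)" if "r > 0" for r
    using b(3)[of r] c(4)[of r] that bc by (cases "r \<le> b") auto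
  note prof = this
  have "u r = sqrt (2 * M * b / (r\<^sup>2 + b\<^sup>2)) *\<^sub>R e" if r: "r > 0" for r
  proof -
    have s: "r\<^sup>2 + b\<^sup>2 > 0" using r by (simp add: add_pos_nonneg)
    have "(norm (u r))\<^sup>2 = rho r / r" using r by (simp add: rho_def)
    also have "\<dots> = 2 * M / ((r\<^sup>2 + b\<^sup>2) / (r * b)) / r"
      unfolding prof[OF r] using r bp(1) by (simp add: add_divide_distrib power2_eq_square)
    also have "\<dots> = 2 * M * b / (r\<^sup>2 + b\<^sup>2)"
    proof -
      define q where "q = r\<^sup>2 + b\<^sup>2"
      have "q > 0" using s by (simp add: q_def)
      then show ?thesis unfolding q_def[symmetric] using r bp(1) by (simp add: field_simps)
    qed
    finally have "norm (u r) = sqrt (2 * M * b / (r\<^sup>2 + b\<^sup>2))"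
      by (metis norm_ge_zero real_sqrt_abs2 real_sqrt_unique)
    then show ?thesis using ue(1)[OF r] by metis
  qed
  then show ?thesis using that[of b M e] bp(1) M(1) e e2 by simp
qed

end

section \<open>Smooth functions as weak solutions\<close>

lemma continuous_loc_integrable:
  fixes g :: "'a::euclidean_space \<Rightarrow> 'b::euclidean_space"
  assumes "continuous_on UNIV g"
  shows "loc_integrable g"
  unfolding loc_integrable_def
proof (intro allI impI)
  fix K :: "'a set" assume "compact K"
  then have "integrable lborel (\<lambda>x. indicator K x *\<^sub>R g x)"
    using assms by (intro borel_integrable_compact) (auto intro: continuous_on_subset)
  then show "g absolutely_integrable_on K"
    by (simp add: set_integrable_def integrable_completion borel_measurable_integrable)
qed

lemma integral_by_parts:
  fixes \<phi> g :: "'a::euclidean_space \<Rightarrow> real"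
  assumes \<phi>: "test_fun \<phi>" and g: "Ck 1 g" and i: "i \<in> Basis"
  shows "(LINT x|lebesgue. partial i \<phi> x * g x) = - (LINT x|lebesgue. \<phi> x * partial i g x)"
proof -
  obtain K where K: "compact K" "\<And>x. x \<notin> K \<Longrightarrow> \<phi> x = 0" using test_funE[OF \<phi>] by metis
  have \<phi>1: "Ck 1 \<phi>" by (rule test_fun_Ck[OF \<phi>])
  have g': "continuous_on UNIV (partial i g)" "continuous_on UNIV g"
    using g i by (auto intro: Ck_continuous simp: differentiable_imp_continuous_on)
  have "((\<lambda>x. \<phi> x * g x) has_derivative (\<lambda>h. \<phi> x * partial h g x + partial h \<phi> x * g x)) (at x)" for x
    by (intro has_derivative_mult Ck_Suc_has_derivative[of 0]) (use \<phi>1 g in auto)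
  from partial_eq[OF this] have "partial i (\<lambda>x. \<phi> x * g x) x = \<phi> x * partial i g x + partial i \<phi> x * g x" for x .
  moreover have "(LINT x|lebesgue. partial i (\<lambda>x. \<phi> x * g x) x) = 0"
    by (rule integral_partial_eq_0[OF Ck_mult[OF \<phi>1 g] K(1) _ i]) (use K(2) in auto)
  ultimately have "(LINT x|lebesgue. \<phi> x * partial i g x + partial i \<phi> x * g x) = 0" by simp
  moreover have "integrable lebesgue (\<lambda>x. \<phi> x * partial i g x)" "integrable lebesgue (\<lambda>x. partial i \<phi> x * g x)"
    using integrable_test_fun_scaleR[OF \<phi> continuous_loc_integrable[OF g'(1)]]
      integrable_test_fun_scaleR[OF test_fun_partial[OF \<phi> i] continuous_loc_integrable[OF g'(2)]] by simp_all
  ultimately show ?thesis by simp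
qed

lemma lebesgue_integral_scaleR_left:
  fixes f :: "'a::euclidean_space \<Rightarrow> real" and \<omega> :: "'b::euclidean_space"
  assumes "integrable lebesgue f"
  shows "(LINT x|lebesgue. f x *\<^sub>R \<omega>) = (LINT x|lebesgue. f x) *\<^sub>R \<omega>"
  using assms by simp

lemma smooth_has_weak_partial:
  fixes g :: "'a::euclidean_space \<Rightarrow> real" and \<omega> :: "'b::euclidean_space"
  assumes g: "Ck 1 g" and i: "i \<in> Basis"
  shows "has_weak_partial i (\<lambda>x. g x *\<^sub>R \<omega>) (\<lambda>x. partial i g x *\<^sub>R \<omega>)"
proof -
  have c: "continuous_on UNIV (partial i g)" "continuous_on UNIV g"
    using g i by (auto intro: Ck_continuous simp: differentiable_imp_continuous_on)
  show ?thesis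
    unfolding has_weak_partial_def
  proof (intro conjI allI impI continuous_loc_integrable)
    show "continuous_on UNIV (\<lambda>x. g x *\<^sub>R \<omega>)" "continuous_on UNIV (\<lambda>x. partial i g x *\<^sub>R \<omega>)"
      by (intro continuous_intros c)+
    fix \<phi> :: "'a \<Rightarrow> real" assume \<phi>: "test_fun \<phi>"
    have i1: "integrable lebesgue (\<lambda>x. partial i \<phi> x * g x)" "integrable lebesgue (\<lambda>x. \<phi> x * partial i g x)"
      using integrable_test_fun_scaleR[OF \<phi> continuous_loc_integrable[OF c(1)]]
        integrable_test_fun_scaleR[OF test_fun_partial[OF \<phi> i] continuous_loc_integrable[OF c(2)]] by simp_all
    show "(LINT x|lebesgue. partial i \<phi> x *\<^sub>R g x *\<^sub>R \<omega>) = - (LINT x|lebesgue. \<phi> x *\<^sub>R partial i g x *\<^sub>R \<omega>)"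
      using lebesgue_integral_scaleR_left[OF i1(1), of \<omega>] lebesgue_integral_scaleR_left[OF i1(2), of \<omega>] integral_by_parts[OF \<phi> g i]
      by simp
  qed
qed

lemma smooth_has_weak_laplacian:
  fixes g :: "'a::euclidean_space \<Rightarrow> real" and \<omega> :: "'b::euclidean_space"
  assumes g: "Ck 2 g"
  shows "has_weak_laplacian (\<lambda>x. g x *\<^sub>R \<omega>) (\<lambda>x. laplacian g x *\<^sub>R \<omega>)"
proof -
  have g1: "Ck 1 g" and gi: "Ck 1 (partial i g)" if "i \<in> Basis" for i
    using g that Ck_SucD[of 1 g] by (auto simp: numeral_2_eq_2 simp del: Ck.simps intro: Ck_Suc_partial)
  have cg: "continuous_on UNIV g" using Ck_continuous[OF g] .
  have cgi: "continuous_on UNIV (partial i (partial i g))" if "i \<in> Basis" for i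
    using Ck_continuous[OF Ck_Suc_partial[of 0]] gi[OF that] that by simp
  show ?thesis
    unfolding has_weak_laplacian_def
  proof (intro conjI allI impI continuous_loc_integrable)
    show "continuous_on UNIV (\<lambda>x. g x *\<^sub>R \<omega>)" by (intro continuous_intros cg)
    show "continuous_on UNIV (\<lambda>x. laplacian g x *\<^sub>R \<omega>)"
      unfolding laplacian_def by (intro continuous_intros cgi)
    fix \<phi> :: "'a \<Rightarrow> real" assume \<phi>: "test_fun \<phi>"
    have eq: "(LINT x|lebesgue. partial i (partial i \<phi>) x * g x) = (LINT x|lebesgue. \<phi> x * partial i (partial i g) x)" if i: "i \<in> Basis" for i
      using integral_by_parts[OF test_fun_partial[OF \<phi> i] g1[OF i] i] integral_by_parts[OF \<phi> gi[OF i] i] by simp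
    have i1: "integrable lebesgue (\<lambda>x. partial i (partial i \<phi>) x * g x)" "integrable lebesgue (\<lambda>x. \<phi> x * partial i (partial i g) x)" if i: "i \<in> Basis" for i
      using integrable_test_fun_scaleR[OF \<phi> continuous_loc_integrable[OF cgi[OF i]]]
        integrable_test_fun_scaleR[OF test_fun_partial[OF test_fun_partial[OF \<phi> i] i] continuous_loc_integrable[OF cg]] by simp_all
    have "(LINT x|lebesgue. laplacian \<phi> x * g x) = (LINT x|lebesgue. \<phi> x * laplacian g x)"
      unfolding laplacian_def sum_distrib_left sum_distrib_right using i1 eq
      by (simp add: Bochner_Integration.integral_sum)
    moreover have "integrable lebesgue (\<lambda>x. laplacian \<phi> x * g x)" "integrable lebesgue (\<lambda>x. \<phi> x * laplacian g x)"
      unfolding laplacian_def sum_distrib_left sum_distrib_right using i1 by (auto intro!: Bochner_Integration.integrable_sum)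
    ultimately show "(LINT x|lebesgue. laplacian \<phi> x *\<^sub>R g x *\<^sub>R \<omega>) = (LINT x|lebesgue. \<phi> x *\<^sub>R laplacian g x *\<^sub>R \<omega>)"
      using lebesgue_integral_scaleR_left[of "\<lambda>x. laplacian \<phi> x * g x" \<omega>] lebesgue_integral_scaleR_left[of "\<lambda>x. \<phi> x * laplacian g x" \<omega>] by simp
  qed
qed

section \<open>The Talenti function\<close>

text \<open>All real powers of the base of \<open>W\<close> at once: up to polynomial factors the
  family is closed under differentiation, which makes smoothness an induction over all
  exponents.\<close>

definition Wpow :: "real \<Rightarrow> 'a::euclidean_space \<Rightarrow> real" where
  "Wpow p x = (1 + (norm x)\<^sup>2 / 3) powr p"

lemma W_eq: "W = Wpow (- 1 / 2)"
  by (auto simp: W_def Wpow_def)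

lemma base_pos: "1 + (norm x)\<^sup>2 / 3 > 0"
  by (simp add: add_pos_nonneg)

lemma Wpow_pos: "Wpow p x > 0"
  unfolding Wpow_def using base_pos[of x] by simp

lemma Wpow_power: "Wpow p x ^ n = Wpow (p * real n) x"
  unfolding Wpow_def using base_pos[of x] by (simp add: powr_powr[symmetric] powr_realpow)

lemma Wpow_has_derivative:
  "(Wpow p has_derivative (\<lambda>h. (2 * p / 3) * Wpow (p - 1) x * (x \<bullet> h))) (at x)"
proof -
  have d: "((\<lambda>x. 1 + (norm x)\<^sup>2 / 3) has_derivative (\<lambda>h. 2 / 3 * (x \<bullet> h))) (at x)"
    unfolding power2_norm_eq_inner by (auto intro!: derivative_eq_intros simp: inner_commute)
  have "((\<lambda>s. s powr p) has_real_derivative p * (1 + (norm x)\<^sup>2 / 3) powr (p - 1)) (at (1 + (norm x)\<^sup>2 / 3))"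
    using base_pos[of x] by (intro has_real_derivative_powr) 
  from has_derivative_compose[OF d this[unfolded has_field_derivative_def]]
  show ?thesis by (simp add: Wpow_def[abs_def] algebra_simps)
qed

lemma partial_Wpow: "partial i (Wpow p) x = (2 * p / 3) * Wpow (p - 1) x * (x \<bullet> i)"
  by (rule partial_eq[OF Wpow_has_derivative])

lemma Ck_Wpow: "Ck k (Wpow p)"
proof (induction k arbitrary: p)
  case 0
  show ?case unfolding Ck.simps
    by (rule continuous_at_imp_continuous_on, rule ballI, rule has_derivative_continuous[OF Wpow_has_derivative])
next
  case (Suc k)
  show ?case
    by (rule Ck_SucI[OF Wpow_has_derivative]) (intro Ck_mult Ck_const Suc Ck_inner_left)
qed

text \<open>Two derivatives give
  \<open>- Wpow (- 3/2) x + (norm x)\<^sup>2 / 3 * Wpow (- 5/2) x\<close>, the sum over three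
  coordinates cancelling the factor 1/3. Taking out the lower power leaves only the exponent
  \<open>- 5/2\<close>, which is the fifth power of \<open>W\<close>.\<close>

lemma laplacian_W: "laplacian W x = - (W x ^ 5)"
proof -
  have "partial i (partial i W) x = - (1 / 3) * (Wpow (- 3 / 2) x + (x \<bullet> i) * (- Wpow (- 5 / 2) x * (x \<bullet> i)))"
    if i: "i \<in> Basis" for i
  proof -
    have "partial i W = (\<lambda>x. - (1 / 3) * (Wpow (- 3 / 2) x * (x \<bullet> i)))"
      unfolding W_eq by (auto simp: partial_Wpow)
    moreover have d: "((\<lambda>x. - (1 / 3) * (Wpow (- 3 / 2) x * (x \<bullet> i))) has_derivative
       (\<lambda>h. - (1 / 3) * (Wpow (- 3 / 2) x * (h \<bullet> i) + ((2 * (- 3 / 2) / 3) * Wpow (- 3 / 2 - 1) x * (x \<bullet> h)) * (x \<bullet> i)))) (at x)"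
      by (intro has_derivative_mult_right has_derivative_mult Wpow_has_derivative bounded_linear_imp_has_derivative bounded_linear_inner_left)
    ultimately have "partial i (partial i W) x = - (1 / 3) * (Wpow (- 3 / 2) x * (i \<bullet> i) + ((2 * (- 3 / 2) / 3) * Wpow (- 3 / 2 - 1) x * (x \<bullet> i)) * (x \<bullet> i))"
      using partial_eq[OF d] by simp
    then show ?thesis using i by (simp add: inner_same_Basis algebra_simps)
  qed
  then have "laplacian W x = (\<Sum>i\<in>Basis. - (1 / 3) * (Wpow (- 3 / 2) x + (x \<bullet> i) * (- Wpow (- 5 / 2) x * (x \<bullet> i))))"
    unfolding laplacian_def by (intro sum.cong) auto
  also have "\<dots> = (\<Sum>i\<in>(Basis :: (real^3) set). - (1 / 3) * Wpow (- 3 / 2) x + (1 / 3) * Wpow (- 5 / 2) x * ((x \<bullet> i) * (x \<bullet> i)))"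
    by (intro sum.cong) (auto simp: algebra_simps)
  also have "\<dots> = - Wpow (- 3 / 2) x + (1 / 3) * Wpow (- 5 / 2) x * (x \<bullet> x)"
    unfolding sum.distrib sum_distrib_left[symmetric] euclidean_inner[of x x] by simp
  also have "Wpow (- 3 / 2) x = Wpow (- 5 / 2) x * (1 + (norm x)\<^sup>2 / 3)"
    using powr_add[of "1 + (norm x)\<^sup>2 / 3" "- 5 / 2" 1] base_pos[of x] by (simp add: Wpow_def)
  also have "- (Wpow (- 5 / 2) x * (1 + (norm x)\<^sup>2 / 3)) + (1 / 3) * Wpow (- 5 / 2) x * (x \<bullet> x) = - Wpow (- 5 / 2) x"
    by (simp add: power2_norm_eq_inner algebra_simps)
  also have "Wpow (- 5 / 2) x = W x ^ 5" by (simp add: W_eq Wpow_power)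
  finally show ?thesis .
qed

text \<open>Nonnegativity makes the antiderivative monotone, so a finite limit at infinity already
  yields integrability.\<close>

lemma half_line_FTC:
  fixes f F :: "real \<Rightarrow> real"
  assumes [measurable]: "f \<in> borel_measurable borel" and F: "\<And>x. 0 \<le> x \<Longrightarrow> (F has_real_derivative f x) (at x)"
    and nn: "\<And>x. 0 \<le> x \<Longrightarrow> 0 \<le> f x" and lim: "(F \<longlongrightarrow> T) at_top"
  shows "set_integrable lborel {0<..} f" "(LINT r:{0<..}|lborel. f r) = T - F 0"
proof -
  have ae: "AE r in lborel. indicator {0<..} r *\<^sub>R f r = indicator {0..} r * f r"
    using AE_lborel_singleton[of "0::real"] by eventually_elim (auto simp: indicator_def)
  have nni: "(\<integral>\<^sup>+r. ennreal (indicator {0..} r * f r) \<partial>lborel) = ennreal (T - F 0)"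
  proof -
    have "(\<integral>\<^sup>+r. ennreal (indicator {0..} r * f r) \<partial>lborel) = (\<integral>\<^sup>+r. ennreal (f r) * indicator {0..} r \<partial>lborel)"
      by (intro nn_integral_cong) (simp add: indicator_def)
    also have "\<dots> = ennreal (T - F 0)"
      by (rule nn_integral_FTC_atLeast[OF assms(1) F nn lim])
    finally show ?thesis .
  qed
  have "F 0 \<le> F x" if "0 \<le> x" for x
    by (rule DERIV_nonneg_imp_nondecreasing[OF that]) (use F nn in blast)
  then have "\<forall>\<^sub>F x in at_top. F 0 \<le> F x"
    unfolding eventually_at_top_linorder by blast
  then have T: "F 0 \<le> T" by (intro tendsto_lowerbound[OF lim]) auto
  have nnn: "0 \<le> indicator {0..} r * f r" for r using nn by (auto simp: indicator_def)
  have i: "integrable lborel (\<lambda>r. indicator {0..} r * f r)"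
    by (rule integrableI_nonneg) (use nni nnn in auto)
  have v: "(LINT r|lborel. indicator {0..} r * f r) = T - F 0"
    using nn_integral_eq_integral[OF i] nni nnn T by (auto simp: integral_eq_nn_integral)
  have m: "(\<lambda>r. indicator {0<..} r *\<^sub>R f r) \<in> borel_measurable lborel" "(\<lambda>r. indicator {0..} r * f r) \<in> borel_measurable lborel"
    by measurable
  show "set_integrable lborel {0<..} f"
    unfolding set_integrable_def using integrable_cong_AE[OF m ae] i by simp
  show "(LINT r:{0<..}|lborel. f r) = T - F 0"
    unfolding set_lebesgue_integral_def using integral_cong_AE[OF m ae] v by simp
qed

text \<open>The area of the unit sphere in three-space, the factor between integrals over space and
  radial integrals with weight \<open>r\<^sup>2\<close>.\<close>

definition kappa :: real where "kappa = 3 * unit_ball_vol 3"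

lemma kappa_pos: "kappa > 0" by (simp add: kappa_def)

lemma radius_density_3: "radius_density TYPE(real^3) r = kappa * (indicator {0<..} r * r\<^sup>2)"
  by (simp add: radius_density_def kappa_def)

lemma radius_density_integral_3:
  fixes h :: "real \<Rightarrow> real"
  shows "integrable lborel (\<lambda>r. radius_density TYPE(real^3) r * h r) \<longleftrightarrow> set_integrable lborel {0<..} (\<lambda>r. r\<^sup>2 * h r)"
    "(LINT r|lborel. radius_density TYPE(real^3) r * h r) = kappa * (LINT r:{0<..}|lborel. r\<^sup>2 * h r)"
proof -
  have eq: "(\<lambda>r. radius_density TYPE(real^3) r * h r) = (\<lambda>r. kappa * (indicator {0<..} r *\<^sub>R (r\<^sup>2 * h r)))"
    by (simp add: radius_density_3 mult_ac)
  show "integrable lborel (\<lambda>r. radius_density TYPE(real^3) r * h r) \<longleftrightarrow> set_integrable lborel {0<..} (\<lambda>r. r\<^sup>2 * h r)"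
    unfolding eq set_integrable_def using kappa_pos by (subst integrable_mult_left_iff) auto
  show "(LINT r|lborel. radius_density TYPE(real^3) r * h r) = kappa * (LINT r:{0<..}|lborel. r\<^sup>2 * h r)"
    unfolding eq set_lebesgue_integral_def by simp
qed

lemma real_radial_integral_3:
  fixes h :: "real \<Rightarrow> real"
  assumes "h \<in> borel_measurable borel"
  shows "integrable lebesgue (\<lambda>x::real^3. h (norm x)) \<longleftrightarrow> set_integrable lborel {0<..} (\<lambda>r. r\<^sup>2 * h r)"
    "(LINT x|lebesgue. h (norm (x::real^3))) = kappa * (LINT r:{0<..}|lborel. r\<^sup>2 * h r)"
proof -
  have [measurable]: "h \<in> borel_measurable borel" by fact
  have m: "(\<lambda>x::real^3. h (norm x)) \<in> borel_measurable lborel" by measurable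
  show "integrable lebesgue (\<lambda>x::real^3. h (norm x)) \<longleftrightarrow> set_integrable lborel {0<..} (\<lambda>r. r\<^sup>2 * h r)"
    using radial_integral(1)[OF assms, where 'a = "real^3"] radius_density_integral_3(1)[of h] integrable_completion[OF m] by simp
  show "(LINT x|lebesgue. h (norm (x::real^3))) = kappa * (LINT r:{0<..}|lborel. r\<^sup>2 * h r)"
    using radial_integral(2)[OF assms, where 'a = "real^3"] radius_density_integral_3(2)[of h] integral_completion[OF m] by simp
qed

text \<open>The common value of the radial mass and the radial energy of \<open>W\<close>. That they
  agree reflects the equation for \<open>W\<close> tested with \<open>W\<close> itself.\<close>

definition talenti :: real where "talenti = 3 * sqrt 3 * pi / 16"

lemma talenti_pos: "talenti > 0" by (simp add: talenti_def)

lemma W_integrals: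
  "set_integrable lborel {0<..} (\<lambda>r::real. r\<^sup>2 * (1 / (1 + r\<^sup>2 / 3) ^ 3))"
  "(LINT r:{0<..}|lborel. r\<^sup>2 * (1 / (1 + r\<^sup>2 / 3) ^ 3)) = talenti"
  "set_integrable lborel {0<..} (\<lambda>r::real. r\<^sup>2 * (r\<^sup>2 / 9 / (1 + r\<^sup>2 / 3) ^ 3))"
  "(LINT r:{0<..}|lborel. r\<^sup>2 * (r\<^sup>2 / 9 / (1 + r\<^sup>2 / 3) ^ 3)) = talenti"
proof -
  have r2: "(r / sqrt 3)\<^sup>2 = r\<^sup>2 / 3" for r :: real by (simp add: power_divide)
  have d: "((\<lambda>r. r / sqrt 3) has_real_derivative 1 / sqrt 3) (at r)" for r :: real
    by (rule DERIV_cdivide[OF DERIV_ident])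
  define F1 where "F1 t = (arctan t + t * (t\<^sup>2 - 1) / (1 + t\<^sup>2)\<^sup>2) / 8" for t :: real
  define F2 where "F2 t = (3 * arctan t - (5 * t ^ 3 + 3 * t) / (1 + t\<^sup>2)\<^sup>2) / 8" for t :: real
  have D1: "((\<lambda>r. 3 * sqrt 3 * F1 (r / sqrt 3)) has_real_derivative r\<^sup>2 * (1 / (1 + r\<^sup>2 / 3) ^ 3)) (at r)" for r
  proof -
    have "((\<lambda>r. 3 * sqrt 3 * F1 (r / sqrt 3)) has_real_derivative 3 * sqrt 3 * ((r / sqrt 3)\<^sup>2 / (1 + (r / sqrt 3)\<^sup>2) ^ 3 * (1 / sqrt 3))) (at r)"
      unfolding F1_def by (rule DERIV_cmult[OF DERIV_chain2[OF arctan_rational_DERIV(1) d]])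
    moreover have "3 * sqrt 3 * (y * (1 / sqrt 3)) = 3 * y" for y :: real
      by simp
    ultimately show ?thesis by (simp only: r2) simp
  qed
  have D2: "((\<lambda>r. sqrt 3 * F2 (r / sqrt 3)) has_real_derivative r\<^sup>2 * (r\<^sup>2 / 9 / (1 + r\<^sup>2 / 3) ^ 3)) (at r)" for r
  proof -
    have r4: "(r / sqrt 3) ^ 4 = r\<^sup>2 * (r\<^sup>2 / 9)"
    proof -
      have "(r / sqrt 3) ^ 4 = ((r / sqrt 3)\<^sup>2)\<^sup>2" by (simp flip: power_mult)
      also have "\<dots> = r\<^sup>2 * (r\<^sup>2 / 9)" unfolding r2 by (simp add: power2_eq_square)
      finally show ?thesis .
    qed
    have "((\<lambda>r. sqrt 3 * F2 (r / sqrt 3)) has_real_derivative sqrt 3 * ((r / sqrt 3) ^ 4 / (1 + (r / sqrt 3)\<^sup>2) ^ 3 * (1 / sqrt 3))) (at r)"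
      unfolding F2_def by (rule DERIV_cmult[OF DERIV_chain2[OF arctan_rational_DERIV(2) d]])
    then show ?thesis by (simp add: r2 r4)
  qed
  have "(F1 \<longlongrightarrow> pi / 2 / 8) at_top" unfolding F1_def by real_asymp
  moreover have sc: "filterlim (\<lambda>r. r / sqrt 3) at_top (at_top :: real filter)" by real_asymp
  ultimately have L1: "((\<lambda>r. 3 * sqrt 3 * F1 (r / sqrt 3)) \<longlongrightarrow> 3 * sqrt 3 * (pi / 2 / 8)) at_top"
    using filterlim_compose by (intro tendsto_mult tendsto_const) blast
  have "(F2 \<longlongrightarrow> 3 * (pi / 2) / 8) at_top" unfolding F2_def by real_asymp
  then have L2: "((\<lambda>r. sqrt 3 * F2 (r / sqrt 3)) \<longlongrightarrow> sqrt 3 * (3 * (pi / 2) / 8)) at_top"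
    using filterlim_compose sc by (intro tendsto_mult tendsto_const) blast
  have p: "1 + r\<^sup>2 / 3 \<ge> 0" for r :: real by (simp add: add_nonneg_nonneg)
  have I1: "set_integrable lborel {0<..} (\<lambda>r::real. r\<^sup>2 * (1 / (1 + r\<^sup>2 / 3) ^ 3))"
    "(LINT r:{0<..}|lborel. r\<^sup>2 * (1 / (1 + r\<^sup>2 / 3) ^ 3)) = 3 * sqrt 3 * (pi / 2 / 8) - 3 * sqrt 3 * F1 (0 / sqrt 3)"
    by (rule half_line_FTC[OF _ D1 _ L1]; (measurable | use p in simp))+
  have I2: "set_integrable lborel {0<..} (\<lambda>r::real. r\<^sup>2 * (r\<^sup>2 / 9 / (1 + r\<^sup>2 / 3) ^ 3))"
    "(LINT r:{0<..}|lborel. r\<^sup>2 * (r\<^sup>2 / 9 / (1 + r\<^sup>2 / 3) ^ 3)) = sqrt 3 * (3 * (pi / 2) / 8) - sqrt 3 * F2 (0 / sqrt 3)"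
    by (rule half_line_FTC[OF _ D2 _ L2]; (measurable | use p in simp))+
  show "set_integrable lborel {0<..} (\<lambda>r::real. r\<^sup>2 * (1 / (1 + r\<^sup>2 / 3) ^ 3))"
    "set_integrable lborel {0<..} (\<lambda>r::real. r\<^sup>2 * (r\<^sup>2 / 9 / (1 + r\<^sup>2 / 3) ^ 3))" by (fact I1(1) I2(1))+
  show "(LINT r:{0<..}|lborel. r\<^sup>2 * (1 / (1 + r\<^sup>2 / 3) ^ 3)) = talenti"
    "(LINT r:{0<..}|lborel. r\<^sup>2 * (r\<^sup>2 / 9 / (1 + r\<^sup>2 / 3) ^ 3)) = talenti"
    using I1(2) I2(2) by (simp_all add: F1_def F2_def talenti_def)
qed

lemma W_power_6: "W x ^ 6 = 1 / (1 + (norm x)\<^sup>2 / 3) ^ 3"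
proof -
  have "W x ^ 6 = (1 + (norm x)\<^sup>2 / 3) powr (- real 3)" by (simp add: W_eq Wpow_power) (simp add: Wpow_def)
  also have "\<dots> = 1 / (1 + (norm x)\<^sup>2 / 3) ^ 3"
    using base_pos[of x] by (subst powr_minus_divide, subst powr_realpow) auto
  finally show ?thesis .
qed

lemma W_gradient: "(\<Sum>i\<in>Basis. (partial i W x)\<^sup>2) = (norm x)\<^sup>2 / 9 / (1 + (norm x)\<^sup>2 / 3) ^ 3"
proof -
  have "(Wpow (- 3 / 2) x)\<^sup>2 = (1 + (norm x)\<^sup>2 / 3) powr (- real 3)" by (simp add: Wpow_power) (simp add: Wpow_def)
  also have "\<dots> = 1 / (1 + (norm x)\<^sup>2 / 3) ^ 3"
    using base_pos[of x] by (subst powr_minus_divide, subst powr_realpow) auto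
  finally have W3: "(Wpow (- 3 / 2) x)\<^sup>2 = 1 / (1 + (norm x)\<^sup>2 / 3) ^ 3" .
  have "(\<Sum>i\<in>Basis. (partial i W x)\<^sup>2) = (\<Sum>i\<in>Basis. (1 / 9) * (Wpow (- 3 / 2) x)\<^sup>2 * ((x \<bullet> i) * (x \<bullet> i)))"
    unfolding W_eq by (intro sum.cong) (auto simp: partial_Wpow power_mult_distrib power2_eq_square)
  also have "\<dots> = (1 / 9) * (Wpow (- 3 / 2) x)\<^sup>2 * (norm x)\<^sup>2"
    unfolding power2_norm_eq_inner[of x] by (subst euclidean_inner) (simp add: sum_distrib_left)
  finally show ?thesis unfolding W3 by simp
qed

section \<open>Radial functions of finite energy on three-space\<close>

text \<open>The three-dimensional form of \<open>radial_profile\<close>, with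
  \<open>weak_partial\<close> as gradient and the sphere area taken out of the integrals. That
  \<open>Q\<close> is nonzero reappears as positivity of the mass.\<close>

lemma H1dot_rad_nz_profile:
  fixes Q :: "real^3 \<Rightarrow> real^'m"
  assumes Q: "Q \<in> H1dot_rad_nz"
  obtains u w where "radial_energy u w" "w \<in> borel_measurable borel"
    "AE x in lebesgue. Q x = u (norm x)" "\<not> (\<forall>r>0. u r = 0)"
    "kappa * radial_energy.energy w \<le> dirichlet Q"
    "integrable lebesgue (\<lambda>x. norm (Q x) ^ 6)"
    "(LINT x|lebesgue. norm (Q x) ^ 6) = kappa * radial_energy.mass u"
    "radial_energy.mass u > 0"
    "\<And>i. i \<in> Basis \<Longrightarrow> has_weak_partial i Q (weak_partial i Q)"
    "\<And>\<psi> a b. (\<And>n. Ck n \<psi>) \<Longrightarrow> 0 < a \<Longrightarrow> (\<And>t. t \<notin> {a..b} \<Longrightarrow> \<psi> t = 0) \<Longrightarrow>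
      (LINT x|lebesgue. (\<Sum>i\<in>Basis. partial i (\<lambda>x. \<psi> (norm x)) x *\<^sub>R weak_partial i Q x))
       = kappa *\<^sub>R (LINT r|lborel. (indicator {0<..} r * r\<^sup>2 * partial 1 \<psi> r) *\<^sub>R w r)"
proof -
  have H: "Q \<in> borel_measurable lebesgue" "integrable lebesgue (\<lambda>x. norm (Q x) ^ 6)" "radial Q"
    "\<And>i. i \<in> Basis \<Longrightarrow> \<exists>v. has_weak_partial i Q v \<and> integrable lebesgue (\<lambda>x. (norm (v x))\<^sup>2)"
    and nz: "\<not> (AE x in lebesgue. Q x = 0)"
    using Q by (auto simp: H1dot_rad_nz_def H1dot_def)
  have wp: "has_weak_partial i Q (weak_partial i Q)" "integrable lebesgue (\<lambda>x. (norm (weak_partial i Q x))\<^sup>2)" if i: "i \<in> Basis" for i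
  proof -
    obtain v where v: "has_weak_partial i Q v" "integrable lebesgue (\<lambda>x. (norm (v x))\<^sup>2)" using H(4)[OF i] by auto
    show w: "has_weak_partial i Q (weak_partial i Q)" by (rule weak_partial_AE_eq(1)[OF v(1)])
    have m: "weak_partial i Q \<in> borel_measurable lebesgue"
      using w loc_integrable_measurable unfolding has_weak_partial_def by blast
    show "integrable lebesgue (\<lambda>x. (norm (weak_partial i Q x))\<^sup>2)"
    proof (rule integrable_cong_AE_imp[OF v(2)])
      show "AE x in lebesgue. (norm (v x))\<^sup>2 = (norm (weak_partial i Q x))\<^sup>2"
        using weak_partial_AE_eq(2)[OF v(1)] by eventually_elim simp
    qed (use m in measurable)
  qed
  obtain g0 where g0: "AE x in lebesgue. Q x = g0 (norm x)" using H(3) by (auto simp: radial_def)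
  obtain u w :: "real \<Rightarrow> real^'m" where uw: "primitive_on {0<..} u w"
    "AE x in lebesgue. Q x = u (norm x)"
    "integrable lborel (\<lambda>r. radius_density TYPE(real^3) r * norm (u r) ^ 6)"
    "integrable lborel (\<lambda>r. radius_density TYPE(real^3) r * (norm (w r))\<^sup>2)"
    "(LINT r|lborel. radius_density TYPE(real^3) r * (norm (w r))\<^sup>2) \<le> dirichlet Q"
    "w \<in> borel_measurable borel"
    and rest: "\<And>\<psi> a b. (\<And>n. Ck n \<psi>) \<Longrightarrow> 0 < a \<Longrightarrow> (\<And>t. t \<notin> {a..b} \<Longrightarrow> \<psi> t = 0) \<Longrightarrow>
      (LINT x|lebesgue. (\<Sum>i\<in>Basis. partial i (\<lambda>x. \<psi> (norm x)) x *\<^sub>R weak_partial i Q x))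
       = (LINT r|lborel. (radius_density TYPE(real^3) r * partial 1 \<psi> r) *\<^sub>R w r)"
  proof (rule radial_profile[OF H(1,2) g0, of "\<lambda>i. weak_partial i Q"])
    fix u w :: "real \<Rightarrow> real^'m"
    assume a: "primitive_on {0<..} u w" "w \<in> borel_measurable borel" "AE x in lebesgue. Q x = u (norm x)"
      "integrable lborel (\<lambda>r. radius_density TYPE(real^3) r * norm (u r) ^ 6)"
      "integrable lborel (\<lambda>r. radius_density TYPE(real^3) r * (norm (w r))\<^sup>2)"
      "(LINT r|lborel. radius_density TYPE(real^3) r * (norm (w r))\<^sup>2) \<le> dirichlet Q"
    assume r: "\<And>\<psi> a b. (\<And>n. Ck n \<psi>) \<Longrightarrow> 0 < a \<Longrightarrow> (\<And>t. t \<notin> {a..b} \<Longrightarrow> \<psi> t = 0) \<Longrightarrow>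
      (LINT x|lebesgue. (\<Sum>i\<in>Basis. partial i (\<lambda>x. \<psi> (norm x)) x *\<^sub>R weak_partial i Q x))
       = (LINT r|lborel. (radius_density TYPE(real^3) r * partial 1 \<psi> r) *\<^sub>R w r)"
    show thesis by (rule that[OF a(1,3,4,5,6,2)], rule r, assumption+)
  qed (use wp in auto)
  have re: "radial_energy u w"
    using uw(1,3,4) by unfold_locales (simp_all add: radius_density_integral_3)
  interpret radial_energy u w by fact
  have en: "kappa * energy \<le> dirichlet Q"
    using uw(5) by (simp add: radius_density_integral_3 energy_def)
  \<comment> \<open>Only the values of \<open>u\<close> at positive radii are controlled; cutting
    off elsewhere gives a Borel function on the line.\<close>
  define ut where "ut r = indicator {0<..} r *\<^sub>R u r" for r
  have mt: "ut \<in> borel_measurable borel"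
    unfolding ut_def[abs_def] using borel_measurable_continuous_on_indicator[OF _ u_cont] by simp
  have mt6: "(\<lambda>r. norm (ut r) ^ 6) \<in> borel_measurable borel"
    by (intro borel_measurable_power measurable_compose[OF mt borel_measurable_norm])
  have Q6: "(LINT x|lebesgue. norm (Q x) ^ 6) = kappa * mass"
  proof -
    have "AE x in lborel. (x :: real^3) \<noteq> 0" by (rule AE_lborel_singleton)
    then have "AE x in lborel. norm (Q x) ^ 6 = norm (ut (norm x)) ^ 6"
      using AE_lebesgue_imp_lborel[OF uw(2)] by eventually_elim (simp add: ut_def)
    moreover have "(\<lambda>x::real^3. norm (ut (norm x)) ^ 6) \<in> borel_measurable borel"
      by (rule measurable_compose[OF borel_measurable_norm mt6])
    ultimately have "(LINT x|lebesgue. norm (Q x) ^ 6) = (LINT x|lborel. norm (ut (norm (x::real^3))) ^ 6)"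
      by (rule lebesgue_integral_lborel_AE(2))
    also have "\<dots> = (LINT r|lborel. radius_density TYPE(real^3) r * norm (ut r) ^ 6)"
      using radial_integral(2)[OF mt6, where 'a = "real^3"] by simp
    also have "\<dots> = kappa * (LINT r:{0<..}|lborel. r\<^sup>2 * norm (ut r) ^ 6)"
      by (rule radius_density_integral_3)
    also have "(LINT r:{0<..}|lborel. r\<^sup>2 * norm (ut r) ^ 6) = mass"
      unfolding mass_def set_lebesgue_integral_def
      by (intro Bochner_Integration.integral_cong) (auto simp: ut_def indicator_def)
    finally show ?thesis .
  qed
  have Qpos: "mass > 0"
  proof (rule ccontr)
    assume "\<not> ?thesis"
    then have "mass = 0" using mass_nonneg by simp
    then have "(LINT x|lebesgue. norm (Q x) ^ 6) = 0" using Q6 by simp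
    then have "AE x in lebesgue. norm (Q x) ^ 6 = 0"
      using integral_nonneg_eq_0_iff_AE[OF H(2)] by simp
    then have "AE x in lebesgue. Q x = 0" by eventually_elim simp
    then show False using nz by simp
  qed
  have nzu: "\<not> (\<forall>r>0. u r = 0)"
  proof
    assume z: "\<forall>r>0. u r = 0"
    have "AE x in lborel. (x :: real^3) \<noteq> 0" by (rule AE_lborel_singleton)
    then have "AE x in lebesgue. (x :: real^3) \<noteq> 0" by (rule AE_completion)
    then have "AE x in lebesgue. Q x = 0" using uw(2) by eventually_elim (use z in simp)
    then show False using nz by simp
  qed
  have conv: "(LINT r|lborel. (radius_density TYPE(real^3) r * p r) *\<^sub>R w r)
     = kappa *\<^sub>R (LINT r|lborel. (indicator {0<..} r * r\<^sup>2 * p r) *\<^sub>R w r)" for p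
  proof -
    have "(\<lambda>r. (radius_density TYPE(real^3) r * p r) *\<^sub>R w r) = (\<lambda>r. kappa *\<^sub>R ((indicator {0<..} r * r\<^sup>2 * p r) *\<^sub>R w r))"
      by (simp add: radius_density_3 mult_ac)
    then show ?thesis by (simp only: Bochner_Integration.integral_scaleR_right)
  qed
  show ?thesis
  proof (rule that[OF re uw(6,2) nzu en H(2) Q6 Qpos wp(1)])
    fix \<psi> :: "real \<Rightarrow> real" and a b :: real
    assume \<psi>: "\<And>n. Ck n \<psi>" "0 < a" "\<And>t. t \<notin> {a..b} \<Longrightarrow> \<psi> t = 0"
    have "(LINT x|lebesgue. (\<Sum>i\<in>Basis. partial i (\<lambda>x. \<psi> (norm x)) x *\<^sub>R weak_partial i Q x))
       = (LINT r|lborel. (radius_density TYPE(real^3) r * partial 1 \<psi> r) *\<^sub>R w r)"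
      by (rule rest[OF \<psi>])
    also note conv
    finally show "(LINT x|lebesgue. (\<Sum>i\<in>Basis. partial i (\<lambda>x. \<psi> (norm x)) x *\<^sub>R weak_partial i Q x))
       = kappa *\<^sub>R (LINT r|lborel. (indicator {0<..} r * r\<^sup>2 * partial 1 \<psi> r) *\<^sub>R w r)" .
  qed
qed

text \<open>Positive mass forces positive energy through \<open>bliss_inequality\<close>, and the
  Dirichlet integral dominates the energy.\<close>

lemma dirichlet_pos:
  fixes Q :: "real^3 \<Rightarrow> real^'m"
  assumes Q: "Q \<in> H1dot_rad_nz"
  shows "dirichlet Q > 0"
proof -
  obtain u w :: "real \<Rightarrow> real^'m" where uw: "radial_energy u w" "kappa * radial_energy.energy w \<le> dirichlet Q" "radial_energy.mass u > 0"
    using H1dot_rad_nz_profile[OF Q] by metis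
  interpret radial_energy u w by (rule uw)
  have "0 < 27 * pi\<^sup>2 / 256 * mass" using uw(3) by simp
  then have "energy ^ 3 > 0" using bliss_inequality by linarith
  then have "energy > 0" using energy_nonneg by (cases "energy = 0") auto
  then have "0 < kappa * energy" using kappa_pos by simp
  then show ?thesis using uw(2) by linarith
qed

lemma not_AE_lebesgue_False: "\<not> (AE x in (lebesgue :: 'a::euclidean_space measure). False)"
proof
  assume "AE x in (lebesgue :: 'a measure). False"
  then have "AE x in (lborel :: 'a measure). False" by (rule AE_lebesgue_imp_lborel)
  then have "emeasure lborel (UNIV :: 'a set) = 0" by (subst (asm) AE_iff_measurable[OF _ refl]) auto
  then show False by simp
qed

lemma Talenti_multiple:
  fixes \<omega> :: "real^'m"
  assumes c: "c > 0" and \<omega>: "norm \<omega> = 1"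
  defines "Z \<equiv> \<lambda>x. (c * W x) *\<^sub>R \<omega>"
  shows "Z \<in> H1dot_rad_nz" "dirichlet Z = kappa * (c\<^sup>2 * talenti)"
    "has_weak_laplacian Z (\<lambda>x. - ((c * W x ^ 5) *\<^sub>R \<omega>))"
    "(LINT x|lebesgue. W x ^ 6) = kappa * talenti"
proof -
  have Zeq: "Z = (\<lambda>x. W x *\<^sub>R (c *\<^sub>R \<omega>))" by (simp add: Z_def mult.commute)
  have Wp: "W x > 0" for x by (simp add: W_eq Wpow_pos)
  have W1: "Ck 1 W" "Ck 2 W" unfolding W_eq by (rule Ck_Wpow)+
  have cont: "continuous_on UNIV W" by (rule Ck_continuous[OF W1(1)])
  have mZ: "Z \<in> borel_measurable lebesgue"
    unfolding Zeq by (intro continuous_on_UNIV_lebesgue_measurable continuous_intros cont)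
  have i6: "integrable lebesgue (\<lambda>x. W x ^ 6)" and v6: "(LINT x|lebesgue. W x ^ 6) = kappa * talenti"
    using real_radial_integral_3[of "\<lambda>r. 1 / (1 + r\<^sup>2 / 3) ^ 3"] W_integrals(1,2) by (simp_all add: W_power_6)
  show "(LINT x|lebesgue. W x ^ 6) = kappa * talenti" by fact
  have ig: "integrable lebesgue (\<lambda>x. \<Sum>i\<in>Basis. (partial i W x)\<^sup>2)"
    and vg: "(LINT x|lebesgue. (\<Sum>i\<in>Basis. (partial i W x)\<^sup>2)) = kappa * talenti"
    using real_radial_integral_3[of "\<lambda>r. r\<^sup>2 / 9 / (1 + r\<^sup>2 / 3) ^ 3"] W_integrals(3,4) by (simp_all add: W_gradient)
  have wpart: "has_weak_partial i Z (\<lambda>x. partial i W x *\<^sub>R (c *\<^sub>R \<omega>))" if "i \<in> Basis" for i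
    unfolding Zeq by (rule smooth_has_weak_partial[OF W1(1) that])
  have np: "(norm (partial i W x *\<^sub>R (c *\<^sub>R \<omega>)))\<^sup>2 = c\<^sup>2 * (partial i W x)\<^sup>2" for i x
    using \<omega> by (simp add: power_mult_distrib mult.commute)
  have iw: "integrable lebesgue (\<lambda>x. (norm (partial i W x *\<^sub>R (c *\<^sub>R \<omega>)))\<^sup>2)" if i: "i \<in> Basis" for i
    unfolding np
  proof (rule integrable_mult_right, rule Bochner_Integration.integrable_bound[OF ig])
    have "continuous_on UNIV (partial i W)" using Ck_continuous[OF Ck_Suc_partial[of 0 W i]] W1(1) i by simp
    then show "(\<lambda>x. (partial i W x)\<^sup>2) \<in> borel_measurable lebesgue"
      by (intro continuous_on_UNIV_lebesgue_measurable continuous_intros)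
    show "AE x in lebesgue. norm ((partial i W x)\<^sup>2) \<le> norm (\<Sum>i\<in>Basis. (partial i W x)\<^sup>2)"
      using member_le_sum[OF i, of "\<lambda>i. (partial i W _)\<^sup>2"] by (intro AE_I2) (simp add: sum_nonneg)
  qed
  have n6: "norm (Z x) ^ 6 = c ^ 6 * W x ^ 6" for x
    using \<omega> c Wp[of x] by (simp add: Z_def power_mult_distrib abs_mult)
  have "integrable lebesgue (\<lambda>x. norm (Z x) ^ 6)" unfolding n6 using i6 by simp
  then have "Z \<in> H1dot"
    unfolding H1dot_def using mZ by (auto intro!: exI conjI wpart iw)
  moreover have "radial Z"
    unfolding radial_def Z_def W_def
    by (intro exI[of _ "\<lambda>r. (c * (1 + r\<^sup>2 / 3) powr (- 1 / 2)) *\<^sub>R \<omega>"] AE_I2) simp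
  moreover have "\<not> (AE x in lebesgue. Z x = 0)"
  proof
    assume "AE x in lebesgue. Z x = 0"
    moreover have "Z x \<noteq> 0" for x using Wp[of x] c \<omega> by (auto simp: Z_def)
    ultimately show False using not_AE_lebesgue_False[where 'a = "real^3"] by simp
  qed
  ultimately show "Z \<in> H1dot_rad_nz" by (simp add: H1dot_rad_nz_def)
  have "dirichlet Z = (LINT x|lebesgue. c\<^sup>2 * (\<Sum>i\<in>Basis. (partial i W x)\<^sup>2))"
    using dirichlet_eq[of Z "\<lambda>i x. partial i W x *\<^sub>R (c *\<^sub>R \<omega>)"] wpart by (simp only: np sum_distrib_left)
  then show "dirichlet Z = kappa * (c\<^sup>2 * talenti)" using vg by simp
  show "has_weak_laplacian Z (\<lambda>x. - ((c * W x ^ 5) *\<^sub>R \<omega>))"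
    using smooth_has_weak_laplacian[OF W1(2), of "c *\<^sub>R \<omega>"] by (simp add: Zeq laplacian_W mult.commute)
qed

section \<open>The homogeneous nonlinearity\<close>

locale homogeneous_potential =
  fixes F :: "real^'m \<Rightarrow> real" and f :: "real^'m \<Rightarrow> real^'m"
  assumes F_C3: "Ck 3 F"
    and F_hom: "\<And>c x. c \<ge> 0 \<Longrightarrow> F (c *\<^sub>R x) = c ^ 6 * F x"
    and f_grad: "\<And>x. GDERIV F x :> f x"
begin

lemma F_cont: "continuous_on UNIV F"
  by (rule Ck_continuous[OF F_C3])

lemma F_deriv: "(F has_derivative (\<lambda>h. f x \<bullet> h)) (at x)"
proof -
  have "(\<lambda>h. f x \<bullet> h) = (\<lambda>h. h \<bullet> f x)" by (auto simp: inner_commute)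
  then show ?thesis using f_grad[of x] by (simp only: gderiv_def)
qed

lemma f_cont: "continuous_on UNIV f"
proof -
  have "f x = (\<Sum>i\<in>Basis. partial i F x *\<^sub>R i)" for x
    by (simp add: partial_eq[OF F_deriv] euclidean_representation)
  moreover have "continuous_on UNIV (partial i F)" if "i \<in> Basis" for i
    using Ck_continuous[OF Ck_Suc_partial[of 2 F i]] F_C3 that by (simp add: numeral_3_eq_3 numeral_2_eq_2)
  ultimately show ?thesis by (simp add: continuous_on_sum continuous_on_scaleR)
qed

text \<open>Differentiation of \<open>F (t *\<^sub>R x) = t ^ 6 * F x\<close> at
  \<open>t = 1\<close>; homogeneity holds in a neighbourhood of 1, where \<open>t\<close> is
  positive.\<close>

lemma Euler: "f x \<bullet> x = 6 * F x"
proof -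
  have l: "((\<lambda>t. t *\<^sub>R x) has_derivative (\<lambda>h. h *\<^sub>R x)) (at 1)"
    by (auto intro!: derivative_eq_intros)
  have "((\<lambda>t. F (t *\<^sub>R x)) has_derivative (\<lambda>h. f x \<bullet> (h *\<^sub>R x))) (at (1::real))"
    using has_derivative_compose[OF l, of F "\<lambda>h. f x \<bullet> h"] F_deriv[of x] by simp
  then have 1: "((\<lambda>t. F (t *\<^sub>R x)) has_real_derivative f x \<bullet> x) (at 1)"
    by (simp add: has_field_derivative_def mult.commute[of _ "f x \<bullet> x"])
  have "eventually (\<lambda>t. F (t *\<^sub>R x) = t ^ 6 * F x) (nhds (1::real))"
    using eventually_nhds_in_open[of "{0<..}" "1::real"] by (auto elim!: eventually_mono simp: F_hom)
  from DERIV_cong_ev[OF refl this refl] 1 have "((\<lambda>t. t ^ 6 * F x) has_real_derivative f x \<bullet> x) (at 1)"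
    by blast
  moreover have "((\<lambda>t::real. t ^ 6 * F x) has_real_derivative 6 * F x) (at 1)"
    by (auto intro!: derivative_eq_intros)
  ultimately show ?thesis by (rule DERIV_unique)
qed

lemma arg_max_bound:
  assumes "is_arg_max F (\<lambda>u. u \<in> sphere 0 1) \<omega>"
  shows "norm \<omega> = 1" "F x \<le> F \<omega> * norm x ^ 6"
proof -
  show "norm \<omega> = 1" using assms by (simp add: is_arg_max_def)
  show "F x \<le> F \<omega> * norm x ^ 6"
  proof (cases "x = 0")
    case True
    then show ?thesis using F_hom[of 0 0] by simp
  next
    case False
    have "F (sgn x) \<le> F \<omega>" using assms False by (auto simp: is_arg_max_def norm_sgn not_less)
    moreover have "F x = norm x ^ 6 * F (sgn x)" using F_hom[of "norm x" "sgn x"] False by (simp add: sgn_div_norm)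
    ultimately show ?thesis by (simp add: mult.commute[of _ "norm x ^ 6"] mult_left_mono)
  qed
qed

text \<open>The function \<open>F \<omega> |x| ^ 6 - F x\<close> is nonnegative and vanishes on the
  ray through \<open>\<omega>\<close>, so its gradient vanishes there. This replaces a Lagrange
  multiplier argument; the sixth power is written as a polynomial to be differentiable
  everywhere.\<close>

lemma f_arg_max:
  assumes \<omega>: "is_arg_max F (\<lambda>u. u \<in> sphere 0 1) \<omega>" and t: "t > 0"
  shows "f (t *\<^sub>R \<omega>) = (6 * F \<omega> * t ^ 5) *\<^sub>R \<omega>"
proof -
  note n = arg_max_bound[OF \<omega>]
  have \<omega>\<omega>: "\<omega> \<bullet> \<omega> = 1" using n(1) by (simp add: norm_eq_1)
  define g where "g x = F \<omega> * (x \<bullet> x) ^ 3 - F x" for x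
  have "(g has_derivative (\<lambda>h. F \<omega> * (6 * t ^ 5 * (\<omega> \<bullet> h)) - f (t *\<^sub>R \<omega>) \<bullet> h)) (at (t *\<^sub>R \<omega>))"
    unfolding g_def using \<omega>\<omega>
    by (auto intro!: derivative_eq_intros F_deriv simp: fun_eq_iff inner_commute power_mult_distrib eval_nat_numeral)
  moreover have "g (t *\<^sub>R \<omega>) \<le> g y" for y
  proof -
    have "norm y ^ 6 = (y \<bullet> y) ^ 3" by (simp add: power2_norm_eq_inner[symmetric] flip: power_mult)
    then have "0 \<le> g y" using n(2)[of y] by (simp add: g_def)
    moreover have "g (t *\<^sub>R \<omega>) = 0" using t \<omega>\<omega> by (simp add: g_def F_hom eval_nat_numeral)
    ultimately show ?thesis by simp
  qed
  ultimately have *: "(\<lambda>h. F \<omega> * (6 * t ^ 5 * (\<omega> \<bullet> h)) - f (t *\<^sub>R \<omega>) \<bullet> h) = (\<lambda>h. 0)"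
    by (intro has_derivative_local_min[of g]) auto
  then have "f (t *\<^sub>R \<omega>) \<bullet> h = ((6 * F \<omega> * t ^ 5) *\<^sub>R \<omega>) \<bullet> h" for h
    using fun_cong[OF *, of h] by simp
  then show ?thesis by (metis vector_eq_rdot)
qed

lemma exists_arg_max: "\<exists>\<omega>. is_arg_max F (\<lambda>u. u \<in> sphere 0 1) \<omega>"
proof -
  obtain \<omega> where "\<omega> \<in> sphere 0 1" "\<And>y. y \<in> sphere 0 1 \<Longrightarrow> F y \<le> F \<omega>"
    using continuous_attains_sup[OF _ _ continuous_on_subset[OF F_cont], of "sphere 0 1"] by auto
  then show ?thesis by (auto simp: is_arg_max_def not_less intro!: exI[of _ \<omega>])
qed

text \<open>By homogeneity \<open>F\<close> is bounded by a constant times the sixth power of the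
  norm, the constant being its bound on the unit sphere.\<close>

lemma potential_integrable:
  fixes Q :: "real^3 \<Rightarrow> real^'m"
  assumes "Q \<in> H1dot"
  shows "integrable lebesgue (\<lambda>x. F (Q x))"
proof -
  have Q: "Q \<in> borel_measurable lebesgue" "integrable lebesgue (\<lambda>x. norm (Q x) ^ 6)"
    using assms by (auto simp: H1dot_def)
  have FQ: "(\<lambda>x. F (Q x)) \<in> borel_measurable lebesgue"
    using measurable_compose[OF Q(1) borel_measurable_continuous_onI[OF F_cont]] .
  have "bounded (F ` sphere 0 1)"
    using F_cont by (intro compact_imp_bounded compact_continuous_image) (auto intro: continuous_on_subset)
  then obtain C where C: "\<forall>y\<in>F ` sphere 0 1. norm y \<le> C" "C > 0" unfolding bounded_pos by blast
  have "\<bar>F y\<bar> \<le> C * norm y ^ 6" for y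
  proof (cases "y = 0")
    case True
    then show ?thesis using F_hom[of 0 0] by simp
  next
    case False
    have "\<bar>F (sgn y)\<bar> \<le> C" using C False by (auto simp: norm_sgn)
    moreover have "F y = norm y ^ 6 * F (sgn y)" using F_hom[of "norm y" "sgn y"] False by (simp add: sgn_div_norm)
    ultimately show ?thesis by (simp add: abs_mult mult.commute[of C] mult_left_mono)
  qed
  then show ?thesis
    using Q(2) C(2) by (intro Bochner_Integration.integrable_bound[OF integrable_mult_right[of C lebesgue "\<lambda>x. norm (Q x) ^ 6"] FQ])
      (auto intro!: AE_I2 simp: abs_mult)
qed

end

text \<open>\<open>V\<close> is the continuous representative of \<open>r\<^sup>2 w\<close>, so the
  flux \<open>V r \<bullet> u r\<close> obeys the product rule. By the sign condition its increments
  dominate the energy on each interval, and the flux is arbitrarily small at suitable radii near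
  both ends.\<close>

lemma (in radial_energy) monotone_flux_imp_energy_0:
  assumes z: "primitive_on {0<..} V (\<lambda>r. - (r\<^sup>2 *\<^sub>R g r))" and g: "continuous_on {0<..} g"
    and V: "AE r in lebesgue. 0 < r \<longrightarrow> r\<^sup>2 *\<^sub>R w r = V r"
    and sign: "\<And>r. 0 < r \<Longrightarrow> g r \<bullet> u r \<le> 0"
  shows "energy = 0"
proof -
  define m where "m r = V r \<bullet> u r" for r
  define zr where "zr r = - (r\<^sup>2 *\<^sub>R g r)" for r
  have czr: "continuous_on {0<..} zr" unfolding zr_def by (intro continuous_intros g)
  have cV: "continuous_on {0<..} V" by (rule primitive_on_continuous[OF z]) simp
  have dV: "(V has_vector_derivative zr r) (at r)" if r: "r > 0" for r
  proof -
    have sub: "{r / 2..r + 1} \<subseteq> {0<..}" using r by auto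
    have "((\<lambda>t. V (r / 2) + integral {r / 2..t} zr) has_vector_derivative 0 + zr r) (at r within {r / 2..r + 1})"
      by (rule has_vector_derivative_add[OF has_vector_derivative_const integral_has_vector_derivative[OF continuous_on_subset[OF czr sub]]])
        (use r in auto)
    then have "((\<lambda>t. V (r / 2) + integral {r / 2..t} zr) has_vector_derivative zr r) (at r)"
      using r by (subst (asm) at_within_interior) auto
    then show ?thesis
    proof (rule has_vector_derivative_transform_within_open)
      show "open {r / 2<..<r + 1}" "r \<in> {r / 2<..<r + 1}" using r by auto
      show "V (r / 2) + integral {r / 2..t} zr = V t" if "t \<in> {r / 2<..<r + 1}" for t
      proof -
        have "V t - V (r / 2) = integral {r / 2..t} zr"
          unfolding zr_def using that r by (intro primitive_onD(3)[OF z]) auto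
        then show ?thesis by (metis add.commute diff_add_cancel)
      qed
    qed
  qed
  have pm: "primitive_on {0<..} m (\<lambda>r. zr r \<bullet> u r + V r \<bullet> w r)"
    unfolding m_def
  proof (rule primitive_on_chain2[OF prim])
    fix r :: real and y :: 'b assume r: "r \<in> {0<..}"
    have d: "(V has_derivative (\<lambda>h. h *\<^sub>R zr r)) (at (fst (r, y)))"
      using dV r by (simp add: has_vector_derivative_def)
    have "((\<lambda>p. V (fst p)) has_derivative (\<lambda>h. fst h *\<^sub>R zr r)) (at (r, y))"
      by (rule has_derivative_compose[OF bounded_linear_imp_has_derivative[OF bounded_linear_fst] d])
    then show "((\<lambda>p. V (fst p) \<bullet> snd p) has_derivative (\<lambda>h. zr r \<bullet> y * fst h + V r \<bullet> snd h)) (at (r, y))"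
      by (auto intro!: derivative_eq_intros simp: fun_eq_iff mult.commute)
  next
    show "continuous_on ({0<..} \<times> UNIV) (\<lambda>p. zr (fst p) \<bullet> snd p)" "continuous_on ({0<..} \<times> UNIV) (\<lambda>p. V (fst p))"
      by (intro continuous_intros continuous_on_compose2[OF czr] continuous_on_compose2[OF cV]; auto)+
  qed simp
  obtain N where N: "negligible N" "\<And>r. r \<notin> N \<Longrightarrow> 0 < r \<Longrightarrow> r\<^sup>2 *\<^sub>R w r = V r"
    using V unfolding eventually_ae_filter by (auto simp: negligible_iff_null_sets)
  have inc: "integral {a..b} (\<lambda>r. r\<^sup>2 * (norm (w r))\<^sup>2) \<le> m b - m a" if ab: "0 < a" "a \<le> b" for a b
  proof -
    have sub: "{a..b} \<subseteq> {0<..}" using ab by auto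
    \<comment> \<open>The derivative of the flux, altered on the null set \<open>N\<close> so that
      the comparison with the energy density holds at every point.\<close>
    define q where "q r = (if r \<in> N then r\<^sup>2 * (norm (w r))\<^sup>2 else zr r \<bullet> u r + V r \<bullet> w r)" for r
    have qi: "q integrable_on {a..b}"
      by (rule integrable_spike[OF primitive_onD(2)[OF pm sub] N(1)]) (auto simp: q_def)
    have "integral {a..b} (\<lambda>r. r\<^sup>2 * (norm (w r))\<^sup>2) \<le> integral {a..b} q"
    proof (rule integral_le[OF half_line_integral(2)[OF int2 ab(1)] qi])
      fix r assume "r \<in> {a..b}"
      then have r: "r > 0" using ab by auto
      show "r\<^sup>2 * (norm (w r))\<^sup>2 \<le> q r"
      proof (cases "r \<in> N")
        case False
        have "zr r \<bullet> u r \<ge> 0" using sign[OF r] by (simp add: zr_def mult_nonneg_nonpos)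
        moreover have "V r \<bullet> w r = r\<^sup>2 * (norm (w r))\<^sup>2"
          unfolding N(2)[OF False r, symmetric] by (simp add: power2_norm_eq_inner)
        ultimately show ?thesis using False by (simp add: q_def)
      qed (simp add: q_def)
    qed
    also have "\<dots> = integral {a..b} (\<lambda>r. zr r \<bullet> u r + V r \<bullet> w r)"
      by (rule integral_spike[OF N(1)]) (auto simp: q_def)
    also have "\<dots> = m b - m a" using primitive_onD(3)[OF pm sub ab(2)] by simp
    finally show ?thesis .
  qed
  \<comment> \<open>Almost everywhere this is the energy density, hence integrable, but it is
    continuous and bounds the flux pointwise: \<open>(m r)\<^sup>2 \<le> rho r * (r * h r)\<close>,
    where \<open>rho\<close> is bounded and \<open>r * h r\<close> is small at suitable
    radii.\<close>
  define h where "h r = (norm (V r))\<^sup>2 / r\<^sup>2" for r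
  have h: "set_integrable lborel {0<..} h"
  proof -
    have "AE r in lborel. indicator {0<..} r *\<^sub>R (r\<^sup>2 * (norm (w r))\<^sup>2) = indicator {0<..} r *\<^sub>R h r"
      using AE_lebesgue_imp_lborel[OF V]
    proof eventually_elim
      case (elim r)
      show ?case
      proof (cases "r > 0")
        case True
        then have "V r = r\<^sup>2 *\<^sub>R w r" using elim by simp
        then show ?thesis using True by (simp add: h_def power_mult_distrib power2_eq_square)
      qed simp
    qed
    moreover have "(\<lambda>r. indicator {0<..} r *\<^sub>R h r) \<in> borel_measurable lborel"
    proof -
      have "continuous_on {0<..} h" unfolding h_def by (intro continuous_intros cV) auto
      then show ?thesis using borel_measurable_continuous_on_indicator[of "{0<..}" h] by simp
    qed
    ultimately show ?thesis
      using int2 integrable_cong_AE_imp[of lborel "\<lambda>r. indicator {0<..} r *\<^sub>R (r\<^sup>2 * (norm (w r))\<^sup>2)"]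
      unfolding set_integrable_def by blast
  qed
  have m_bound: "(m r)\<^sup>2 \<le> rho r * (r * h r)" if r: "r > 0" for r
  proof -
    have "(m r)\<^sup>2 \<le> (V r \<bullet> V r) * (u r \<bullet> u r)" unfolding m_def by (rule Cauchy_Schwarz_ineq)
    also have "\<dots> = rho r * (r * h r)"
      unfolding rho_def h_def power2_norm_eq_inner using r by (simp add: power2_eq_square)
    finally show ?thesis .
  qed
  obtain R0 where R0: "R0 > 0" "\<And>r. 0 < r \<Longrightarrow> r \<le> R0 \<Longrightarrow> rho r \<le> 1" using rho_small_at_zero[of 1] by auto
  obtain R1 where R1: "R1 > 0" "\<And>r. r \<ge> R1 \<Longrightarrow> rho r \<le> 1" using rho_small_at_infinity[of 1] by auto
  have hn: "0 \<le> h r" for r by (simp add: h_def)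
  have small: "\<bar>m r\<bar> \<le> e" if r: "r > 0" "rho r \<le> 1" "r * h r \<le> e\<^sup>2" and e: "e > 0" for r e
  proof -
    have "(m r)\<^sup>2 \<le> rho r * (r * h r)" by (rule m_bound[OF r(1)])
    also have "\<dots> \<le> 1 * e\<^sup>2" using r rho_nonneg[OF r(1)] hn by (intro mult_mono) auto
    finally have "(m r)\<^sup>2 \<le> e\<^sup>2" by simp
    then show ?thesis using e abs_le_square_iff[of "m r" e] by simp
  qed
  have zero: "integral {a..b} (\<lambda>r. r\<^sup>2 * (norm (w r))\<^sup>2) = 0" if ab: "0 < a" "a \<le> b" for a b
  proof -
    have "integral {a..b} (\<lambda>r. r\<^sup>2 * (norm (w r))\<^sup>2) \<le> 0 + e" if e: "e > 0" for e
    proof -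
      obtain y where y: "y \<ge> max b R1" "y * h y \<le> (e / 2)\<^sup>2"
        using integrable_half_line_small(1)[OF h hn, of "(e / 2)\<^sup>2" "max b R1"] e R1(1)
        by (auto simp: less_max_iff_disj)
      obtain x where x: "x > 0" "x \<le> min a R0" "x * h x \<le> (e / 2)\<^sup>2"
        using integrable_half_line_small(2)[OF h hn, of "(e / 2)\<^sup>2" "min a R0"] e R0(1) ab(1) by auto
      have "integral {a..b} (\<lambda>r. r\<^sup>2 * (norm (w r))\<^sup>2) \<le> integral {x..y} (\<lambda>r. r\<^sup>2 * (norm (w r))\<^sup>2)"
        using x y ab by (intro integral_subset_le half_line_integral(2)[OF int2]) auto
      also have "\<dots> \<le> m y - m x" using x y ab by (intro inc) auto
      also have "\<dots> \<le> e / 2 + e / 2"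
        using small[of y "e / 2"] small[of x "e / 2"] x y e R0 R1 by auto
      finally show ?thesis by simp
    qed
    then have "integral {a..b} (\<lambda>r. r\<^sup>2 * (norm (w r))\<^sup>2) \<le> 0" by (rule field_le_epsilon)
    moreover have "integral {a..b} (\<lambda>r. r\<^sup>2 * (norm (w r))\<^sup>2) \<ge> 0"
      by (intro integral_nonneg half_line_integral(2)[OF int2 ab(1)]) auto
    ultimately show ?thesis by simp
  qed
  have "(\<lambda>n. integral {1 / real (Suc n)..real (Suc n)} (\<lambda>r. r\<^sup>2 * (norm (w r))\<^sup>2)) = (\<lambda>n. 0)"
    by (intro ext zero) (auto simp: field_simps)
  with half_line_integral(4)[OF int2] show ?thesis
    unfolding energy_def by (metis LIMSEQ_const_iff)
qed

context homogeneous_potential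
begin

text \<open>Radial test functions turn the weak equation into the statement that
  \<open>r\<^sup>2 w\<close> has weak derivative \<open>- r\<^sup>2 f(u)\<close>. If
  \<open>F\<close> were nowhere positive, Euler's identity would give the sign condition of
  \<open>monotone_flux_imp_energy_0\<close>; zero energy contradicts positive mass.\<close>

lemma stationary_imp_positive:
  assumes Z: "Z \<in> stationary f"
  shows "\<exists>x. F x > 0"
proof (rule ccontr)
  assume "\<not> ?thesis"
  then have Fneg: "F x \<le> 0" for x by (simp add: not_less)
  have ZH: "Z \<in> H1dot_rad_nz" and lap: "has_weak_laplacian Z (\<lambda>x. - f (Z x))"
    using Z by (auto simp: stationary_def)
  obtain u w where re: "radial_energy u w" and mw: "w \<in> borel_measurable borel" and Zu: "AE x in lebesgue. Z x = u (norm x)"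
    and mass: "radial_energy.mass u > 0"
    and wp: "\<And>i. i \<in> Basis \<Longrightarrow> has_weak_partial i Z (weak_partial i Z)"
    and test: "\<And>\<psi> a b. (\<And>n. Ck n \<psi>) \<Longrightarrow> 0 < a \<Longrightarrow> (\<And>t. t \<notin> {a..b} \<Longrightarrow> \<psi> t = 0) \<Longrightarrow>
      (LINT x|lebesgue. (\<Sum>i\<in>Basis. partial i (\<lambda>x. \<psi> (norm x)) x *\<^sub>R weak_partial i Z x))
       = kappa *\<^sub>R (LINT r|lborel. (indicator {0<..} r * r\<^sup>2 * partial 1 \<psi> r) *\<^sub>R w r)"
  proof (rule H1dot_rad_nz_profile[OF ZH])
    fix u w :: "real \<Rightarrow> real^'m"
    assume a: "radial_energy u w" "w \<in> borel_measurable borel" "AE x in lebesgue. Z x = u (norm x)"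
      "radial_energy.mass u > 0" "\<And>i. i \<in> Basis \<Longrightarrow> has_weak_partial i Z (weak_partial i Z)"
    assume r: "\<And>\<psi> a b. (\<And>n. Ck n \<psi>) \<Longrightarrow> 0 < a \<Longrightarrow> (\<And>t. t \<notin> {a..b} \<Longrightarrow> \<psi> t = 0) \<Longrightarrow>
      (LINT x|lebesgue. (\<Sum>i\<in>Basis. partial i (\<lambda>x. \<psi> (norm x)) x *\<^sub>R weak_partial i Z x))
       = kappa *\<^sub>R (LINT r|lborel. (indicator {0<..} r * r\<^sup>2 * partial 1 \<psi> r) *\<^sub>R w r)"
    show thesis by (rule that[OF a(1-4)], rule a(5), assumption, rule r, assumption+)
  qed
  interpret radial_energy u w by (rule re)
  define ut where "ut r = indicator {0<..} r *\<^sub>R u r" for r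
  have mt: "ut \<in> borel_measurable borel"
    unfolding ut_def[abs_def] using borel_measurable_continuous_on_indicator[OF _ u_cont] by simp
  have mf: "(\<lambda>r. f (ut r)) \<in> borel_measurable borel"
    by (rule measurable_compose[OF mt borel_measurable_continuous_onI[OF f_cont]])
  have cfu: "continuous_on {0<..} (\<lambda>r. f (u r))"
    by (rule continuous_on_compose2[OF f_cont u_cont]) auto
  have weak: "(LINT t|lebesgue. partial 1 \<psi> t *\<^sub>R (t\<^sup>2 *\<^sub>R w t)) = - (LINT t|lebesgue. \<psi> t *\<^sub>R (- (t\<^sup>2 *\<^sub>R f (u t))))"
    if \<psi>: "\<And>n. Ck n \<psi>" "0 < a" "\<And>t. t \<notin> {a..b} \<Longrightarrow> \<psi> t = 0" for \<psi> a b
  proof -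
    \<comment> \<open>Smooth although the norm is not, because \<open>\<psi>\<close> vanishes near
      zero. One integration by parts moves a derivative onto the weak gradient, the form in which
      the profile identity is available.\<close>
    define \<phi> where "\<phi> x = \<psi> (norm x)" for x :: "real^3"
    have "test_fun (\<lambda>x::real^3. 1 * (\<psi> (norm x) / norm x ^ 0))"
      by (rule test_fun_radial_quot[OF \<psi> Ck_const])
    then have \<phi>: "test_fun \<phi>" by (simp add: \<phi>_def[abs_def])
    have c: "continuous_on UNIV \<psi>" by (rule Ck_continuous[OF \<psi>(1)])
    have [measurable]: "\<psi> \<in> borel_measurable borel" by (rule borel_measurable_continuous_onI[OF c])
    have cp: "continuous_on UNIV (partial 1 \<psi>)"
      using Ck_continuous[OF Ck_Suc_partial[of 0 \<psi> 1]] \<psi>(1)[of "Suc 0"] by auto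
    have z: "partial 1 \<psi> t = 0" if "t \<notin> {a..b}" for t
      using partial_outside[of "{a..b}" \<psi> t] \<psi>(3) that by auto
    have lZ: "loc_integrable Z" "loc_integrable (weak_partial i Z)" if "i \<in> Basis" for i
      using wp[OF that] by (auto simp: has_weak_partial_def)
    have i1: "integrable lebesgue (\<lambda>x. partial i (partial i \<phi>) x *\<^sub>R Z x)" "integrable lebesgue (\<lambda>x. partial i \<phi> x *\<^sub>R weak_partial i Z x)"
      if "i \<in> Basis" for i
      using integrable_test_fun_scaleR test_fun_partial \<phi> lZ that by blast+
    have "(LINT x|lebesgue. laplacian \<phi> x *\<^sub>R Z x) = (\<Sum>i\<in>Basis. LINT x|lebesgue. partial i (partial i \<phi>) x *\<^sub>R Z x)"
      unfolding laplacian_def scaleR_sum_left using i1(1) by (intro Bochner_Integration.integral_sum)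
    also have "\<dots> = (\<Sum>i\<in>Basis. - (LINT x|lebesgue. partial i \<phi> x *\<^sub>R weak_partial i Z x))"
      using wp test_fun_partial[OF \<phi>] by (intro sum.cong) (auto simp: has_weak_partial_def)
    also have "\<dots> = - (LINT x|lebesgue. (\<Sum>i\<in>Basis. partial i \<phi> x *\<^sub>R weak_partial i Z x))"
      using i1(2) by (simp add: Bochner_Integration.integral_sum sum_negf)
    also have "(LINT x|lebesgue. (\<Sum>i\<in>Basis. partial i \<phi> x *\<^sub>R weak_partial i Z x)) = kappa *\<^sub>R (LINT r|lborel. (indicator {0<..} r * r\<^sup>2 * partial 1 \<psi> r) *\<^sub>R w r)"
      unfolding \<phi>_def[abs_def] by (rule test[OF \<psi>])
    finally have 1: "(LINT x|lebesgue. laplacian \<phi> x *\<^sub>R Z x) = - (kappa *\<^sub>R (LINT r|lborel. (indicator {0<..} r * r\<^sup>2 * partial 1 \<psi> r) *\<^sub>R w r))" .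
    have 2: "(LINT x|lebesgue. laplacian \<phi> x *\<^sub>R Z x) = (LINT x|lebesgue. \<phi> x *\<^sub>R (- f (Z x)))"
      using lap \<phi> by (simp add: has_weak_laplacian_def)
    have mh: "(\<lambda>r. \<psi> r *\<^sub>R (- f (ut r))) \<in> borel_measurable borel" using mf by measurable
    have "AE x in lborel. (x :: real^3) \<noteq> 0" by (rule AE_lborel_singleton)
    then have "AE x in lborel. \<phi> x *\<^sub>R (- f (Z x)) = \<psi> (norm x) *\<^sub>R (- f (ut (norm x)))"
      using AE_lebesgue_imp_lborel[OF Zu] by eventually_elim (simp add: ut_def \<phi>_def)
    from lebesgue_integral_lborel_AE(2)[OF this measurable_compose[OF borel_measurable_norm mh]]
    have 3: "(LINT x|lebesgue. \<phi> x *\<^sub>R (- f (Z x))) = (LINT r|lborel. radius_density TYPE(real^3) r *\<^sub>R (\<psi> r *\<^sub>R (- f (ut r))))"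
      using radial_integral(2)[OF mh, where 'a = "real^3"] by simp
    have "(\<lambda>r. radius_density TYPE(real^3) r *\<^sub>R (\<psi> r *\<^sub>R (- f (ut r)))) = (\<lambda>r. kappa *\<^sub>R ((indicator {0<..} r * r\<^sup>2 * \<psi> r) *\<^sub>R (- f (ut r))))"
      by (simp add: radius_density_3 mult_ac)
    then have 4: "(LINT r|lborel. radius_density TYPE(real^3) r *\<^sub>R (\<psi> r *\<^sub>R (- f (ut r)))) = kappa *\<^sub>R (LINT r|lborel. (indicator {0<..} r * r\<^sup>2 * \<psi> r) *\<^sub>R (- f (ut r)))"
      by (simp only: Bochner_Integration.integral_scaleR_right)
    have "kappa *\<^sub>R (LINT r|lborel. (indicator {0<..} r * r\<^sup>2 * partial 1 \<psi> r) *\<^sub>R w r) = kappa *\<^sub>R (- (LINT r|lborel. (indicator {0<..} r * r\<^sup>2 * \<psi> r) *\<^sub>R (- f (ut r))))"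
    proof -
      have "- (kappa *\<^sub>R (LINT r|lborel. (indicator {0<..} r * r\<^sup>2 * partial 1 \<psi> r) *\<^sub>R w r))
        = kappa *\<^sub>R (LINT r|lborel. (indicator {0<..} r * r\<^sup>2 * \<psi> r) *\<^sub>R (- f (ut r)))"
        by (rule trans[OF 1[symmetric] trans[OF 2 trans[OF 3 4]]])
      then show ?thesis unfolding scaleR_minus_right by (rule minus_equation_iff[THEN iffD1, symmetric])
    qed
    then have "(LINT r|lborel. (indicator {0<..} r * r\<^sup>2 * partial 1 \<psi> r) *\<^sub>R w r) = - (LINT r|lborel. (indicator {0<..} r * r\<^sup>2 * \<psi> r) *\<^sub>R (- f (ut r)))"
      by (rule real_vector.scale_left_imp_eq[rotated]) (use kappa_pos in simp)
    moreover have "(\<lambda>r. (indicator {0<..} r * r\<^sup>2 * partial 1 \<psi> r) *\<^sub>R w r) = (\<lambda>r. partial 1 \<psi> r *\<^sub>R (r\<^sup>2 *\<^sub>R w r))"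
    proof
      fix r
      show "(indicator {0<..} r * r\<^sup>2 * partial 1 \<psi> r) *\<^sub>R w r = partial 1 \<psi> r *\<^sub>R (r\<^sup>2 *\<^sub>R w r)"
        using z[of r] \<psi>(2) by (cases "r > 0") (auto simp: mult.commute)
    qed
    moreover have eq2: "(\<lambda>r. (indicator {0<..} r * r\<^sup>2 * \<psi> r) *\<^sub>R (- f (ut r))) = (\<lambda>r. \<psi> r *\<^sub>R (- (r\<^sup>2 *\<^sub>R f (u r))))"
    proof
      fix r
      show "(indicator {0<..} r * r\<^sup>2 * \<psi> r) *\<^sub>R (- f (ut r)) = \<psi> r *\<^sub>R (- (r\<^sup>2 *\<^sub>R f (u r)))"
        using \<psi>(3)[of r] \<psi>(2) by (cases "r > 0") (auto simp: mult.commute ut_def)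
    qed
    ultimately have *: "(LINT r|lborel. partial 1 \<psi> r *\<^sub>R (r\<^sup>2 *\<^sub>R w r)) = - (LINT r|lborel. \<psi> r *\<^sub>R (- (r\<^sup>2 *\<^sub>R f (u r))))"
      by (simp only:)
    have [measurable]: "partial 1 \<psi> \<in> borel_measurable borel" by (rule borel_measurable_continuous_onI[OF cp])
    have "(\<lambda>r. (indicator {0<..} r * r\<^sup>2 * \<psi> r) *\<^sub>R (- f (ut r))) \<in> borel_measurable borel"
      using mf by measurable
    then have m2: "(\<lambda>r. \<psi> r *\<^sub>R (- (r\<^sup>2 *\<^sub>R f (u r)))) \<in> borel_measurable lborel"
      unfolding eq2 by simp
    have m1: "(\<lambda>r. partial 1 \<psi> r *\<^sub>R (r\<^sup>2 *\<^sub>R w r)) \<in> borel_measurable lborel"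
      using mw by measurable
    show ?thesis using * unfolding integral_completion[OF m1] integral_completion[OF m2] .
  qed
  have iw: "(\<lambda>t. t\<^sup>2 *\<^sub>R w t) absolutely_integrable_on {a..b}" if "0 < a" for a b
  proof -
    have "{a..b} \<subseteq> {0<..}" using that by auto
    from primitive_onD(1)[OF prim this] show ?thesis
      by (intro absolutely_integrable_continuous_scaleR continuous_intros)
  qed
  have if': "(\<lambda>t. - (t\<^sup>2 *\<^sub>R f (u t))) absolutely_integrable_on {a..b}" if "0 < a" for a b
    using that by (intro absolutely_integrable_continuous_real continuous_intros continuous_on_subset[OF cfu]) auto
  obtain V where V: "primitive_on {0<..} V (\<lambda>t. - (t\<^sup>2 *\<^sub>R f (u t)))" "AE t in lebesgue. 0 < t \<longrightarrow> t\<^sup>2 *\<^sub>R w t = V t"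
    by (rule du_Bois_Reymond[OF iw if' weak]) assumption+
  have e0: "energy = 0"
    by (rule monotone_flux_imp_energy_0[OF V(1) cfu V(2)]) (use Euler Fneg in auto)
  have "0 < 27 * pi\<^sup>2 / 256 * mass" using mass by simp
  moreover have "energy ^ 3 = 0" using e0 by simp
  ultimately show False using bliss_inequality by linarith
qed

end

section \<open>The minimization problem\<close>

text \<open>Read \<open>D\<close>, \<open>P\<close> as Dirichlet integral and potential,
  \<open>E\<close>, \<open>I\<close> as energy and mass of the profile, \<open>G\<close> as the
  maximum of \<open>F\<close>, \<open>k\<close> as the sphere area, \<open>c0\<close> as the
  constant of the inequality and \<open>D0\<close> as the candidate minimum. The chain is
  \<open>D0\<^sup>2 D \<le> k ^ 3 c0 I \<le> k ^ 3 E ^ 3 \<le> D ^ 3\<close>; if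
  \<open>D = D0\<close>, every link is an equality.\<close>

lemma Nehari_algebra:
  fixes D E I P G k c0 D0 :: real
  assumes pos: "k > 0" "G > 0" "c0 > 0" "E \<ge> 0" "D > 0" "D0 > 0"
    and DP: "6 * P = D" and PI: "P \<le> G * k * I" and ED: "k * E \<le> D" and IE: "c0 * I \<le> E ^ 3"
    and D0: "D0\<^sup>2 * (6 * G) = k\<^sup>2 * c0"
  shows "D0 \<le> D" "D = D0 \<Longrightarrow> k * E = D \<and> E ^ 3 = c0 * I \<and> P = G * k * I"
proof -
  have a: "D0\<^sup>2 * D \<le> k ^ 3 * (c0 * I)"
  proof -
    have "(D0\<^sup>2 * D) * (6 * G) = (k\<^sup>2 * c0) * (6 * P)" unfolding DP D0[symmetric] by simp
    also have "\<dots> \<le> (k\<^sup>2 * c0) * (6 * (G * k * I))" using PI pos by (intro mult_left_mono) auto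
    also have "\<dots> = (k ^ 3 * (c0 * I)) * (6 * G)" by (simp add: power2_eq_square power3_eq_cube)
    finally show ?thesis using pos by simp
  qed
  have b: "k ^ 3 * (c0 * I) \<le> k ^ 3 * E ^ 3" using IE pos by (intro mult_left_mono) auto
  have c: "k ^ 3 * E ^ 3 \<le> D ^ 3"
    using power_mono[OF ED, of 3] pos by (simp add: power_mult_distrib)
  have "D0\<^sup>2 * D \<le> D\<^sup>2 * D" using a b c by (simp add: power2_eq_square power3_eq_cube)
  then have "D0\<^sup>2 \<le> D\<^sup>2" using pos by simp
  then show "D0 \<le> D" using pos power2_le_imp_le[of D0 D] by simp
  assume eq: "D = D0"
  then have e: "D0\<^sup>2 * D = D ^ 3" by (simp add: power2_eq_square power3_eq_cube)
  have "(k * E) ^ 3 = D ^ 3" using a b c e unfolding power_mult_distrib by linarith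
  then have 1: "k * E = D" using pos power_eq_iff_eq_base[of 3 "k * E" D] by simp
  have "k ^ 3 * (c0 * I) = k ^ 3 * E ^ 3" using a b c e by linarith
  then have 2: "E ^ 3 = c0 * I" using pos by simp
  have "k ^ 3 * (c0 * I) = D0\<^sup>2 * D" using a b c e by linarith
  moreover have "(k\<^sup>2 * c0) * (6 * (G * k * I)) = (k ^ 3 * (c0 * I)) * (6 * G)" by (simp add: power2_eq_square power3_eq_cube)
  ultimately have "(k\<^sup>2 * c0) * (6 * (G * k * I)) = (D0\<^sup>2 * D) * (6 * G)" by (simp only:)
  also have "\<dots> = (k\<^sup>2 * c0) * (6 * P)" unfolding DP D0[symmetric] by simp
  finally have "P = G * k * I" using pos by simp
  with 1 2 show "k * E = D \<and> E ^ 3 = c0 * I \<and> P = G * k * I" by simp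
qed

lemma mu_power4:
  assumes "F \<omega> > 0"
  shows "mu F \<omega> > 0" "mu F \<omega> ^ 4 * (6 * F \<omega>) = 1"
proof -
  show "mu F \<omega> > 0" using assms by (simp add: mu_def)
  have "mu F \<omega> ^ 4 = (6 * F \<omega>) powr (- 1)"
    using assms by (simp add: mu_def powr_power)
  then show "mu F \<omega> ^ 4 * (6 * F \<omega>) = 1"
    using assms by (simp add: powr_minus_divide)
qed

text \<open>Equality in \<open>bliss_inequality\<close> for \<open>W\<close>: energy and mass are
  both \<open>talenti\<close>, so the constant has to be its square.\<close>

lemma talenti_power2: "talenti\<^sup>2 = 27 * pi\<^sup>2 / 256"
  by (simp add: talenti_def power_divide power_mult_distrib)

context homogeneous_potential
begin

lemma arg_max_pos:
  assumes "is_arg_max F (\<lambda>u. u \<in> sphere 0 1) \<omega>" "F v > 0"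
  shows "F \<omega> > 0"
proof (rule ccontr)
  assume "\<not> ?thesis"
  then have "F \<omega> * norm v ^ 6 \<le> 0" by (simp add: mult_nonpos_nonneg)
  then show False using arg_max_bound(2)[OF assms(1), of v] assms(2) by linarith
qed

lemma nehari_pos:
  assumes "Q \<in> nehari F"
  shows "\<exists>v. F v > 0"
proof (rule ccontr)
  assume "\<not> ?thesis"
  then have "0 \<le> (LINT x|lebesgue. - F (Q x))"
    by (intro integral_nonneg_AE) (auto simp: not_less)
  then have "potential F Q \<le> 0" by (simp add: potential_def)
  moreover have "potential F Q > 0" using assms dirichlet_pos[of Q] by (auto simp: nehari_def)
  ultimately show False by simp
qed

text \<open>The bound is the Dirichlet integral of the explicit candidate. In the case of equality
  the profile is extremal and \<open>F (Q x) = F \<omega> * norm (Q x) ^ 6\<close> almost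
  everywhere, so the constant direction of \<open>Q\<close> is itself a maximum point.\<close>

lemma nehari_bound:
  assumes Q: "Q \<in> nehari F" and \<omega>: "is_arg_max F (\<lambda>u. u \<in> sphere 0 1) \<omega>"
  shows "kappa * ((mu F \<omega>)\<^sup>2 * talenti) \<le> dirichlet Q"
    and "dirichlet Q = kappa * ((mu F \<omega>)\<^sup>2 * talenti) \<Longrightarrow>
      \<exists>e. \<exists>s>0. is_arg_max F (\<lambda>u. u \<in> sphere 0 1) e \<and>
        (AE x in lebesgue. Q x = (sqrt s * mu F e * W (s *\<^sub>R x)) *\<^sub>R e)"
proof -
  have QH: "Q \<in> H1dot_rad_nz" and QN: "6 * potential F Q = dirichlet Q" using Q by (auto simp: nehari_def)
  have Q1: "Q \<in> H1dot" using QH by (simp add: H1dot_rad_nz_def)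
  have G: "F \<omega> > 0" using arg_max_pos[OF \<omega>] nehari_pos[OF Q] by blast
  note mu = mu_power4[where F = F and \<omega> = \<omega>, OF G]
  obtain u w :: "real \<Rightarrow> real^'m" where re: "radial_energy u w" and Qu: "AE x in lebesgue. Q x = u (norm x)"
    and nzu: "\<not> (\<forall>r>0. u r = 0)" and en: "kappa * radial_energy.energy w \<le> dirichlet Q"
    and i6: "integrable lebesgue (\<lambda>x. norm (Q x) ^ 6)"
    and v6: "(LINT x|lebesgue. norm (Q x) ^ 6) = kappa * radial_energy.mass u"
    by (rule H1dot_rad_nz_profile[OF QH])
  interpret radial_energy u w by (rule re)
  have le: "F (Q x) \<le> F \<omega> * norm (Q x) ^ 6" for x by (rule arg_max_bound(2)[OF \<omega>])
  note iF = potential_integrable[OF Q1]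
  have iG: "integrable lebesgue (\<lambda>x. F \<omega> * norm (Q x) ^ 6)" using i6 by simp
  have PI: "potential F Q \<le> F \<omega> * kappa * mass"
    using integral_mono[OF iF iG le] v6 by (simp add: potential_def mult.assoc)
  have D0: "(kappa * ((mu F \<omega>)\<^sup>2 * talenti))\<^sup>2 * (6 * F \<omega>) = kappa\<^sup>2 * (27 * pi\<^sup>2 / 256)"
  proof -
    have "(kappa * ((mu F \<omega>)\<^sup>2 * talenti))\<^sup>2 * (6 * F \<omega>) = kappa\<^sup>2 * talenti\<^sup>2 * (mu F \<omega> ^ 4 * (6 * F \<omega>))"
      by (simp add: power_mult_distrib flip: power_mult)
    then show ?thesis unfolding mu(2) talenti_power2 by simp
  qed
  have D0p: "kappa * ((mu F \<omega>)\<^sup>2 * talenti) > 0" using kappa_pos mu(1) talenti_pos by simp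
  have c0: "27 * pi\<^sup>2 / 256 > 0" by simp
  note alg = Nehari_algebra[OF kappa_pos G c0 energy_nonneg dirichlet_pos[OF QH] D0p QN PI en bliss_inequality D0]
  show "kappa * ((mu F \<omega>)\<^sup>2 * talenti) \<le> dirichlet Q" by (rule alg(1))
  assume eq: "dirichlet Q = kappa * ((mu F \<omega>)\<^sup>2 * talenti)"
  have kE: "kappa * energy = dirichlet Q" and E3: "energy ^ 3 = 27 * pi\<^sup>2 / 256 * mass"
    and PG: "potential F Q = F \<omega> * kappa * mass"
    using alg(2)[OF eq] by auto
  obtain b M e where bM: "b > 0" "M > 0" "norm e = 1" "energy = 3 * pi * M / 8"
    and ue: "\<And>r. r > 0 \<Longrightarrow> u r = sqrt (2 * M * b / (r\<^sup>2 + b\<^sup>2)) *\<^sub>R e"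
    using bliss_equality[OF E3 nzu] by metis
  have "(LINT x|lebesgue. F \<omega> * norm (Q x) ^ 6 - F (Q x)) = 0"
    using iF iG PG v6 by (simp add: potential_def)
  moreover have "integrable lebesgue (\<lambda>x. F \<omega> * norm (Q x) ^ 6 - F (Q x))" using iF iG by simp
  ultimately have FQ: "AE x in lebesgue. F \<omega> * norm (Q x) ^ 6 - F (Q x) = 0"
    by (subst (asm) integral_nonneg_eq_0_iff_AE) (auto simp: le)
  have "AE x in lborel. (x :: real^3) \<noteq> 0" by (rule AE_lborel_singleton)
  then have nz: "AE x in lebesgue. (x :: real^3) \<noteq> 0" by (rule AE_completion)
  \<comment> \<open>A single good point is enough: the direction is constant and both sides are
    homogeneous of degree 6.\<close>
  have "\<exists>x. x \<noteq> 0 \<and> Q x = u (norm x) \<and> F \<omega> * norm (Q x) ^ 6 - F (Q x) = 0"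
  proof (rule ccontr)
    assume neg: "\<not> ?thesis"
    have "AE x in (lebesgue :: (real^3) measure). False" using FQ Qu nz by eventually_elim (use neg in blast)
    then show False using not_AE_lebesgue_False by blast
  qed
  then obtain x where x: "x \<noteq> 0" "Q x = u (norm x)" "F \<omega> * norm (Q x) ^ 6 - F (Q x) = 0" by blast
  define t where "t = sqrt (2 * M * b / ((norm x)\<^sup>2 + b\<^sup>2))"
  have "(norm x)\<^sup>2 + b\<^sup>2 > 0" using bM(1) by (simp add: add_nonneg_pos)
  then have t: "t > 0" using bM by (simp add: t_def)
  have "Q x = t *\<^sub>R e" using x ue[of "norm x"] by (simp add: t_def)
  then have Fe: "F e = F \<omega>" using x(3) t bM(3) F_hom[of t e] by (simp add: power_mult_distrib)
  have arg: "is_arg_max F (\<lambda>u. u \<in> sphere 0 1) e"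
    using \<omega> bM(3) Fe by (simp add: is_arg_max_def)
  have mue: "mu F e = mu F \<omega>" by (simp add: mu_def Fe)
  \<comment> \<open>Two expressions for the energy of the extremal profile; comparing them fixes the
    amplitude \<open>M\<close> in terms of \<open>mu\<close>.\<close>
  have "3 * pi * M / 8 = (mu F \<omega>)\<^sup>2 * talenti"
    using kE kappa_pos unfolding eq bM(4) by simp
  then have M: "2 * M = sqrt 3 * (mu F \<omega>)\<^sup>2" by (simp add: talenti_def)
  \<comment> \<open>This dilation matches the length scales, since
    \<open>1 + (norm (s *\<^sub>R x))\<^sup>2 / 3\<close> becomes
    \<open>((norm x)\<^sup>2 + b\<^sup>2) / b\<^sup>2\<close>.\<close>
  define s where "s = sqrt 3 / b"
  have s: "s > 0" using bM(1) by (simp add: s_def)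
  have "AE x in lebesgue. Q x = (sqrt s * mu F e * W (s *\<^sub>R x)) *\<^sub>R e"
    using Qu nz
  proof eventually_elim
    case (elim x)
    define q where "q = (norm x)\<^sup>2 + b\<^sup>2"
    have q: "q > 0" using bM(1) by (simp add: q_def add_nonneg_pos)
    have "(W (s *\<^sub>R x))\<^sup>2 = Wpow (- 1) (s *\<^sub>R x)" by (simp add: W_eq Wpow_power)
    also have "\<dots> = 1 / (1 + (norm (s *\<^sub>R x))\<^sup>2 / 3)"
      unfolding Wpow_def using base_pos[of "s *\<^sub>R x"] by (subst powr_minus_divide) simp
    also have "1 + (norm (s *\<^sub>R x))\<^sup>2 / 3 = q / b\<^sup>2"
      using bM(1) by (simp add: s_def q_def power_mult_distrib power_divide field_simps)
    finally have W2: "(W (s *\<^sub>R x))\<^sup>2 = b\<^sup>2 / q" by simp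
    have "(sqrt s * mu F \<omega> * W (s *\<^sub>R x))\<^sup>2 = s * (mu F \<omega>)\<^sup>2 * (b\<^sup>2 / q)"
      using s by (simp add: power_mult_distrib W2)
    also have "\<dots> = 2 * M * b / q" unfolding M s_def using bM(1) by (simp add: power2_eq_square)
    finally have "(sqrt s * mu F \<omega> * W (s *\<^sub>R x))\<^sup>2 = 2 * M * b / q" .
    moreover have "sqrt s * mu F \<omega> * W (s *\<^sub>R x) \<ge> 0"
      using s mu(1) Wpow_pos[of "- 1 / 2" "s *\<^sub>R x"] by (simp add: W_eq)
    ultimately have "sqrt (2 * M * b / q) = sqrt s * mu F \<omega> * W (s *\<^sub>R x)"
      by (metis real_sqrt_unique)
    then show ?case using elim ue[of "norm x"] by (simp add: q_def mue)
  qed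
  with arg s show "\<exists>e. \<exists>s>0. is_arg_max F (\<lambda>u. u \<in> sphere 0 1) e \<and>
        (AE x in lebesgue. Q x = (sqrt s * mu F e * W (s *\<^sub>R x)) *\<^sub>R e)" by blast
qed

text \<open>\<open>mu\<close> is normalized by \<open>6 * F \<omega> * mu ^ 4 = 1\<close>. This one
  relation reduces the equation to that of \<open>W\<close> and also gives the constraint of
  \<open>nehari\<close>.\<close>

lemma ground_state:
  assumes \<omega>: "is_arg_max F (\<lambda>u. u \<in> sphere 0 1) \<omega>" and G: "F \<omega> > 0"
  defines "Z \<equiv> \<lambda>x. (mu F \<omega> * W x) *\<^sub>R \<omega>"
  shows "Z \<in> stationary f" "Z \<in> nehari F" "dirichlet Z = kappa * ((mu F \<omega>)\<^sup>2 * talenti)"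
proof -
  note mu = mu_power4[where F = F and \<omega> = \<omega>, OF G]
  note T = Talenti_multiple[OF mu(1) arg_max_bound(1)[OF \<omega>], folded Z_def]
  have Wp: "W x > 0" for x by (simp add: W_eq Wpow_pos)
  have fZ: "f (Z x) = (mu F \<omega> * W x ^ 5) *\<^sub>R \<omega>" for x
  proof -
    have "f (Z x) = (6 * F \<omega> * (mu F \<omega> * W x) ^ 5) *\<^sub>R \<omega>"
      unfolding Z_def using mu(1) Wp[of x] by (intro f_arg_max[OF \<omega>]) simp
    also have "6 * F \<omega> * (mu F \<omega> * W x) ^ 5 = (mu F \<omega> ^ 4 * (6 * F \<omega>)) * (mu F \<omega> * W x ^ 5)"
      by (simp add: power_mult_distrib eval_nat_numeral)
    finally show ?thesis unfolding mu(2) by simp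
  qed
  show "Z \<in> stationary f" using T(1,3) by (simp add: stationary_def fZ)
  show dZ: "dirichlet Z = kappa * ((mu F \<omega>)\<^sup>2 * talenti)" by (rule T(2))
  have "F (Z x) = (mu F \<omega> ^ 6 * F \<omega>) * W x ^ 6" for x
    unfolding Z_def using mu(1) Wp[of x] by (subst F_hom) (auto simp: power_mult_distrib)
  then have "potential F Z = mu F \<omega> ^ 6 * F \<omega> * (kappa * talenti)"
    unfolding potential_def using T(4) by simp
  then have "6 * potential F Z = (mu F \<omega> ^ 4 * (6 * F \<omega>)) * ((mu F \<omega>)\<^sup>2 * (kappa * talenti))"
    by (simp add: eval_nat_numeral)
  also have "\<dots> = dirichlet Z" unfolding mu(2) dZ by simp
  finally show "Z \<in> nehari F" using T(1) by (simp add: nehari_def)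
qed

end

text \<open>The dilation of \<open>Q(x)\<close> to \<open>sqrt s * Q(s x)\<close> preserves the
  potential and the Dirichlet integral, so every dilate of a minimizer is again a minimizer. The
  converse must therefore admit the factor \<open>s\<close>, and it identifies functions only up to
  null sets.\<close>

theorem proposition3p9:
  fixes F :: "real^'m \<Rightarrow> real" and f :: "real^'m \<Rightarrow> real^'m"
  assumes F_C3: "Ck 3 F"
    and F_hom: "\<And>c x. c \<ge> 0 \<Longrightarrow> F (c *\<^sub>R x) = c ^ 6 * F x"
    and f_grad: "\<And>x. GDERIV F x :> f x"
  shows "(stationary f \<noteq> {} \<longleftrightarrow> (\<exists>u. F u > 0)) \<and>
    ((\<exists>u. F u > 0) \<longrightarrow>
      (\<forall>\<omega>. is_arg_max F (\<lambda>u. u \<in> sphere 0 1) \<omega> \<longrightarrow>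
        (\<lambda>x. (mu F \<omega> * W x) *\<^sub>R \<omega>) \<in> stationary f \<and>
        is_arg_min (potential F) (\<lambda>Q. Q \<in> nehari F) (\<lambda>x. (mu F \<omega> * W x) *\<^sub>R \<omega>))) \<and>
    (\<forall>Z. is_arg_min (potential F) (\<lambda>Q. Q \<in> nehari F) Z \<longrightarrow>
      (\<exists>\<omega>. \<exists>s>0. is_arg_max F (\<lambda>u. u \<in> sphere 0 1) \<omega> \<and>
        (AE x in lebesgue. Z x = (sqrt s * mu F \<omega> * W (s *\<^sub>R x)) *\<^sub>R \<omega>)))"
proof -
  interpret homogeneous_potential F f by unfold_locales fact+
  obtain \<omega>0 where \<omega>0: "is_arg_max F (\<lambda>u. u \<in> sphere 0 1) \<omega>0" using exists_arg_max by blast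
  \<comment> \<open>On the constraint set, minimizing the potential is the same as minimizing the
    Dirichlet integral, to which \<open>nehari_bound\<close> applies.\<close>
  have pot: "potential F Q = dirichlet Q / 6" if "Q \<in> nehari F" for Q
    using that by (auto simp: nehari_def)
  have gs: "(\<lambda>x. (mu F \<omega> * W x) *\<^sub>R \<omega>) \<in> stationary f \<and>
      is_arg_min (potential F) (\<lambda>Q. Q \<in> nehari F) (\<lambda>x. (mu F \<omega> * W x) *\<^sub>R \<omega>)"
    if \<omega>: "is_arg_max F (\<lambda>u. u \<in> sphere 0 1) \<omega>" and pos: "F v > 0" for \<omega> v
  proof -
    note g = ground_state[OF \<omega> arg_max_pos[OF \<omega> pos]]
    have "\<not> potential F Q < potential F (\<lambda>x. (mu F \<omega> * W x) *\<^sub>R \<omega>)" if Q: "Q \<in> nehari F" for Q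
      using nehari_bound(1)[OF Q \<omega>] by (simp add: pot[OF Q] pot[OF g(2)] g(3))
    then show ?thesis using g by (auto simp: is_arg_min_def)
  qed
  have "\<exists>\<omega>. \<exists>s>0. is_arg_max F (\<lambda>u. u \<in> sphere 0 1) \<omega> \<and>
        (AE x in lebesgue. Z x = (sqrt s * mu F \<omega> * W (s *\<^sub>R x)) *\<^sub>R \<omega>)"
    if Z: "is_arg_min (potential F) (\<lambda>Q. Q \<in> nehari F) Z" for Z
  proof -
    have ZN: "Z \<in> nehari F" using Z by (simp add: is_arg_min_def)
    obtain v where v: "F v > 0" using nehari_pos[OF ZN] by blast
    note g = ground_state[OF \<omega>0 arg_max_pos[OF \<omega>0 v]]
    have "potential F Z \<le> potential F (\<lambda>x. (mu F \<omega>0 * W x) *\<^sub>R \<omega>0)"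
      using Z g(2) by (auto simp: is_arg_min_def not_less)
    then have "dirichlet Z \<le> kappa * ((mu F \<omega>0)\<^sup>2 * talenti)"
      by (simp add: pot[OF ZN] pot[OF g(2)] g(3))
    then show ?thesis
      using nehari_bound[OF ZN \<omega>0] by (meson order_antisym)
  qed
  moreover have "stationary f \<noteq> {} \<longleftrightarrow> (\<exists>u. F u > 0)"
    using stationary_imp_positive gs[OF \<omega>0] by blast
  ultimately show ?thesis using gs by blast
qed

end
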